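(* For each integer $n\ge1$, let $\boldsymbol{X}$ and $\boldsymbol{Y}$ be independent random matrices from $\mathrm{GUE}(n)$ and set $$ \alpha_n=\frac{\mathbb{E}\left[\operatorname{Tr}\left(e^{\boldsymbol{X}}e^{\boldsymbol{Y}}\right)\right]}{\mathbb{E}\left[\operatorname{Tr}\left(e^{\boldsymbol{X}+\boldsymbol{Y}}\right)\right]}. $$ Then $$ \lim_{n\to\infty}\frac{\ln\alpha_n}{\sqrt n}=2(\sqrt2-1). $$
   Context: $\mathrm{GUE}(n)$ is the ensemble of random Hermitian matrices $\boldsymbol{A}=\frac12(\boldsymbol{Z}+\boldsymbol{Z}^\dagger)$, where $\boldsymbol{Z}=(z_{ij})_{n\times n}$ has i.i.d. standard complex Gaussian entries, i.e. the real and imaginary parts of $z_{ij}$ are independent $N(0,\frac12)$ real normal variables (mean $0$, variance $\frac12$). Equivalently, $\boldsymbol{A}$ has density $\frac{2^{\binom n2}}{\pi^{n^2/2}}\exp(-\operatorname{Tr}(\boldsymbol{A}^2))$ with respect to Lebesgue measure on the diagonal entries and the real and imaginary parts of the strictly upper triangular entries. $\ln$ is the natural logarithm. *)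

theory Defs
  imports
    "HOL-Probability.Probability"
    "Jordan_Normal_Form.Matrix"
    "Jordan_Normal_Form.Schur_Decomposition"
begin

definition mat_trace :: "'a :: comm_monoid_add mat \<Rightarrow> 'a" where
  "mat_trace A = (\<Sum>i<dim_row A. A $$ (i, i))"

text \<open>The power series of the exponential, summed entrywise; it converges for every square
  matrix (see \<open>summable_mat_exp\<close> below).\<close>

definition mat_exp :: "complex mat \<Rightarrow> complex mat" where
  "mat_exp A = mat (dim_row A) (dim_row A) (\<lambda>ij. \<Sum>k. (A ^\<^sub>m k) $$ ij / fact k)"

text \<open>The Borel sigma-algebra on the complex \<open>n \<times> n\<close> matrices, transported from the product
  sigma-algebra along the map that sends a matrix to its family of entries.\<close>

definition mat_borel :: "nat \<Rightarrow> complex mat measure" where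
  "mat_borel n = vimage_algebra (carrier_mat n n)
     (\<lambda>A. \<lambda>ij\<in>{..<n} \<times> {..<n}. A $$ ij) (PiM ({..<n} \<times> {..<n}) (\<lambda>_. borel))"

text \<open>The second argument of \<^const>\<open>normal_density\<close> is the standard deviation, so real and
  imaginary part have variance \<open>1/2\<close>.\<close>

definition std_complex_gaussian :: "complex measure" where
  "std_complex_gaussian =
     (let N = density lborel (\<lambda>x. ennreal (normal_density 0 (sqrt (1/2)) x))
      in distr (N \<Otimes>\<^sub>M N) borel (\<lambda>(x, y). Complex x y))"

definition gue :: "nat \<Rightarrow> complex mat measure" where
  "gue n = distr (PiM ({..<n} \<times> {..<n}) (\<lambda>_. std_complex_gaussian)) (mat_borel n)
     (\<lambda>z. let Z = mat n n z in (1/2) \<cdot>\<^sub>m (Z + mat_adjoint Z))"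

definition is_gue :: "'w measure \<Rightarrow> nat \<Rightarrow> ('w \<Rightarrow> complex mat) \<Rightarrow> bool" where
  "is_gue M n X \<longleftrightarrow> X \<in> measurable M (mat_borel n) \<and> distr M (mat_borel n) X = gue n"

section \<open>Well-definedness\<close>

lemma mat_adjoint_dims [simp]:
  "dim_row (mat_adjoint A) = dim_col A" "dim_col (mat_adjoint A) = dim_row A"
  by (simp_all add: mat_adjoint_def)

lemma mat_adjoint_index [simp]:
  "i < dim_col A \<Longrightarrow> j < dim_row A \<Longrightarrow> mat_adjoint (A :: complex mat) $$ (i, j) = cnj (A $$ (j, i))"
  by (simp add: mat_adjoint_def mat_of_rows_def)

lemma mat_exp_carrier [simp]: "A \<in> carrier_mat n n \<Longrightarrow> mat_exp A \<in> carrier_mat n n"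
  by (auto simp: mat_exp_def)

lemma mult_mat_entry:
  assumes "A \<in> carrier_mat n n" "B \<in> carrier_mat n n" "i < n" "j < n"
  shows "(A * B) $$ (i, j) = (\<Sum>l<n. A $$ (i, l) * B $$ (l, j))"
  using assms by (simp add: scalar_prod_def atLeast0LessThan)

lemma pow_mat_entry_bound:
  fixes A :: "complex mat"
  assumes A: "A \<in> carrier_mat n n"
    and b: "\<And>i j. i < n \<Longrightarrow> j < n \<Longrightarrow> norm (A $$ (i, j)) \<le> b"
    and ij: "i < n" "j < n"
  shows "norm ((A ^\<^sub>m k) $$ (i, j)) \<le> (real n * b) ^ k"
  using ij
proof (induction k arbitrary: j)
  case 0
  then show ?case using A by auto
next
  case (Suc k)
  have b0: "0 \<le> b" using b[OF Suc.prems] norm_ge_zero order_trans by blast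
  have "(A ^\<^sub>m Suc k) $$ (i, j) = (\<Sum>l<n. (A ^\<^sub>m k) $$ (i, l) * A $$ (l, j))"
    using mult_mat_entry[OF pow_carrier_mat[OF A] A Suc.prems] by simp
  also have "norm \<dots> \<le> (\<Sum>l<n. (real n * b) ^ k * b)"
    by (intro sum_norm_le) (auto simp: norm_mult intro!: mult_mono zero_le_power mult_nonneg_nonneg Suc.IH b Suc.prems b0)
  also have "\<dots> = (real n * b) ^ Suc k" by simp
  finally show ?case .
qed

lemma summable_mat_exp:
  fixes A :: "complex mat"
  assumes A: "A \<in> carrier_mat n n" and ij: "i < n" "j < n"
  shows "summable (\<lambda>k. (A ^\<^sub>m k) $$ (i, j) / fact k)"
proof -
  define b where "b = Max ((\<lambda>ij. norm (A $$ ij)) ` ({..<n} \<times> {..<n}))"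
  have b: "norm (A $$ (i, j)) \<le> b" if "i < n" "j < n" for i j
    unfolding b_def using that by (intro Max_ge) auto
  show ?thesis
  proof (rule summable_comparison_test')
    show "summable (\<lambda>k. inverse (fact k) * (real n * b) ^ k)"
      by (rule summable_exp)
    show "norm ((A ^\<^sub>m k) $$ (i, j) / fact k) \<le> inverse (fact k) * (real n * b) ^ k" for k
      using pow_mat_entry_bound[OF A b ij, of k]
      by (simp add: norm_divide divide_simps)
  qed
qed

lemma mat_adjoint_smult_add_self:
  "mat_adjoint ((1/2) \<cdot>\<^sub>m (mat n n z + mat_adjoint (mat n n z)))
     = ((1/2) \<cdot>\<^sub>m (mat n n z + mat_adjoint (mat n n z)) :: complex mat)"
  by (intro eq_matI) (auto simp: add.commute)

lemma measurable_mat_borel_iff: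
  assumes "f \<in> space M \<rightarrow> carrier_mat n n"
    and "\<And>i j. i < n \<Longrightarrow> j < n \<Longrightarrow> (\<lambda>x. f x $$ (i, j)) \<in> borel_measurable M"
  shows "f \<in> measurable M (mat_borel n)"
  unfolding mat_borel_def
  by (rule measurable_vimage_algebra2) (use assms in \<open>auto intro!: measurable_restrict\<close>)

lemma measurable_mat_borel_entry:
  assumes "i < n" "j < n"
  shows "(\<lambda>A. A $$ (i, j)) \<in> borel_measurable (mat_borel n)"
proof -
  have "(\<lambda>A. \<lambda>ij\<in>{..<n} \<times> {..<n}. A $$ ij)
      \<in> measurable (mat_borel n) (PiM ({..<n} \<times> {..<n}) (\<lambda>_. borel :: complex measure))"
    unfolding mat_borel_def
    by (rule measurable_vimage_algebra1) (auto simp: space_PiM)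
  from measurable_compose[OF this measurable_component_singleton[of "(i, j)"]] assms
  show ?thesis by simp
qed

lemma space_mat_borel [simp]: "space (mat_borel n) = carrier_mat n n"
  by (simp add: mat_borel_def)

lemma sets_std_complex_gaussian [simp, measurable_cong]: "sets std_complex_gaussian = sets borel"
  by (simp add: std_complex_gaussian_def Let_def)

lemma prob_space_std_complex_gaussian: "prob_space std_complex_gaussian"
proof -
  define N where "N = density lborel (\<lambda>x. ennreal (normal_density 0 (sqrt (1/2)) x))"
  interpret N: prob_space N
    unfolding N_def by (rule prob_space_normal_density) simp
  interpret NN: pair_prob_space N N ..
  have "(\<lambda>p. Complex (fst p) (snd p)) \<in> borel_measurable (N \<Otimes>\<^sub>M N)"
    unfolding Complex_eq N_def by measurable
  then show ?thesis
    unfolding std_complex_gaussian_def Let_def N_def[symmetric] case_prod_beta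
    by (rule NN.prob_space_distr)
qed

lemma measurable_gue_map:
  "(\<lambda>z. let Z = mat n n z in (1/2) \<cdot>\<^sub>m (Z + mat_adjoint Z))
     \<in> measurable (PiM ({..<n} \<times> {..<n}) (\<lambda>_. std_complex_gaussian)) (mat_borel n)"
proof (rule measurable_mat_borel_iff, goal_cases)
  case 1
  then show ?case by (auto simp: Let_def)
next
  case (2 i j)
  have [measurable]: "(\<lambda>z. z (k, l)) \<in> borel_measurable
      (PiM ({..<n} \<times> {..<n}) (\<lambda>_. std_complex_gaussian))" if "k < n" "l < n" for k l
    using measurable_component_singleton[of "(k, l)" "{..<n} \<times> {..<n}" "\<lambda>_. std_complex_gaussian"] that
    by simp
  have [measurable]: "cnj \<in> borel_measurable borel"
    by (intro borel_measurable_continuous_onI continuous_intros)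
  have "(\<lambda>z. (z (i, j) + cnj (z (j, i))) / 2) \<in> borel_measurable
      (PiM ({..<n} \<times> {..<n}) (\<lambda>_. std_complex_gaussian))"
    using 2 by measurable
  then show ?case using 2 by (simp add: Let_def)
qed

lemma prob_space_gue: "prob_space (gue n)"
proof -
  interpret prob_space "PiM ({..<n} \<times> {..<n}) (\<lambda>_. std_complex_gaussian)"
    by (intro prob_space_PiM prob_space_std_complex_gaussian)
  show ?thesis
    unfolding gue_def by (rule prob_space_distr) (rule measurable_gue_map)
qed

lemma is_gue_hermitian:
  assumes "is_gue M n X"
  shows "AE \<omega> in M. X \<omega> \<in> carrier_mat n n \<and> mat_adjoint (X \<omega>) = X \<omega>"
proof -
  define P where "P = (\<lambda>A. \<forall>i<n. \<forall>j<n. cnj (A $$ (j, i)) = (A $$ (i, j) :: complex))"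
  have [measurable]: "cnj \<in> borel_measurable borel"
    by (intro borel_measurable_continuous_onI continuous_intros)
  note [measurable] = measurable_mat_borel_entry
  have P: "{A \<in> space (mat_borel n). P A} \<in> sets (mat_borel n)"
  proof -
    have "{A \<in> space (mat_borel n). P A} = {A \<in> space (mat_borel n). \<forall>i\<in>{..<n}. \<forall>j\<in>{..<n}.
        cnj (A $$ (j, i)) = A $$ (i, j)}"
      by (auto simp: P_def)
    also have "\<dots> \<in> sets (mat_borel n)"
      by (intro sets.sets_Collect_finite_All finite_lessThan) measurable
    finally show ?thesis .
  qed
  have "AE A in gue n. P A"
    unfolding gue_def
    by (subst AE_distr_iff[OF measurable_gue_map P])
       (auto simp: P_def Let_def add.commute)
  then have "AE A in distr M (mat_borel n) X. P A"
    using assms unfolding is_gue_def by metis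
  moreover have X: "X \<in> measurable M (mat_borel n)"
    using assms by (simp add: is_gue_def)
  ultimately have "AE \<omega> in M. P (X \<omega>)"
    by (simp add: AE_distr_iff[OF X P])
  then show ?thesis
  proof (rule AE_mp, intro AE_I2 impI)
    fix \<omega> assume "\<omega> \<in> space M" and *: "P (X \<omega>)"
    then have c: "X \<omega> \<in> carrier_mat n n"
      using measurable_space[OF X] by simp
    then show "X \<omega> \<in> carrier_mat n n \<and> mat_adjoint (X \<omega>) = X \<omega>"
      using * by (auto simp: P_def intro!: eq_matI)
  qed
qed

lemma mat_adjoint_pow_entry:
  fixes A :: "complex mat"
  assumes A: "A \<in> carrier_mat n n" and h: "mat_adjoint A = A" and ij: "i < n" "j < n"
  shows "cnj ((A ^\<^sub>m k) $$ (i, j)) = (A ^\<^sub>m k) $$ (j, i)"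
  using ij
proof (induction k arbitrary: i j)
  case 0
  then show ?case using A by auto
next
  case (Suc k)
  have step: "(A ^\<^sub>m Suc k) $$ (i, j) = (\<Sum>l<n. (A ^\<^sub>m k) $$ (i, l) * A $$ (l, j))"
    if "i < n" "j < n" for i j
    using mult_mat_entry[OF pow_carrier_mat[OF A] A that] by simp
  have comm: "A ^\<^sub>m k * A = A * A ^\<^sub>m k"
  proof (induction k)
    case 0
    then show ?case using A by simp
  next
    case (Suc k)
    have "A ^\<^sub>m Suc k * A = (A * A ^\<^sub>m k) * A" using Suc by simp
    also have "\<dots> = A * A ^\<^sub>m Suc k"
      using assoc_mult_mat[OF A pow_carrier_mat[OF A, of k] A] by simp
    finally show ?case .
  qed
  have step': "(A ^\<^sub>m Suc k) $$ (i, j) = (\<Sum>l<n. A $$ (i, l) * (A ^\<^sub>m k) $$ (l, j))"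
    if "i < n" "j < n" for i j
    unfolding pow_mat.simps comm by (rule mult_mat_entry[OF A pow_carrier_mat[OF A] that])
  have hA: "cnj (A $$ (l, m)) = A $$ (m, l)" if "l < n" "m < n" for l m
    using A that mat_adjoint_index[of m A l] h by simp
  show ?case
    unfolding step[OF Suc.prems] step'[OF Suc.prems(2,1)]
    by (simp add: cnj_sum, intro sum.cong) (use Suc in \<open>auto simp: hA\<close>)
qed

lemma mat_exp_hermitian:
  assumes A: "A \<in> carrier_mat n n" and h: "mat_adjoint A = A"
  shows "mat_adjoint (mat_exp A) = mat_exp A"
proof (rule eq_matI)
  fix i j assume "i < dim_row (mat_exp A)" "j < dim_col (mat_exp A)"
  then have ij: "i < n" "j < n" using A by (auto simp: mat_exp_def)
  have "cnj (\<Sum>k. (A ^\<^sub>m k) $$ (j, i) / fact k) = (\<Sum>k. cnj ((A ^\<^sub>m k) $$ (j, i) / fact k))"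
    using bounded_linear.suminf[OF bounded_linear_cnj summable_mat_exp[OF A ij(2,1)]] .
  also have "\<dots> = (\<Sum>k. (A ^\<^sub>m k) $$ (i, j) / fact k)"
    using mat_adjoint_pow_entry[OF A h ij(2,1)] by simp
  finally show "mat_adjoint (mat_exp A) $$ (i, j) = mat_exp A $$ (i, j)"
    using ij A by (simp add: mat_exp_def)
qed (use A in \<open>auto simp: mat_exp_def\<close>)

lemma Im_trace_hermitian:
  assumes A: "A \<in> carrier_mat n n" and h: "mat_adjoint A = A"
  shows "Im (mat_trace A) = 0"
proof -
  have "cnj (A $$ (i, i)) = A $$ (i, i)" if "i < n" for i
    using A that mat_adjoint_index[of i A i] h by simp
  then have "Im (A $$ (i, i)) = 0" if "i < n" for i
    using that by (metis Reals_cnj_iff complex_is_Real_iff)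
  then show ?thesis using A by (simp add: mat_trace_def)
qed

lemma Im_trace_mult_hermitian:
  assumes A: "A \<in> carrier_mat n n" "mat_adjoint A = A"
    and B: "B \<in> carrier_mat n n" "mat_adjoint B = B"
  shows "Im (mat_trace (A * B)) = 0"
proof -
  have hA: "cnj (A $$ (l, m)) = A $$ (m, l)" and hB: "cnj (B $$ (l, m)) = B $$ (m, l)"
    if "l < n" "m < n" for l m
    using that A B mat_adjoint_index[of m A l] mat_adjoint_index[of m B l] by simp_all
  have tr: "mat_trace (A * B) = (\<Sum>i<n. \<Sum>j<n. A $$ (i, j) * B $$ (j, i))"
    using A B by (simp add: mat_trace_def scalar_prod_def atLeast0LessThan)
  have "cnj (mat_trace (A * B)) = (\<Sum>i<n. \<Sum>j<n. A $$ (j, i) * B $$ (i, j))"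
    unfolding tr by (simp add: cnj_sum hA hB)
  also have "\<dots> = mat_trace (A * B)"
    unfolding tr by (rule sum.swap)
  finally show ?thesis by (metis Reals_cnj_iff complex_is_Real_iff)
qed

lemma Im_integral_eq_0:
  fixes f :: "'w \<Rightarrow> complex"
  assumes "AE \<omega> in M. Im (f \<omega>) = 0"
  shows "Im (integral\<^sup>L M f) = 0"
proof (cases "integrable M f")
  case True
  then have "Im (integral\<^sup>L M f) = (\<integral>\<omega>. Im (f \<omega>) \<partial>M)"
    by (simp add: integral_Im)
  also have "\<dots> = 0"
    using assms by (rule integral_eq_zero_AE)
  finally show ?thesis .
qed (simp add: not_integrable_integral_eq)

text \<open>Both expectations of traces are real, so that passing to the real part of their quotient
  does not change it.\<close>

lemma gue_trace_expectations_real: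
  assumes "is_gue M n X" "is_gue M n Y"
  shows "Im (\<integral>\<omega>. mat_trace (mat_exp (X \<omega>) * mat_exp (Y \<omega>)) \<partial>M) = 0"
    and "Im (\<integral>\<omega>. mat_trace (mat_exp (X \<omega> + Y \<omega>)) \<partial>M) = 0"
proof -
  have sum_h: "mat_adjoint (A + B) = A + B"
    if A: "A \<in> carrier_mat n n" "mat_adjoint A = A" and B: "B \<in> carrier_mat n n" "mat_adjoint B = B"
    for A B :: "complex mat"
  proof (rule eq_matI)
    fix i j assume "i < dim_row (A + B)" "j < dim_col (A + B)"
    then have "i < n" "j < n" using A B by auto
    then have "cnj (A $$ (j, i)) = A $$ (i, j)" "cnj (B $$ (j, i)) = B $$ (i, j)"
      using A B mat_adjoint_index[of i A j] mat_adjoint_index[of i B j] by simp_all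
    then show "mat_adjoint (A + B) $$ (i, j) = (A + B) $$ (i, j)"
      using \<open>i < n\<close> \<open>j < n\<close> A B by simp
  qed (use A B in auto)
  note h = is_gue_hermitian[OF assms(1)] is_gue_hermitian[OF assms(2)]
  show "Im (\<integral>\<omega>. mat_trace (mat_exp (X \<omega>) * mat_exp (Y \<omega>)) \<partial>M) = 0"
    using h by (intro Im_integral_eq_0, eventually_elim)
      (rule Im_trace_mult_hermitian[where n = n]; auto intro: mat_exp_hermitian)
  show "Im (\<integral>\<omega>. mat_trace (mat_exp (X \<omega> + Y \<omega>)) \<partial>M) = 0"
    using h by (intro Im_integral_eq_0, eventually_elim)
      (rule Im_trace_hermitian[where n = n]; auto intro!: mat_exp_hermitian[where n = n] sum_h)
qed

end

theory Submission
  imports Defs "HOL-Real_Asymp.Real_Asymp"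
begin

text \<open>
  By independence, the numerator is \<open>\<Sum> P\<^sub>u\<^sub>v P\<^sub>v\<^sub>u\<close> with \<open>P = E e\<^sup>X\<close>, which lies between
  \<open>(tr P)\<^sup>2 / n\<close> and \<open>n\<^sup>2\<close> times the square of the largest entry; such polynomial factors do not
  matter after division by \<open>\<surd>n\<close>. The entries of \<open>X\<close>, and of \<open>X + Y\<close>, satisfy Wick's formula with
  covariance \<open>E A\<^sub>i\<^sub>j A\<^sub>k\<^sub>l = \<kappa> \<delta>\<^sub>i\<^sub>l \<delta>\<^sub>j\<^sub>k\<close>, where \<open>\<kappa> = 1/2\<close> and \<open>\<kappa> = 1\<close> respectively, so it suffices to show
  that \<open>ln E tr e\<^sup>A \<sim> 2 \<surd>(\<kappa> n)\<close> for such matrices.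

  Gaussian integration by parts gives
  \<open>E tr A\<^sup>k\<^sup>+\<^sup>2 = \<kappa> \<Sum>\<^sub>a E (tr A\<^sup>a tr A\<^sup>k\<^sup>-\<^sup>a)\<close>, summed over \<open>0 \<le> a \<le> k\<close>. Since all covariances are nonnegative, two
  polynomials \<open>f\<close>, \<open>g\<close> in the entries with nonnegative coefficients satisfy
  \<open>E f E g \<le> E (f g) \<le> E f E g + \<kappa> \<Sum> E (\<partial>\<^sub>i\<^sub>j f \<partial>\<^sub>j\<^sub>i g)\<close>: the Wick pairings of \<open>f g\<close> either do not
  link \<open>f\<close> to \<open>g\<close>, or are counted by one of their links. For traces of powers the last sum is
  \<open>a b E tr A\<^sup>a\<^sup>+\<^sup>b\<^sup>-\<^sup>2\<close>. The resulting recursive inequalities compare the moments with the Catalan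
  recursion and yield, with \<open>C\<^sub>i\<close> the Catalan numbers,
  \<open>n C\<^sub>i (\<kappa> n)\<^sup>i \<le> E tr A\<^sup>2\<^sup>i \<le> n C\<^sub>i (\<kappa> (n + i \<surd>i))\<^sup>i\<close>.
  As only \<open>i\<close> of order \<open>\<surd>n\<close> contribute to \<open>E tr e\<^sup>A\<close>, the correction \<open>i \<surd>i\<close> is negligible.
\<close>

section \<open>Wick's formula under linear maps and sums of independent families\<close>

section \<open>Wick calculus\<close>

text \<open>Wick's formula in the form of its one-step recursion: the factor \<open>x v\<close> is
  paired with each remaining factor in turn, and iteration gives the sum over all pairings.
  Multisets index the monomials, so repeated factors count with multiplicity. On a probability space
  \<open>C v w\<close> is the expectation of \<open>x v * x w\<close> without conjugation, the
  bilinear form that complex linear maps transport.\<close>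

definition wick :: "'w measure \<Rightarrow> 'v set \<Rightarrow> ('v \<Rightarrow> 'w \<Rightarrow> complex) \<Rightarrow> ('v \<Rightarrow> 'v \<Rightarrow> complex) \<Rightarrow> bool" where
  "wick M V x C \<longleftrightarrow>
     (\<forall>A. set_mset A \<subseteq> V \<longrightarrow> integrable M (\<lambda>\<omega>. \<Prod>v\<in>#A. x v \<omega>)) \<and>
     (\<forall>v\<in>V. \<forall>A. set_mset A \<subseteq> V \<longrightarrow>
        (\<integral>\<omega>. x v \<omega> * (\<Prod>w\<in>#A. x w \<omega>) \<partial>M) =
        (\<Sum>w\<in>#A. C v w * (\<integral>\<omega>. (\<Prod>u\<in>#A - {#w#}. x u \<omega>) \<partial>M)))"

lemma wick_integrable: "wick M V x C \<Longrightarrow> set_mset A \<subseteq> V \<Longrightarrow> integrable M (\<lambda>\<omega>. \<Prod>v\<in>#A. x v \<omega>)"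
  by (simp add: wick_def)

lemma wick_step:
  "wick M V x C \<Longrightarrow> v \<in> V \<Longrightarrow> set_mset A \<subseteq> V \<Longrightarrow>
     (\<integral>\<omega>. x v \<omega> * (\<Prod>w\<in>#A. x w \<omega>) \<partial>M) =
     (\<Sum>w\<in>#A. C v w * (\<integral>\<omega>. (\<Prod>u\<in>#A - {#w#}. x u \<omega>) \<partial>M))"
  by (simp add: wick_def)

lemma prod_mset_cong_on:
  assumes "\<And>v. v \<in> V \<Longrightarrow> f v = g v" "set_mset A \<subseteq> V"
  shows "(\<Prod>v\<in>#A. f v) = (\<Prod>v\<in>#A. g v :: 'a :: comm_monoid_mult)"
  using assms by (intro arg_cong[where f = prod_mset] image_mset_cong) auto

lemma wick_cong:
  assumes w: "wick M V x C"
    and x: "\<And>v \<omega>. v \<in> V \<Longrightarrow> \<omega> \<in> space M \<Longrightarrow> x v \<omega> = y v \<omega>"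
    and C: "\<And>v w. v \<in> V \<Longrightarrow> w \<in> V \<Longrightarrow> C v w = D v w"
  shows "wick M V y D"
proof -
  have P: "(\<Prod>v\<in>#A. y v \<omega>) = (\<Prod>v\<in>#A. x v \<omega>)" if "set_mset A \<subseteq> V" "\<omega> \<in> space M" for A \<omega>
    using that x by (intro prod_mset_cong_on[where V = V]) auto
  have I: "(\<integral>\<omega>. (\<Prod>v\<in>#A. y v \<omega>) \<partial>M) = (\<integral>\<omega>. (\<Prod>v\<in>#A. x v \<omega>) \<partial>M)" if "set_mset A \<subseteq> V" for A
    using that by (intro Bochner_Integration.integral_cong) (auto simp: P)
  have "integrable M (\<lambda>\<omega>. \<Prod>v\<in>#A. y v \<omega>)" if "set_mset A \<subseteq> V" for A
    using wick_integrable[OF w that] by (rule Bochner_Integration.integrable_cong[THEN iffD1, rotated -1]) (auto simp: P that)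
  moreover have "(\<integral>\<omega>. y v \<omega> * (\<Prod>w\<in>#A. y w \<omega>) \<partial>M) =
        (\<Sum>w\<in>#A. D v w * (\<integral>\<omega>. (\<Prod>u\<in>#A - {#w#}. y u \<omega>) \<partial>M))" if v: "v \<in> V" and A: "set_mset A \<subseteq> V" for v A
  proof -
    have "(\<integral>\<omega>. y v \<omega> * (\<Prod>w\<in>#A. y w \<omega>) \<partial>M) = (\<integral>\<omega>. x v \<omega> * (\<Prod>w\<in>#A. x w \<omega>) \<partial>M)"
      using v by (intro Bochner_Integration.integral_cong) (auto simp: P[OF A] x)
    also have "\<dots> = (\<Sum>w\<in>#A. C v w * (\<integral>\<omega>. (\<Prod>u\<in>#A - {#w#}. x u \<omega>) \<partial>M))"
      by (rule wick_step[OF w v A])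
    also have "\<dots> = (\<Sum>w\<in>#A. D v w * (\<integral>\<omega>. (\<Prod>u\<in>#A - {#w#}. y u \<omega>) \<partial>M))"
      using v A by (intro arg_cong[where f = sum_mset] image_mset_cong)
        (auto simp: C I[OF order_trans[OF set_mset_mono[OF diff_subset_eq_self] A]] subset_iff)
    finally show ?thesis .
  qed
  ultimately show ?thesis by (simp add: wick_def)
qed

lemma sum_sum_mset_swap:
  "(\<Sum>v\<in>V. \<Sum>w\<in>#B. f v w) = (\<Sum>w\<in>#B. \<Sum>v\<in>V. f v w :: 'a :: comm_monoid_add)"
  by (induction B) (auto simp: sum.distrib)

lemma sum_mset_cong: "(\<And>v. v \<in># A \<Longrightarrow> f v = g v) \<Longrightarrow> (\<Sum>v\<in>#A. f v) = (\<Sum>v\<in>#A. g v)"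
  by (intro arg_cong[where f = sum_mset] image_mset_cong)

lemma add_mset_diff_single: "w \<in># B \<Longrightarrow> add_mset v B - {#w#} = add_mset v (B - {#w#})"
  by (auto dest!: multi_member_split simp: add_mset_commute)

text \<open>Moments are multilinear in their factors, and so is the recursion. The proof works with
  mixed monomials, in which the new variables are expanded into the old ones one factor at a
  time.\<close>

lemma wick_linear:
  fixes c :: "'u \<Rightarrow> 'v \<Rightarrow> complex"
  assumes w: "wick M V x C" and fin: "finite V"
  shows "wick M U (\<lambda>u \<omega>. \<Sum>v\<in>V. c u v * x v \<omega>) (\<lambda>u u'. \<Sum>v\<in>V. \<Sum>v'\<in>V. c u v * c u' v' * C v v')"
proof -
  define y where "y = (\<lambda>u \<omega>. \<Sum>v\<in>V. c u v * x v \<omega>)"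
  \<comment> \<open>Mixed moments, with the factors \<open>x\<close> indexed by \<open>B\<close> and
    the factors \<open>y\<close> by \<open>A\<close>. The next definition, \<open>D v u\<close>, is
    the covariance of \<open>x v\<close> with \<open>y u\<close>.\<close>
  define I where "I = (\<lambda>B A. \<integral>\<omega>. (\<Prod>v\<in>#B. x v \<omega>) * (\<Prod>u\<in>#A. y u \<omega>) \<partial>M)"
  define D where "D = (\<lambda>v u. \<Sum>v'\<in>V. c u v' * C v v')"
  have expand: "(\<Prod>v\<in>#B. x v \<omega>) * (\<Prod>u\<in>#add_mset u A. y u \<omega>) =
      (\<Sum>v\<in>V. c u v * ((\<Prod>v\<in>#add_mset v B. x v \<omega>) * (\<Prod>u\<in>#A. y u \<omega>)))" for A B u \<omega>
    by (simp add: y_def sum_distrib_left sum_distrib_right mult_ac)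
  have int: "integrable M (\<lambda>\<omega>. (\<Prod>v\<in>#B. x v \<omega>) * (\<Prod>u\<in>#A. y u \<omega>))" if "set_mset B \<subseteq> V" for A B
    using that
  proof (induction A arbitrary: B)
    case empty
    then show ?case using wick_integrable[OF w] by simp
  next
    case (add u A)
    show ?case
      unfolding expand using add.prems by (intro Bochner_Integration.integrable_sum integrable_mult_right add.IH) auto
  qed
  have I_add: "I B (add_mset u A) = (\<Sum>v\<in>V. c u v * I (add_mset v B) A)" if B: "set_mset B \<subseteq> V" for u A B
  proof -
    have "integrable M (\<lambda>\<omega>. x v \<omega> * (\<Prod>v\<in>#B. x v \<omega>) * (\<Prod>u\<in>#A. y u \<omega>))" if "v \<in> V" for v
      using int[of "add_mset v B" A] that B by simp
    then show ?thesis
      unfolding I_def expand by (subst Bochner_Integration.integral_sum) auto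
  qed
  \<comment> \<open>The factor \<open>x v\<close> is paired either within \<open>B\<close> or within
    \<open>A\<close>. Expanding a factor \<open>y u\<close> enlarges \<open>B\<close>, hence
    \<open>B\<close> is arbitrary in the induction on \<open>A\<close>.\<close>
  have stein: "I (add_mset v B) A = (\<Sum>w\<in>#B. C v w * I (B - {#w#}) A) + (\<Sum>u\<in>#A. D v u * I B (A - {#u#}))"
    if v: "v \<in> V" and "set_mset B \<subseteq> V" for v A B
    using that(2)
  proof (induction A arbitrary: B)
    case empty
    then show ?case using wick_step[OF w v empty] by (simp add: I_def)
  next
    case (add u A)
    have "I (add_mset v B) (add_mset u A) = (\<Sum>v'\<in>V. c u v' * I (add_mset v (add_mset v' B)) A)"
      using v add.prems by (subst I_add) (auto simp: add_mset_commute)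
    also have "\<dots> = (\<Sum>v'\<in>V. c u v' * C v v' * I B A
        + (\<Sum>w\<in>#B. c u v' * C v w * I (add_mset v' (B - {#w#})) A)
        + (\<Sum>u'\<in>#A. c u v' * D v u' * I (add_mset v' B) (A - {#u'#})))"
    proof (rule sum.cong[OF refl])
      fix v' assume "v' \<in> V"
      then have "set_mset (add_mset v' B) \<subseteq> V" using add.prems by auto
      from add.IH[OF this]
      have "I (add_mset v (add_mset v' B)) A = C v v' * I B A
         + (\<Sum>w\<in>#B. C v w * I (add_mset v' B - {#w#}) A)
         + (\<Sum>u'\<in>#A. D v u' * I (add_mset v' B) (A - {#u'#}))" by simp
      also have "(\<Sum>w\<in>#B. C v w * I (add_mset v' B - {#w#}) A) = (\<Sum>w\<in>#B. C v w * I (add_mset v' (B - {#w#})) A)"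
        by (rule sum_mset_cong) (simp add: add_mset_diff_single)
      finally show "c u v' * I (add_mset v (add_mset v' B)) A = c u v' * C v v' * I B A
        + (\<Sum>w\<in>#B. c u v' * C v w * I (add_mset v' (B - {#w#})) A)
        + (\<Sum>u'\<in>#A. c u v' * D v u' * I (add_mset v' B) (A - {#u'#}))"
        by (simp add: ring_distribs sum_mset_distrib_left mult.assoc image_mset.compositionality comp_def)
    qed
    also have "\<dots> = D v u * I B A + (\<Sum>w\<in>#B. C v w * (\<Sum>v'\<in>V. c u v' * I (add_mset v' (B - {#w#})) A))
        + (\<Sum>u'\<in>#A. D v u' * (\<Sum>v'\<in>V. c u v' * I (add_mset v' B) (A - {#u'#})))"
      by (simp add: sum.distrib sum_sum_mset_swap D_def sum_distrib_left sum_distrib_right mult_ac)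
    also have "(\<Sum>w\<in>#B. C v w * (\<Sum>v'\<in>V. c u v' * I (add_mset v' (B - {#w#})) A)) = (\<Sum>w\<in>#B. C v w * I (B - {#w#}) (add_mset u A))"
      by (subst I_add) (use add.prems in \<open>auto dest!: in_diffD\<close>)
    also have "(\<Sum>u'\<in>#A. D v u' * (\<Sum>v'\<in>V. c u v' * I (add_mset v' B) (A - {#u'#}))) =
        (\<Sum>u'\<in>#A. D v u' * I B (add_mset u A - {#u'#}))"
    proof (rule sum_mset_cong)
      fix u' assume "u' \<in># A"
      then have "add_mset u A - {#u'#} = add_mset u (A - {#u'#})"
        by (rule add_mset_diff_single)
      then show "D v u' * (\<Sum>v'\<in>V. c u v' * I (add_mset v' B) (A - {#u'#})) = D v u' * I B (add_mset u A - {#u'#})"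
        by (simp add: I_add[OF add.prems])
    qed
    finally show ?case by (simp add: add_ac)
  qed
  have "(\<integral>\<omega>. y u \<omega> * (\<Prod>w\<in>#A. y w \<omega>) \<partial>M) =
      (\<Sum>u'\<in>#A. (\<Sum>v\<in>V. \<Sum>v'\<in>V. c u v * c u' v' * C v v') * (\<integral>\<omega>. (\<Prod>w\<in>#A - {#u'#}. y w \<omega>) \<partial>M))" for u A
  proof -
    have "(\<integral>\<omega>. y u \<omega> * (\<Prod>w\<in>#A. y w \<omega>) \<partial>M) = I {#} (add_mset u A)" by (simp add: I_def)
    also have "\<dots> = (\<Sum>v\<in>V. c u v * I {#v#} A)" by (simp add: I_add)
    also have "\<dots> = (\<Sum>v\<in>V. \<Sum>u'\<in>#A. c u v * D v u' * I {#} (A - {#u'#}))"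
      by (intro sum.cong) (simp_all add: stein sum_mset_distrib_left mult_ac image_mset.compositionality comp_def)
    also have "\<dots> = (\<Sum>u'\<in>#A. (\<Sum>v\<in>V. c u v * D v u') * I {#} (A - {#u'#}))"
      by (simp add: sum_sum_mset_swap sum_distrib_right)
    finally show ?thesis by (simp add: I_def D_def sum_distrib_left mult.assoc)
  qed
  moreover have "integrable M (\<lambda>\<omega>. \<Prod>u\<in>#A. y u \<omega>)" for A
    using int[of "{#}" A] by simp
  ultimately show ?thesis unfolding wick_def y_def by blast
qed

lemma mset_sum_decomp:
  fixes A :: "('a + 'b) multiset"
  obtains A1 A2 where "A = image_mset Inl A1 + image_mset Inr A2"
proof -
  have "\<exists>A1 A2. A = image_mset Inl A1 + image_mset Inr A2"
  proof (induction A)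
    case empty
    then show ?case by auto
  next
    case (add s A)
    then obtain A1 A2 where A: "A = image_mset Inl A1 + image_mset Inr A2" by auto
    show ?case
    proof (cases s)
      case (Inl a)
      then show ?thesis using A by (intro exI[of _ "add_mset a A1"] exI[of _ A2]) simp
    next
      case (Inr a)
      then show ?thesis using A by (intro exI[of _ A1] exI[of _ "add_mset a A2"]) simp
    qed
  qed
  then show ?thesis using that by blast
qed

text \<open>By independence a joint moment is a moment of \<open>x\<close> times a moment of
  \<open>y\<close>, so a factor is paired only within its own family and the cross covariances are
  0. Independence is asked of monomials, the form in which it is inherited from independent
  matrices.\<close>

lemma (in prob_space) wick_indep_Plus:
  assumes x: "wick M V x C" and y: "wick M W y D"
    and indep: "\<And>A B. set_mset A \<subseteq> V \<Longrightarrow> set_mset B \<subseteq> W \<Longrightarrow>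
      indep_var borel (\<lambda>\<omega>. \<Prod>v\<in>#A. x v \<omega>) borel (\<lambda>\<omega>. \<Prod>v\<in>#B. y v \<omega>)"
  shows "wick M (V <+> W) (case_sum x y)
    (case_sum (\<lambda>v. case_sum (C v) (\<lambda>_. 0)) (\<lambda>w. case_sum (\<lambda>_. 0) (D w)))"
proof -
  have dec: "set_mset A1 \<subseteq> V" "set_mset A2 \<subseteq> W"
    if "set_mset (image_mset Inl A1 + image_mset Inr A2) \<subseteq> V <+> W" for A1 A2
    using that by (auto simp: Plus_def)
  have prod: "(\<Prod>v\<in>#image_mset Inl A1 + image_mset Inr A2. case_sum x y v \<omega>) =
      (\<Prod>v\<in>#A1. x v \<omega>) * (\<Prod>v\<in>#A2. y v \<omega>)" for A1 A2 \<omega>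
    by (simp add: image_mset.compositionality comp_def)
  have int: "integrable M (\<lambda>\<omega>. (\<Prod>v\<in>#A1. x v \<omega>) * (\<Prod>v\<in>#A2. y v \<omega>))"
    and factor: "(\<integral>\<omega>. (\<Prod>v\<in>#A1. x v \<omega>) * (\<Prod>v\<in>#A2. y v \<omega>) \<partial>M) =
      (\<integral>\<omega>. (\<Prod>v\<in>#A1. x v \<omega>) \<partial>M) * (\<integral>\<omega>. (\<Prod>v\<in>#A2. y v \<omega>) \<partial>M)"
    if "set_mset A1 \<subseteq> V" "set_mset A2 \<subseteq> W" for A1 A2
    using indep_var_integrable[OF indep[OF that]] indep_var_lebesgue_integral[OF indep[OF that]]
      wick_integrable[OF x] wick_integrable[OF y] that by auto
  have dInl: "image_mset Inl A1 + image_mset Inr A2 - {#Inl v#} = image_mset Inl (A1 - {#v#}) + image_mset Inr A2"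
    if "v \<in># A1" for v and A1 :: "'b multiset" and A2 :: "'c multiset"
    using that by (auto dest!: multi_member_split)
  have dInr: "image_mset Inl A1 + image_mset Inr A2 - {#Inr v#} = image_mset Inl A1 + image_mset Inr (A2 - {#v#})"
    if "v \<in># A2" for v and A1 :: "'b multiset" and A2 :: "'c multiset"
    using that by (auto dest!: multi_member_split)
  show ?thesis
    unfolding wick_def
  proof (intro conjI allI impI ballI)
    fix A :: "('b + 'c) multiset" assume A: "set_mset A \<subseteq> V <+> W"
    obtain A1 A2 where A': "A = image_mset Inl A1 + image_mset Inr A2" by (rule mset_sum_decomp)
    note d = dec[OF A[unfolded A']]
    show "integrable M (\<lambda>\<omega>. \<Prod>v\<in>#A. case_sum x y v \<omega>)"
      unfolding A' prod by (rule int[OF d])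
    fix s assume s: "s \<in> V <+> W"
    show "(\<integral>\<omega>. case_sum x y s \<omega> * (\<Prod>w\<in>#A. case_sum x y w \<omega>) \<partial>M) =
      (\<Sum>w\<in>#A. case_sum (\<lambda>v. case_sum (C v) (\<lambda>_. 0)) (\<lambda>w. case_sum (\<lambda>_. 0) (D w)) s w *
         (\<integral>\<omega>. (\<Prod>u\<in>#A - {#w#}. case_sum x y u \<omega>) \<partial>M))"
    proof (cases s)
      case (Inl v)
      then have v: "v \<in> V" using s by auto
      have d': "set_mset (A1 - {#w#}) \<subseteq> V" for w
        using d(1) by (meson diff_subset_eq_self order_trans set_mset_mono)
      have "(\<integral>\<omega>. case_sum x y s \<omega> * (\<Prod>w\<in>#A. case_sum x y w \<omega>) \<partial>M) =
         (\<integral>\<omega>. (\<Prod>v\<in>#add_mset v A1. x v \<omega>) * (\<Prod>v\<in>#A2. y v \<omega>) \<partial>M)"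
        unfolding A' prod Inl by (simp add: mult_ac)
      also have "\<dots> = (\<integral>\<omega>. x v \<omega> * (\<Prod>v\<in>#A1. x v \<omega>) \<partial>M) * (\<integral>\<omega>. (\<Prod>v\<in>#A2. y v \<omega>) \<partial>M)"
        using v d by (subst factor) auto
      also have "\<dots> = (\<Sum>w\<in>#A1. C v w * ((\<integral>\<omega>. (\<Prod>u\<in>#A1 - {#w#}. x u \<omega>) \<partial>M) * (\<integral>\<omega>. (\<Prod>v\<in>#A2. y v \<omega>) \<partial>M)))"
        by (subst wick_step[OF x v d(1)]) (simp add: sum_mset_distrib_right mult.assoc image_mset.compositionality comp_def)
      also have "\<dots> = (\<Sum>w\<in>#A1. C v w * (\<integral>\<omega>. (\<Prod>u\<in>#A - {#Inl w#}. case_sum x y u \<omega>) \<partial>M))"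
        by (rule sum_mset_cong) (simp only: A' dInl prod factor[OF d' d(2)])
      finally show ?thesis
        unfolding Inl by (simp add: A' image_mset.compositionality comp_def)
    next
      case (Inr v)
      then have v: "v \<in> W" using s by auto
      have d': "set_mset (A2 - {#w#}) \<subseteq> W" for w
        using d(2) by (meson diff_subset_eq_self order_trans set_mset_mono)
      have "(\<integral>\<omega>. case_sum x y s \<omega> * (\<Prod>w\<in>#A. case_sum x y w \<omega>) \<partial>M) =
         (\<integral>\<omega>. (\<Prod>v\<in>#A1. x v \<omega>) * (\<Prod>v\<in>#add_mset v A2. y v \<omega>) \<partial>M)"
        unfolding A' prod Inr by (simp add: mult_ac)
      also have "\<dots> = (\<integral>\<omega>. (\<Prod>v\<in>#A1. x v \<omega>) \<partial>M) * (\<integral>\<omega>. y v \<omega> * (\<Prod>v\<in>#A2. y v \<omega>) \<partial>M)"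
        using v d by (subst factor) auto
      also have "\<dots> = (\<Sum>w\<in>#A2. D v w * ((\<integral>\<omega>. (\<Prod>v\<in>#A1. x v \<omega>) \<partial>M) * (\<integral>\<omega>. (\<Prod>u\<in>#A2 - {#w#}. y u \<omega>) \<partial>M)))"
        by (subst wick_step[OF y v d(2)]) (simp add: sum_mset_distrib_left mult_ac image_mset.compositionality comp_def)
      also have "\<dots> = (\<Sum>w\<in>#A2. D v w * (\<integral>\<omega>. (\<Prod>u\<in>#A - {#Inr w#}. case_sum x y u \<omega>) \<partial>M))"
        by (rule sum_mset_cong) (simp only: A' dInr prod factor[OF d(1) d'])
      finally show ?thesis
        unfolding Inr by (simp add: A' image_mset.compositionality comp_def)
    qed
  qed
qed

text \<open>The sum is the image of the joint family under the linear map that adds the two copies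
  of each index; the block form of the joint covariance leaves the sum of the two blocks.\<close>

lemma (in prob_space) wick_indep_add:
  assumes x: "wick M V x C" and y: "wick M V y D" and fin: "finite V"
    and indep: "\<And>A B. set_mset A \<subseteq> V \<Longrightarrow> set_mset B \<subseteq> V \<Longrightarrow>
      indep_var borel (\<lambda>\<omega>. \<Prod>v\<in>#A. x v \<omega>) borel (\<lambda>\<omega>. \<Prod>v\<in>#B. y v \<omega>)"
  shows "wick M V (\<lambda>v \<omega>. x v \<omega> + y v \<omega>) (\<lambda>v w. C v w + D v w)"
proof -
  have d: "of_bool (u = v) * z = (if u = v then z else 0)" for u v and z :: complex by simp
  show ?thesis
    by (rule wick_cong[OF wick_linear[OF wick_indep_Plus[OF x y indep], where U = V
          and c = "\<lambda>u. case_sum (\<lambda>v. of_bool (u = v)) (\<lambda>v. of_bool (u = v))"]])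
      (use fin in \<open>auto simp: sum.Plus d sum.delta sum.delta' mult.assoc sum_distrib_left[symmetric]\<close>)
qed

section \<open>Catalan numbers: recursion and size\<close>

section \<open>Catalan numbers and exponential sums\<close>

text \<open>The coefficients of \<open>(1 - \<surd>(1 - 4 x)) / (2 x)\<close>, so that the convolution identity is
  Vandermonde's for \<open>1/2 + 1/2 = 1\<close>.\<close>

definition catalan :: "nat \<Rightarrow> real" where
  "catalan k = - ((1/2) gchoose (Suc k)) * (-4) ^ Suc k / 2"

lemma catalan_0: "catalan 0 = 1"
  by (simp add: catalan_def)

lemma catalan_ratio: "catalan (Suc k) = (4 * real k + 2) / (real k + 2) * catalan k"
proof -
  have "real (Suc (Suc k)) * ((1/2::real) gchoose (Suc (Suc k))) = (1/2 - real (Suc k)) * (1/2 gchoose Suc k)"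
    using gbinomial_mult_1[of "1/2 :: real" "Suc k"] by (simp add: algebra_simps)
  then have "((1/2::real) gchoose (Suc (Suc k))) = (1/2 - real (Suc k)) * (1/2 gchoose Suc k) / (real k + 2)"
    by (simp add: field_simps)
  then have eq: "((1/2::real) gchoose (Suc (Suc k))) = - ((2 * real k + 1) / (2 * (real k + 2))) * (1/2 gchoose Suc k)"
    by (simp add: field_simps)
  show ?thesis
    unfolding catalan_def eq by (simp add: divide_simps) (simp add: algebra_simps)
qed

lemma catalan_pos: "0 < catalan k"
  by (induction k) (simp_all add: catalan_0 catalan_ratio)

lemma catalan_convolution: "catalan (Suc k) = (\<Sum>i\<le>k. catalan i * catalan (k - i))"
proof -
  define h where "h = (\<lambda>i. ((1/2::real) gchoose i) * (-4) ^ i)"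
  have h0: "h 0 = 1" and hS: "h (Suc i) = - 2 * catalan i" for i
    by (simp_all add: h_def catalan_def)
  have "(\<Sum>i=0..Suc (Suc k). h i * h (Suc (Suc k) - i)) =
      (\<Sum>i=0..Suc (Suc k). ((1/2::real) gchoose i) * (1/2 gchoose (Suc (Suc k) - i))) * (-4) ^ Suc (Suc k)"
    unfolding sum_distrib_right h_def
    by (intro sum.cong refl) (simp add: power_add[symmetric] mult_ac del: power_Suc)
  \<comment> \<open>The \<open>h i\<close> are the coefficients of the square root of
    \<open>1 - 4 x\<close>, whose square has no term of degree 2 or more: Vandermonde gives
    \<open>1 choose Suc (Suc k)\<close>.\<close>
  also have "\<dots> = 0"
    using binomial_gbinomial[of 1 "Suc (Suc k)", where 'a = real]
    by (subst gbinomial_Vandermonde) simp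
  finally have "(\<Sum>i\<le>Suc (Suc k). h i * h (Suc (Suc k) - i)) = 0"
    by (simp add: atLeast0AtMost)
  \<comment> \<open>The summands \<open>i = 0\<close> and \<open>i = Suc (Suc k)\<close> both equal
    \<open>h (Suc (Suc k))\<close>; the others form the convolution.\<close>
  then have "2 * h (Suc (Suc k)) + (\<Sum>i\<le>k. h (Suc i) * h (Suc (k - i))) = 0"
    by (subst (asm) sum.atMost_Suc, subst (asm) sum.atMost_Suc_shift)
       (simp add: h0 Suc_diff_le)
  then have "4 * catalan (Suc k) = (\<Sum>i\<le>k. 4 * (catalan i * catalan (k - i)))"
    unfolding hS by (simp add: mult_ac)
  then show ?thesis by (simp add: sum_distrib_left[symmetric])
qed

lemma catalan_le: "catalan k \<le> 4 ^ k"
proof (induction k)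
  case (Suc k)
  have "catalan (Suc k) \<le> 4 * catalan k"
    unfolding catalan_ratio using catalan_pos[of k] by (intro mult_right_mono) (auto simp: field_simps)
  then show ?case using Suc by simp
qed (simp add: catalan_0)

text \<open>A polynomial loss is affordable. The square is chosen because
  \<open>(k + 1)^2 * fact (2 * k)\<close> is at most \<open>fact (2 * k + 2)\<close>, which later
  turns the series into a shifted cosh series.\<close>

lemma catalan_ge: "4 ^ k / (real k + 1) ^ 2 \<le> catalan k"
proof (induction k)
  case (Suc k)
  have "4 ^ Suc k / (real (Suc k) + 1) ^ 2 = (4 * (real k + 1)\<^sup>2 / (real k + 2)\<^sup>2) * (4 ^ k / (real k + 1) ^ 2)"
    by (simp add: field_simps)
  also have "\<dots> \<le> ((4 * real k + 2) / (real k + 2)) * catalan k"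
  proof (rule mult_mono[OF _ Suc])
    show "4 * (real k + 1)\<^sup>2 / (real k + 2)\<^sup>2 \<le> (4 * real k + 2) / (real k + 2)"
      by (simp add: divide_simps power2_eq_square) (simp add: algebra_simps)
  qed auto
  finally show ?case by (simp add: catalan_ratio)
qed (simp add: catalan_0)

text \<open>Doubling starts only at index 1, because \<open>catalan 0 = catalan 1\<close>. Together
  the two parts give \<open>2 * catalan k \<le> catalan (k + 2)\<close>, which absorbs the factor 2
  in the covariance terms of the moment recursion.\<close>

lemma catalan_growth: "catalan k \<le> catalan (Suc k)" "2 * catalan (Suc k) \<le> catalan (Suc (Suc k))"
proof -
  show "catalan k \<le> catalan (Suc k)"
    unfolding catalan_ratio using catalan_pos[of k] by (simp add: field_simps)
  show "2 * catalan (Suc k) \<le> catalan (Suc (Suc k))"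
    unfolding catalan_ratio[of "Suc k"] using catalan_pos[of "Suc k"]
    by (intro mult_right_mono) (auto simp: field_simps)
qed

section \<open>Series with denominators \<open>fact (2 * k)\<close> and their logarithmic
  growth\<close>

lemma cosh_sums: "(\<lambda>k. x ^ (2 * k) / fact (2 * k)) sums cosh (x :: real)"
proof -
  have "(\<lambda>n. if even n then x ^ n /\<^sub>R fact n else 0) sums cosh x"
    by (rule cosh_converges)
  moreover have "strict_mono (\<lambda>k::nat. 2 * k)"
    by (simp add: strict_mono_def)
  ultimately have "(\<lambda>k. if even (2 * k) then x ^ (2 * k) /\<^sub>R fact (2 * k) else 0) sums cosh x"
    by (subst sums_mono_reindex) (auto elim!: evenE)
  then show ?thesis by (simp add: field_simps)
qed

text \<open>Keep the term \<open>j = k\<close> of the series of \<open>exp (real k)\<close>.\<close>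

lemma fact_ge_power_exp: "(real k / exp 1) ^ k \<le> fact k"
proof -
  have s: "(\<lambda>j. real k ^ j /\<^sub>R fact j) sums exp (real k)"
    by (rule exp_converges)
  have "(\<Sum>j\<in>{k}. real k ^ j /\<^sub>R fact j) \<le> exp (real k)"
    unfolding sums_unique[OF s] by (rule sum_le_suminf) (use s in \<open>auto simp: sums_iff\<close>)
  then show ?thesis by (simp add: field_simps power_divide exp_of_nat_mult[symmetric])
qed

lemma fact_double_ge: "fact k * real k ^ k \<le> fact (2 * k)"
proof -
  have "fact k * real k ^ m \<le> fact (k + m)" for m
  proof (induction m)
    case (Suc m)
    have "fact k * real k ^ Suc m = real k * (fact k * real k ^ m)" by simp
    also have "\<dots> \<le> real (k + Suc m) * fact (k + m)" using Suc by (intro mult_mono) auto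
    finally show ?case by simp
  qed simp
  from this[of k] show ?thesis by (simp add: mult_2)
qed


text \<open>Since \<open>fact (2 * k)\<close> is at least \<open>(k^2 / exp 1)^k\<close>, the terms
  are at most \<open>(\<bar>B\<bar> * exp 1 / sqrt k)^k\<close> in absolute value. This is why a
  correction of order \<open>k * sqrt k\<close> in the moment bound does no harm.\<close>

lemma summable_power_div_fact_double: "summable (\<lambda>k. (B * (real k * sqrt (real k))) ^ k / fact (2 * k))"
proof (rule summable_comparison_test_ev)
  show "summable (\<lambda>k. (1 / 2 :: real) ^ k)" by (rule summable_geometric) simp
  have "\<forall>\<^sub>F k in sequentially. 2 * \<bar>B\<bar> * exp 1 \<le> sqrt (real k) \<and> k > 0"
    by (intro eventually_conj eventually_gt_at_top) real_asymp
  then show "\<forall>\<^sub>F k in sequentially. norm ((B * (real k * sqrt (real k))) ^ k / fact (2 * k)) \<le> (1 / 2) ^ k"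
  proof eventually_elim
    case (elim k)
    have sk: "sqrt (real k) > 0" and k: "real k > 0" using elim by auto
    have "norm ((B * (real k * sqrt (real k))) ^ k / fact (2 * k)) = (\<bar>B\<bar> * (real k * sqrt (real k))) ^ k / fact (2 * k)"
      by (simp add: power_abs abs_mult)
    also have "\<dots> \<le> (\<bar>B\<bar> * (real k * sqrt (real k))) ^ k / ((real k / exp 1) ^ k * real k ^ k)"
    proof (rule divide_left_mono)
      have "(real k / exp 1) ^ k * real k ^ k \<le> fact k * real k ^ k"
        using fact_ge_power_exp by (rule mult_right_mono) simp
      also have "\<dots> \<le> fact (2 * k)" by (rule fact_double_ge)
      finally show "(real k / exp 1) ^ k * real k ^ k \<le> fact (2 * k)" .
    qed (use k in auto)
    also have "\<dots> = (\<bar>B\<bar> * exp 1 * sqrt (real k) / real k) ^ k"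
      using k by (simp add: power_mult_distrib power_divide field_simps)
    also have "\<bar>B\<bar> * exp 1 * sqrt (real k) / real k = \<bar>B\<bar> * exp 1 / sqrt (real k)"
      using k by (simp add: field_simps)
    also have "\<dots> ^ k \<le> (1 / 2) ^ k"
      using elim sk by (intro power_mono) (auto simp: field_simps)
    finally show ?case .
  qed
qed

text \<open>Meant for a single entry of the power \<open>2 * k\<close>, hence without the prefactor
  \<open>n\<close> that the trace carries.\<close>

definition moment_bound :: "real \<Rightarrow> nat \<Rightarrow> nat \<Rightarrow> real" where
  "moment_bound \<kappa> n k = catalan k * (\<kappa> * (real n + real k * sqrt (real k))) ^ k"

text \<open>This and \<open>exp_upper\<close> are exponential series of moments per dimension; odd
  moments vanish, so only even indices appear.\<close>

definition exp_lower :: "real \<Rightarrow> nat \<Rightarrow> real" where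
  "exp_lower \<kappa> n = (\<Sum>k. catalan k * (\<kappa> * real n) ^ k / fact (2 * k))"

definition exp_upper :: "real \<Rightarrow> nat \<Rightarrow> real" where
  "exp_upper \<kappa> n = (\<Sum>k. moment_bound \<kappa> n k / fact (2 * k))"

text \<open>If \<open>k * sqrt k\<close> is at most \<open>\<epsilon> * n\<close>, the correction
  only enlarges \<open>n\<close> by the factor \<open>1 + \<epsilon>\<close>, which gives a term of
  a cosh series. Otherwise \<open>n\<close> itself is bounded through \<open>k\<close>, which gives
  a term free of \<open>n\<close>. The weight \<open>r ^ k\<close> serves the domination argument in
  \<open>mat_exp_integral\<close>.\<close>

lemma moment_bound_split:
  assumes \<kappa>: "\<kappa> > 0" and \<epsilon>: "\<epsilon> > 0" and r: "r \<ge> 0"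
  shows "r ^ k * moment_bound \<kappa> n k / fact (2 * k) \<le>
    (2 * sqrt (r * \<kappa> * (1 + \<epsilon>) * real n)) ^ (2 * k) / fact (2 * k)
    + (4 * r * \<kappa> * (1 + 1 / \<epsilon>) * (real k * sqrt (real k))) ^ k / fact (2 * k)" (is "_ \<le> ?a + ?b")
proof -
  have ab: "0 \<le> ?a" "0 \<le> ?b" using \<kappa> \<epsilon> r by auto
  have le: "r ^ k * moment_bound \<kappa> n k / fact (2 * k) \<le> (4 * r * \<kappa> * (real n + real k * sqrt (real k))) ^ k / fact (2 * k)"
  proof -
    have "moment_bound \<kappa> n k \<le> 4 ^ k * (\<kappa> * (real n + real k * sqrt (real k))) ^ k"
      unfolding moment_bound_def using \<kappa> by (intro mult_right_mono catalan_le) auto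
    then have "r ^ k * moment_bound \<kappa> n k \<le> r ^ k * (4 ^ k * (\<kappa> * (real n + real k * sqrt (real k))) ^ k)"
      using r by (intro mult_left_mono) auto
    also have "\<dots> = (4 * r * \<kappa> * (real n + real k * sqrt (real k))) ^ k"
      by (simp only: power_mult_distrib mult_ac)
    finally show ?thesis by (intro divide_right_mono) auto
  qed
  show ?thesis
  proof (cases "real k * sqrt (real k) \<le> \<epsilon> * real n")
    case True
    have "(4 * r * \<kappa> * (real n + real k * sqrt (real k))) ^ k \<le> (4 * r * \<kappa> * (real n + \<epsilon> * real n)) ^ k"
      using True \<kappa> r by (intro power_mono mult_left_mono add_left_mono) auto
    also have "4 * r * \<kappa> * (real n + \<epsilon> * real n) = (2 * sqrt (r * \<kappa> * (1 + \<epsilon>) * real n)) ^ 2"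
      using \<kappa> \<epsilon> r by (simp add: power_mult_distrib algebra_simps)
    finally have "(4 * r * \<kappa> * (real n + real k * sqrt (real k))) ^ k / fact (2 * k) \<le> ?a"
      unfolding power_mult[symmetric] by (rule divide_right_mono) simp
    with le ab show ?thesis by linarith
  next
    case False
    have "real n \<le> 1 / \<epsilon> * (real k * sqrt (real k))"
      using False \<epsilon> by (simp add: field_simps)
    then have "(4 * r * \<kappa> * (real n + real k * sqrt (real k))) ^ k
        \<le> (4 * r * \<kappa> * (1 / \<epsilon> * (real k * sqrt (real k)) + real k * sqrt (real k))) ^ k"
      using \<kappa> r by (intro power_mono mult_left_mono add_right_mono) auto
    also have "1 / \<epsilon> * (real k * sqrt (real k)) + real k * sqrt (real k) = (1 + 1 / \<epsilon>) * (real k * sqrt (real k))"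
      by (simp add: ring_distribs)
    finally have "(4 * r * \<kappa> * (real n + real k * sqrt (real k))) ^ k / fact (2 * k) \<le> ?b"
      by (intro divide_right_mono) (simp_all add: mult.assoc)
    with le ab show ?thesis by linarith
  qed
qed

lemma moment_bound_nonneg: "\<kappa> > 0 \<Longrightarrow> 0 \<le> moment_bound \<kappa> n k"
  unfolding moment_bound_def by (intro mult_nonneg_nonneg zero_le_power less_imp_le[OF catalan_pos]) auto

lemma summable_moment_bound:
  assumes "\<kappa> > 0" "r \<ge> 0"
  shows "summable (\<lambda>k. r ^ k * moment_bound \<kappa> n k / fact (2 * k))"
proof (rule summable_comparison_test')
  show "summable (\<lambda>k. (2 * sqrt (r * \<kappa> * (1 + 1) * real n)) ^ (2 * k) / fact (2 * k)
    + (4 * r * \<kappa> * (1 + 1 / 1) * (real k * sqrt (real k))) ^ k / fact (2 * k))"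
    by (intro summable_add summable_power_div_fact_double sums_summable[OF cosh_sums])
  show "norm (r ^ k * moment_bound \<kappa> n k / fact (2 * k)) \<le> (2 * sqrt (r * \<kappa> * (1 + 1) * real n)) ^ (2 * k) / fact (2 * k)
    + (4 * r * \<kappa> * (1 + 1 / 1) * (real k * sqrt (real k))) ^ k / fact (2 * k)" for k
    using moment_bound_split[OF assms(1) _ assms(2), of 1 k n] moment_bound_nonneg[OF assms(1), of n k] assms
    by simp
qed

text \<open>Sum \<open>moment_bound_split\<close> with \<open>r = 1\<close>: the terms free of
  \<open>n\<close> add up to the constant \<open>D\<close>.\<close>

lemma exp_upper_le:
  assumes \<kappa>: "\<kappa> > 0" and \<epsilon>: "\<epsilon> > 0"
  obtains D where "D \<ge> 0" "\<And>n. exp_upper \<kappa> n \<le> cosh (2 * sqrt (\<kappa> * (1 + \<epsilon>) * real n)) + D"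
proof
  let ?b = "\<lambda>k. (4 * 1 * \<kappa> * (1 + 1 / \<epsilon>) * (real k * sqrt (real k))) ^ k / fact (2 * k)"
  have b: "summable ?b" by (rule summable_power_div_fact_double)
  show "suminf ?b \<ge> 0" using \<kappa> \<epsilon> by (intro suminf_nonneg b) auto
  fix n
  note c = cosh_sums[of "2 * sqrt (1 * \<kappa> * (1 + \<epsilon>) * real n)"]
  have "exp_upper \<kappa> n \<le> (\<Sum>k. (2 * sqrt (1 * \<kappa> * (1 + \<epsilon>) * real n)) ^ (2 * k) / fact (2 * k) + ?b k)"
    unfolding exp_upper_def
    using moment_bound_split[OF \<kappa> \<epsilon>, of 1 _ n] summable_moment_bound[OF \<kappa>, of 1 n]
    by (intro suminf_le summable_add sums_summable[OF c] b) auto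
  also have "\<dots> = cosh (2 * sqrt (1 * \<kappa> * (1 + \<epsilon>) * real n)) + suminf ?b"
    by (subst suminf_add[OF sums_summable[OF c] b, symmetric]) (simp only: sums_unique[OF c, symmetric])
  finally show "exp_upper \<kappa> n \<le> cosh (2 * sqrt (\<kappa> * (1 + \<epsilon>) * real n)) + suminf ?b" by simp
qed

lemma summable_exp_lower:
  assumes \<kappa>: "\<kappa> > 0"
  shows "summable (\<lambda>k. catalan k * (\<kappa> * real n) ^ k / fact (2 * k))"
proof (rule summable_comparison_test')
  show "summable (\<lambda>k. 1 ^ k * moment_bound \<kappa> n k / fact (2 * k))"
    by (rule summable_moment_bound[OF \<kappa>]) simp
  show "norm (catalan k * (\<kappa> * real n) ^ k / fact (2 * k)) \<le> 1 ^ k * moment_bound \<kappa> n k / fact (2 * k)" for k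
  proof -
    have "catalan k * (\<kappa> * real n) ^ k \<le> moment_bound \<kappa> n k"
      unfolding moment_bound_def using \<kappa> catalan_pos[of k] by (intro mult_left_mono power_mono) auto
    then show ?thesis using \<kappa> catalan_pos[of k] by (simp add: divide_right_mono)
  qed
qed

lemma exp_lower_le_upper: "\<kappa> > 0 \<Longrightarrow> exp_lower \<kappa> n \<le> exp_upper \<kappa> n"
  unfolding exp_lower_def exp_upper_def
  using summable_exp_lower[of \<kappa> n] summable_moment_bound[of \<kappa> 1 n] catalan_pos less_imp_le
  by (intro suminf_le) (auto simp: moment_bound_def intro!: divide_right_mono mult_left_mono power_mono)

text \<open>With \<open>catalan_ge\<close> and \<open>x^2 = 4 * \<kappa> * n\<close>, the series
  dominates the sum of \<open>x^(2 * k) / fact (2 * k + 2)\<close>, which is the cosh series without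
  its first term, divided by \<open>x^2\<close>.\<close>

lemma exp_lower_ge:
  assumes \<kappa>: "\<kappa> > 0" and n: "n > 0"
  shows "(cosh (2 * sqrt (\<kappa> * real n)) - 1) / (4 * \<kappa> * real n) \<le> exp_lower \<kappa> n"
proof -
  define x where "x = 2 * sqrt (\<kappa> * real n)"
  have x2: "x ^ 2 = 4 * \<kappa> * real n" using \<kappa> by (simp add: x_def power_mult_distrib)
  have x0: "x \<noteq> 0" using \<kappa> n by (simp add: x_def)
  have "(\<lambda>k. x ^ (2 * Suc k) / fact (2 * Suc k)) sums (cosh x - 1)"
    using cosh_sums[of x] by (subst sums_Suc_iff) simp
  then have "(\<lambda>k. x ^ (2 * Suc k) / fact (2 * Suc k) / x ^ 2) sums ((cosh x - 1) / x ^ 2)"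
    by (rule sums_divide)
  then have s: "(\<lambda>k. x ^ (2 * k) / fact (2 * Suc k)) sums ((cosh x - 1) / x ^ 2)"
  proof (rule sums_cong[THEN iffD1, rotated])
    show "x ^ (2 * Suc k) / fact (2 * Suc k) / x ^ 2 = x ^ (2 * k) / fact (2 * Suc k)" for k
      using x0 by (simp add: power2_eq_square del: fact_Suc)
  qed
  have "(cosh x - 1) / x ^ 2 = (\<Sum>k. x ^ (2 * k) / fact (2 * Suc k))"
    using s by (rule sums_unique)
  also have "\<dots> \<le> exp_lower \<kappa> n"
    unfolding exp_lower_def
  proof (rule suminf_le[OF _ sums_summable[OF s] summable_exp_lower[OF \<kappa>]])
    fix k
    have "(real k + 1)\<^sup>2 * fact (2 * k) \<le> real (2 * k + 2) * real (2 * k + 1) * fact (2 * k)"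
      by (intro mult_right_mono) (auto simp: power2_eq_square algebra_simps)
    also have "\<dots> = fact (2 * Suc k)" by (simp add: algebra_simps)
    finally have "x ^ (2 * k) / fact (2 * Suc k) \<le> x ^ (2 * k) / ((real k + 1)\<^sup>2 * fact (2 * k))"
      by (intro divide_left_mono) auto
    also have "\<dots> = 4 ^ k / (real k + 1)\<^sup>2 * (\<kappa> * real n) ^ k / fact (2 * k)"
      by (simp add: power_mult x2 power_mult_distrib)
    also have "\<dots> \<le> catalan k * (\<kappa> * real n) ^ k / fact (2 * k)"
      using \<kappa> by (intro divide_right_mono mult_right_mono catalan_ge) auto
    finally show "x ^ (2 * k) / fact (2 * Suc k) \<le> catalan k * (\<kappa> * real n) ^ k / fact (2 * k)" .
  qed
  finally show ?thesis unfolding x2 unfolding x_def by (simp add: mult.assoc)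
qed

lemma exp_lower_pos: "\<kappa> > 0 \<Longrightarrow> n > 0 \<Longrightarrow> 0 < exp_lower \<kappa> n"
  unfolding exp_lower_def by (intro suminf_pos summable_exp_lower) (auto intro!: mult_pos_pos divide_pos_pos catalan_pos)

text \<open>With \<open>s = sqrt \<kappa>\<close>, the logarithm of
  \<open>cosh (2 * s * sqrt n)\<close> divided by \<open>sqrt n\<close> tends to
  \<open>2 * s\<close>. Dividing the cosh by a multiple of \<open>n\<close>, or adding a constant to
  it, leaves this limit unchanged, and the \<open>\<epsilon>\<close> of \<open>exp_upper_le\<close>
  may be arbitrarily small.\<close>

lemma
  assumes \<kappa>: "\<kappa> > 0"
  shows ln_exp_lower: "(\<lambda>n. ln (exp_lower \<kappa> n) / sqrt (real n)) \<longlonglongrightarrow> 2 * sqrt \<kappa>"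
    and ln_exp_upper: "(\<lambda>n. ln (exp_upper \<kappa> n) / sqrt (real n)) \<longlonglongrightarrow> 2 * sqrt \<kappa>"
proof -
  define s where "s = sqrt \<kappa>"
  have s: "s > 0" using \<kappa> by (simp add: s_def)
  have \<kappa>s: "\<kappa> = s\<^sup>2" using \<kappa> by (simp add: s_def)
  have low: "\<forall>\<^sub>F n in sequentially. a < ln (exp_lower \<kappa> n) / sqrt (real n)" if a: "a < 2 * s" for a
  proof -
    have "(\<lambda>n. ln ((cosh (2 * (s * sqrt (real n))) - 1) / (4 * s\<^sup>2 * real n)) / sqrt (real n)) \<longlonglongrightarrow> 2 * s"
      using s by real_asymp
    then have "\<forall>\<^sub>F n in sequentially. a < ln ((cosh (2 * (s * sqrt (real n))) - 1) / (4 * s\<^sup>2 * real n)) / sqrt (real n)"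
      using a by (rule order_tendstoD)
    then show ?thesis
      using eventually_gt_at_top[of 0]
    proof eventually_elim
      case (elim n)
      have c: "cosh (2 * (s * sqrt (real n))) > 1"
        using cosh_real_strict_mono[of 0 "2 * (s * sqrt (real n))"] s elim(2) by simp
      have "(cosh (2 * (s * sqrt (real n))) - 1) / (4 * s\<^sup>2 * real n) \<le> exp_lower \<kappa> n"
        using exp_lower_ge[OF \<kappa> elim(2)] s by (simp add: \<kappa>s real_sqrt_mult)
      then have "ln ((cosh (2 * (s * sqrt (real n))) - 1) / (4 * s\<^sup>2 * real n)) / sqrt (real n) \<le> ln (exp_lower \<kappa> n) / sqrt (real n)"
        using c s elim(2) by (intro divide_right_mono ln_mono) auto
      with elim(1) show ?case by linarith
    qed
  qed
  have upp: "\<forall>\<^sub>F n in sequentially. ln (exp_upper \<kappa> n) / sqrt (real n) < b" if b: "2 * s < b" for b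
  proof -
    \<comment> \<open>\<open>t\<close> lies strictly between \<open>s\<close> and
      \<open>b / 2\<close>, and \<open>\<epsilon>\<close> is then chosen to make
      \<open>\<kappa> * (1 + \<epsilon>) = t\<^sup>2\<close>.\<close>
    define t where "t = (s + b / 2) / 2"
    have t: "s < t" "2 * t < b" using b by (auto simp: t_def)
    define \<epsilon> where "\<epsilon> = t\<^sup>2 / s\<^sup>2 - 1"
    have "s\<^sup>2 < t\<^sup>2" using t s by (intro power_strict_mono) auto
    then have \<epsilon>: "\<epsilon> > 0" using s by (simp add: \<epsilon>_def)
    have \<kappa>\<epsilon>: "\<kappa> * (1 + \<epsilon>) = t\<^sup>2" using s by (simp add: \<kappa>s \<epsilon>_def)
    obtain D where D: "D \<ge> 0" "\<And>n. exp_upper \<kappa> n \<le> cosh (2 * sqrt (t\<^sup>2 * real n)) + D"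
      using exp_upper_le[OF \<kappa> \<epsilon>] unfolding \<kappa>\<epsilon> by metis
    have "t > 0" using s t by simp
    then have "(\<lambda>n. ln (cosh (2 * (t * sqrt (real n))) + D) / sqrt (real n)) \<longlonglongrightarrow> 2 * t"
      by real_asymp
    then have "\<forall>\<^sub>F n in sequentially. ln (cosh (2 * (t * sqrt (real n))) + D) / sqrt (real n) < b"
      using t(2) by (rule order_tendstoD)
    then show ?thesis
      using eventually_gt_at_top[of 0]
    proof eventually_elim
      case (elim n)
      have "0 < exp_upper \<kappa> n" using exp_lower_pos[OF \<kappa> elim(2)] exp_lower_le_upper[OF \<kappa>, of n] by linarith
      moreover have "exp_upper \<kappa> n \<le> cosh (2 * (t * sqrt (real n))) + D"
        using D(2)[of n] \<open>t > 0\<close> by (simp add: real_sqrt_mult)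
      ultimately have "ln (exp_upper \<kappa> n) / sqrt (real n) \<le> ln (cosh (2 * (t * sqrt (real n))) + D) / sqrt (real n)"
        by (intro divide_right_mono ln_mono) auto
      with elim(1) show ?case by linarith
    qed
  qed
  \<comment> \<open>\<open>low\<close> concerns the smaller series and \<open>upp\<close> the larger
    one; this inequality hands each bound to the other series.\<close>
  have le: "\<forall>\<^sub>F n in sequentially. ln (exp_lower \<kappa> n) / sqrt (real n) \<le> ln (exp_upper \<kappa> n) / sqrt (real n)"
    using eventually_gt_at_top[of 0]
    by eventually_elim (intro divide_right_mono ln_mono exp_lower_le_upper \<kappa> exp_lower_pos; simp)
  show "(\<lambda>n. ln (exp_lower \<kappa> n) / sqrt (real n)) \<longlonglongrightarrow> 2 * sqrt \<kappa>"
    unfolding s_def[symmetric]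
  proof (rule order_tendstoI)
    fix b assume "2 * s < b"
    from upp[OF this] le show "\<forall>\<^sub>F n in sequentially. ln (exp_lower \<kappa> n) / sqrt (real n) < b"
      by eventually_elim linarith
  qed (rule low)
  show "(\<lambda>n. ln (exp_upper \<kappa> n) / sqrt (real n)) \<longlonglongrightarrow> 2 * sqrt \<kappa>"
    unfolding s_def[symmetric]
  proof (rule order_tendstoI)
    fix a assume "a < 2 * s"
    from low[OF this] le show "\<forall>\<^sub>F n in sequentially. a < ln (exp_upper \<kappa> n) / sqrt (real n)"
      by eventually_elim linarith
  qed (rule upp)
qed

section \<open>Positivity and correlation inequalities for monomials\<close>

section \<open>Moments of monomials\<close>

lemma prod_mset_count_fun:
  assumes "set_mset A \<subseteq> V" "finite V"
  shows "(\<Prod>v\<in>#A. x v) = (\<Prod>v\<in>V. x v ^ count A v :: 'a :: comm_monoid_mult)"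
  using assms
proof (induction A)
  case (add a A)
  have "(\<Prod>v\<in>V. x v ^ count (add_mset a A) v) = (\<Prod>v\<in>V. (if v = a then x a else 1) * x v ^ count A v)"
    by (intro prod.cong) auto
  also have "\<dots> = x a * (\<Prod>v\<in>V. x v ^ count A v)"
    using add.prems by (simp add: prod.distrib prod.delta)
  finally show ?case using add by simp
qed auto

lemma add_diff_swap:
  assumes "q \<in># A" shows "A + B - {#q#} = (A - {#q#}) + B"
  using assms by (auto dest!: multi_member_split)

text \<open>The product rule: \<open>count A q\<close> times the monomial of
  \<open>A - {#q#}\<close> is the formal derivative in the variable \<open>q\<close>. If
  \<open>q\<close> is absent the difference is \<open>A\<close> itself, and the coefficient 0
  removes that value.\<close>

lemma count_times_split:
  fixes f :: "'b multiset \<Rightarrow> 'a :: comm_ring_1"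
  shows "of_nat (count (A + B) q) * f (A + B - {#q#}) =
   of_nat (count A q) * f ((A - {#q#}) + B) + of_nat (count B q) * f (A + (B - {#q#}))"
proof -
  have "of_nat (count A q) * f (A + B - {#q#}) = of_nat (count A q) * f ((A - {#q#}) + B)"
    using add_diff_swap[of q A B] by (cases "q \<in># A") (auto simp: not_in_iff)
  moreover have "of_nat (count B q) * f (A + B - {#q#}) = of_nat (count B q) * f (A + (B - {#q#}))"
    by (cases "q \<in># B") (auto simp: not_in_iff)
  ultimately show ?thesis by (simp only: count_union of_nat_add ring_distribs)
qed

lemma swap_eq_iff: "prod.swap p = q \<longleftrightarrow> p = prod.swap q" by (cases p; cases q) auto

text \<open>The covariance pairs an entry with its transpose, which is how Hermitian symmetry
  enters. The parameter \<open>\<kappa>\<close> lets one argument serve a single GUE matrix and the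
  sum of two.\<close>

locale gue_moments = prob_space M for M :: "'w measure" +
  fixes n :: nat and S :: "nat \<times> nat \<Rightarrow> 'w \<Rightarrow> complex" and \<kappa> :: real
  assumes \<kappa>_pos: "\<kappa> > 0"
    and wick: "wick M ({..<n} \<times> {..<n}) S (\<lambda>p q. if q = prod.swap p then of_real \<kappa> else 0)"
begin

abbreviation V where "V \<equiv> {..<n} \<times> {..<n}"

lemma swap_V [simp]: "prod.swap p \<in> V \<longleftrightarrow> p \<in> V" by (cases p) auto

abbreviation monomial :: "(nat \<times> nat) multiset \<Rightarrow> 'w \<Rightarrow> complex" where
  "monomial A \<equiv> (\<lambda>\<omega>. \<Prod>p\<in>#A. S p \<omega>)"

definition monomial_moment :: "(nat \<times> nat) multiset \<Rightarrow> real" where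
  "monomial_moment A = Re (\<integral>\<omega>. monomial A \<omega> \<partial>M)"

lemma set_mset_diff_subset: "set_mset A \<subseteq> V \<Longrightarrow> set_mset (A - B) \<subseteq> V"
  by (auto dest: in_diffD)

lemma integral_monomial_add:
  assumes "p \<in> V" "set_mset A \<subseteq> V"
  shows "(\<integral>\<omega>. monomial (add_mset p A) \<omega> \<partial>M) =
    of_real \<kappa> * of_nat (count A (prod.swap p)) * (\<integral>\<omega>. monomial (A - {#prod.swap p#}) \<omega> \<partial>M)"
proof -
  have "(\<Sum>w\<in>#B. (if w = q then c else 0) * f w) = c * of_nat (count B q) * (f q :: complex)" for B q c f
    by (induction B) (auto simp: algebra_simps)
  then show ?thesis using wick_step[OF wick assms] by simp
qed

text \<open>Each step of the recursion multiplies by \<open>\<kappa>\<close> and a multiplicity,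
  starting from the empty moment 1.\<close>

lemma monomial_moment_props:
  assumes "set_mset A \<subseteq> V"
  shows "(\<integral>\<omega>. monomial A \<omega> \<partial>M) = of_real (monomial_moment A) \<and> 0 \<le> monomial_moment A"
  using assms
proof (induction "size A" arbitrary: A rule: less_induct)
  case less
  show ?case
  proof (cases A)
    case empty
    then show ?thesis by (simp add: monomial_moment_def prob_space)
  next
    case (add p B)
    with less.prems have p: "p \<in> V" and B: "set_mset B \<subseteq> V" by auto
    have "size (B - {#prod.swap p#}) < size A"
      using add by (simp add: less_Suc_eq_le size_mset_mono)
    from less.hyps[OF this set_mset_diff_subset[OF B]]
    have IH: "(\<integral>\<omega>. monomial (B - {#prod.swap p#}) \<omega> \<partial>M) = of_real (monomial_moment (B - {#prod.swap p#}))" "0 \<le> monomial_moment (B - {#prod.swap p#})"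
      by auto
    have "(\<integral>\<omega>. monomial A \<omega> \<partial>M) = of_real (\<kappa> * of_nat (count B (prod.swap p)) * monomial_moment (B - {#prod.swap p#}))"
      unfolding add integral_monomial_add[OF p B] IH(1) by simp
    with IH(2) \<kappa>_pos show ?thesis by (simp add: monomial_moment_def)
  qed
qed

lemmas integral_monomial = monomial_moment_props[THEN conjunct1]
lemmas monomial_moment_nonneg = monomial_moment_props[THEN conjunct2]

lemma monomial_moment_empty [simp]: "monomial_moment {#} = 1" by (simp add: monomial_moment_def prob_space)

lemma monomial_moment_add:
  assumes "p \<in> V" "set_mset A \<subseteq> V"
  shows "monomial_moment (add_mset p A) = \<kappa> * real (count A (prod.swap p)) * monomial_moment (A - {#prod.swap p#})"
  using integral_monomial_add[OF assms] integral_monomial[OF set_mset_diff_subset[OF assms(2)]]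
  by (subst monomial_moment_def) (simp add: of_real_mult[symmetric] del: of_real_mult)

text \<open>A pairing of \<open>A\<close> together with one of \<open>B\<close> is a pairing of
  \<open>A + B\<close>, and all pairings have nonnegative weight. In the induction the first factor
  of \<open>A\<close> is expanded, and its pairings with \<open>B\<close> are dropped.\<close>

lemma monomial_moment_superadd:
  assumes "set_mset A \<subseteq> V" "set_mset B \<subseteq> V"
  shows "monomial_moment A * monomial_moment B \<le> monomial_moment (A + B)"
  using assms
proof (induction "size A" arbitrary: A B rule: less_induct)
  case less
  show ?case
  proof (cases A)
    case (add p A')
    with less.prems have p: "p \<in> V" and A': "set_mset A' \<subseteq> V" by auto
    let ?q = "prod.swap p"
    have sz: "size (A' - {#?q#}) < size A"
      using add by (simp add: less_Suc_eq_le size_mset_mono)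
    have "monomial_moment A * monomial_moment B = \<kappa> * (real (count A' ?q) * (monomial_moment (A' - {#?q#}) * monomial_moment B))"
      unfolding add monomial_moment_add[OF p A'] by simp
    also have "\<dots> \<le> \<kappa> * (real (count A' ?q) * monomial_moment ((A' - {#?q#}) + B) + real (count B ?q) * monomial_moment (A' + (B - {#?q#})))"
      using \<kappa>_pos less.prems A'
      by (intro mult_left_mono add_increasing2 less.hyps[OF sz] mult_nonneg_nonneg monomial_moment_nonneg) (auto dest: in_diffD)
    also have "\<dots> = monomial_moment (A + B)"
      unfolding count_times_split[symmetric] using p A' less.prems by (simp add: add monomial_moment_add mult.assoc)
    finally show ?thesis .
  qed simp
qed

text \<open>A pairing of \<open>A + B\<close> that is not a union of separate pairings has a link
  from some \<open>p\<close> in \<open>A\<close> to its transpose in \<open>B\<close>; the sum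
  counts it at least once. The induction expands the first factor \<open>a\<close> of
  \<open>A\<close>: a link from \<open>a\<close> into \<open>B\<close> gives a term of the sum
  directly, and a pair inside \<open>A\<close> leads to the induction hypothesis.\<close>

lemma monomial_moment_cov:
  assumes "set_mset A \<subseteq> V" "set_mset B \<subseteq> V"
  shows "monomial_moment (A + B) \<le> monomial_moment A * monomial_moment B +
    \<kappa> * (\<Sum>p\<in>V. real (count A p) * real (count B (prod.swap p)) * monomial_moment ((A - {#p#}) + (B - {#prod.swap p#})))"
  using assms
proof (induction "size A" arbitrary: A B rule: less_induct)
  case less
  show ?case
  proof (cases A)
    case (add a A')
    with less.prems have a: "a \<in> V" and A': "set_mset A' \<subseteq> V" and B: "set_mset B \<subseteq> V" by auto
    define q where "q = prod.swap a"
    define cr where "cr = (\<lambda>A B. \<Sum>p\<in>V. real (count A p) * real (count B (prod.swap p)) * monomial_moment ((A - {#p#}) + (B - {#prod.swap p#})))"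
    have sub: "set_mset (C - D) \<subseteq> V" if "set_mset C \<subseteq> V" for C D using that by (auto dest: in_diffD)
    have sz: "size (A' - {#q#}) < size A"
      using add by (simp add: less_Suc_eq_le size_mset_mono)
    have "monomial_moment (A + B) = \<kappa> * (real (count A' q) * monomial_moment ((A' - {#q#}) + B) + real (count B q) * monomial_moment (A' + (B - {#q#})))"
      unfolding count_times_split[symmetric] using a A' B by (simp add: add monomial_moment_add q_def mult.assoc)
    also have "\<dots> \<le> \<kappa> * (real (count A' q) * (monomial_moment (A' - {#q#}) * monomial_moment B + \<kappa> * cr (A' - {#q#}) B) + real (count B q) * monomial_moment (A' + (B - {#q#})))"
      using \<kappa>_pos unfolding cr_def
      by (intro mult_left_mono add_right_mono less.hyps[OF sz sub[OF A'] B]) auto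
    also have "\<dots> = monomial_moment A * monomial_moment B + \<kappa> * (real (count B q) * monomial_moment (A' + (B - {#q#})) + \<kappa> * real (count A' q) * cr (A' - {#q#}) B)"
      unfolding add monomial_moment_add[OF a A'] q_def by (simp add: algebra_simps)
    also have "real (count B q) * monomial_moment (A' + (B - {#q#})) + \<kappa> * real (count A' q) * cr (A' - {#q#}) B \<le> cr A B"
    proof -
      \<comment> \<open>Comparison link by link: the first term is the link that starts at
        \<open>a\<close>, the second collects pairings in which \<open>a\<close> is paired inside
        \<open>A\<close> and the link starts at \<open>p\<close>.\<close>
      have tm: "(if p = a then real (count B q) * monomial_moment (A' + (B - {#q#})) else 0)
          + \<kappa> * real (count A' q) * (real (count (A' - {#q#}) p) * real (count B (prod.swap p)) * monomial_moment ((A' - {#q#} - {#p#}) + (B - {#prod.swap p#})))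
          \<le> real (count A p) * real (count B (prod.swap p)) * monomial_moment ((A - {#p#}) + (B - {#prod.swap p#}))" if p: "p \<in> V" for p
      proof -
        let ?B = "B - {#prod.swap p#}"
        \<comment> \<open>Expand the right-hand moment at its factor \<open>a\<close> and keep only
          the pairings of \<open>a\<close> with a factor \<open>q\<close> of
          \<open>A'\<close>.\<close>
        have *: "\<kappa> * real (count A' q) * (real (count (A' - {#q#}) p) * monomial_moment ((A' - {#q#} - {#p#}) + ?B))
            \<le> real (count A' p) * monomial_moment (add_mset a (A' - {#p#}) + ?B)"
        proof (cases "p \<in># A'")
          case True
          \<comment> \<open>Both sides count ways to take out \<open>p\<close> and \<open>q\<close>
            one after the other, in either order, also when \<open>p = q\<close>.\<close>
          have "real (count A' q) * real (count (A' - {#q#}) p) = real (count A' p) * real (count (A' - {#p#}) q)"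
            by (cases "p = q") auto
          from arg_cong[OF this, of "\<lambda>c. \<kappa> * c * monomial_moment ((A' - {#p#} - {#q#}) + ?B)"] have "\<kappa> * real (count A' q) * (real (count (A' - {#q#}) p) * monomial_moment ((A' - {#q#} - {#p#}) + ?B))
             = real (count A' p) * (\<kappa> * (real (count (A' - {#p#}) q) * monomial_moment ((A' - {#p#} - {#q#}) + ?B)))"
            unfolding diff_right_commute[of A' "{#q#}" "{#p#}"] by (simp only: mult_ac)
          also have "\<dots> \<le> real (count A' p) * (\<kappa> * (real (count (A' - {#p#}) q) * monomial_moment ((A' - {#p#} - {#q#}) + ?B) + real (count ?B q) * monomial_moment ((A' - {#p#}) + (?B - {#q#}))))"
            using \<kappa>_pos sub[OF A'] sub[OF B] A' B by (intro mult_left_mono add_increasing2 mult_nonneg_nonneg monomial_moment_nonneg) (auto dest: in_diffD)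
          also have "\<dots> = real (count A' p) * monomial_moment (add_mset a (A' - {#p#} + ?B))"
            unfolding count_times_split[symmetric] using a A' B sub[OF A'] sub[OF B]
            by (subst monomial_moment_add) (auto simp: q_def)
          finally show ?thesis by simp
        next
          case False
          then have "count A' p = 0" by (simp add: not_in_iff)
          then show ?thesis by simp
        qed
        \<comment> \<open>The product rule in the variable \<open>p\<close> for the monomial of
          \<open>add_mset a A'\<close>.\<close>
        have "real (count A p) * monomial_moment ((A - {#p#}) + ?B) = (if p = a then monomial_moment (A' + ?B) else 0) + real (count A' p) * monomial_moment (add_mset a (A' - {#p#}) + ?B)"
        proof (cases "p = a")
          case True
          have "real (count A' a) * monomial_moment (add_mset a (A' - {#a#}) + ?B) = real (count A' a) * monomial_moment (A' + ?B)"
            by (cases "a \<in># A'") (simp_all add: not_in_iff)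
          then show ?thesis by (auto simp: add True ring_distribs)
        next
          case False
          then show ?thesis by (cases "p \<in># A'") (simp_all add: add add_mset_diff_single not_in_iff)
        qed
        note eq = this
        have "real (count A p) * real (count B (prod.swap p)) * monomial_moment ((A - {#p#}) + ?B)
          = real (count B (prod.swap p)) * (real (count A p) * monomial_moment ((A - {#p#}) + ?B))" by (simp only: mult_ac)
        also have "\<dots> = (if p = a then real (count B q) * monomial_moment (A' + (B - {#q#})) else 0) + real (count B (prod.swap p)) * (real (count A' p) * monomial_moment (add_mset a (A' - {#p#}) + ?B))"
          unfolding eq by (simp add: q_def ring_distribs)
        finally have "real (count A p) * real (count B (prod.swap p)) * monomial_moment ((A - {#p#}) + ?B) = \<dots>" .
        with mult_left_mono[OF *, of "real (count B (prod.swap p))"] show ?thesis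
          by (simp add: mult_ac)
      qed
      have "real (count B q) * monomial_moment (A' + (B - {#q#})) + \<kappa> * real (count A' q) * cr (A' - {#q#}) B
        = (\<Sum>p\<in>V. (if p = a then real (count B q) * monomial_moment (A' + (B - {#q#})) else 0)
          + \<kappa> * real (count A' q) * (real (count (A' - {#q#}) p) * real (count B (prod.swap p)) * monomial_moment ((A' - {#q#} - {#p#}) + (B - {#prod.swap p#}))))"
        using a by (simp add: sum.distrib sum_distrib_left cr_def del: mem_Times_iff)
      also have "\<dots> \<le> cr A B"
        unfolding cr_def by (rule sum_mono) (rule tm)
      finally show ?thesis .
    qed
    finally show ?thesis using \<kappa>_pos unfolding cr_def by simp
  qed simp
qed

end

section \<open>Extension of these inequalities to polynomials\<close>

section \<open>Polynomials with nonnegative coefficients\<close>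

context gue_moments begin

definition mean :: "('w \<Rightarrow> complex) \<Rightarrow> real" where
  "mean \<phi> = Re (\<integral>\<omega>. \<phi> \<omega> \<partial>M)"

text \<open>The second argument carries the formal partial derivatives; outside of \<open>V\<close> it is arbitrary.\<close>

inductive nonneg_poly :: "('w \<Rightarrow> complex) \<Rightarrow> (nat \<times> nat \<Rightarrow> 'w \<Rightarrow> complex) \<Rightarrow> bool" where
  monomial: "set_mset A \<subseteq> V \<Longrightarrow> nonneg_poly (monomial A) (\<lambda>p \<omega>. of_nat (count A p) * monomial (A - {#p#}) \<omega>)"
| zero: "nonneg_poly (\<lambda>_. 0) (\<lambda>_ _. 0)"
| add: "nonneg_poly \<phi> d \<Longrightarrow> nonneg_poly \<psi> e \<Longrightarrow> nonneg_poly (\<lambda>\<omega>. \<phi> \<omega> + \<psi> \<omega>) (\<lambda>p \<omega>. d p \<omega> + e p \<omega>)"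
| congr: "nonneg_poly \<phi> d \<Longrightarrow> (\<And>\<omega>. \<phi> \<omega> = \<phi>' \<omega>) \<Longrightarrow> (\<And>p \<omega>. p \<in> V \<Longrightarrow> d p \<omega> = d' p \<omega>) \<Longrightarrow> nonneg_poly \<phi>' d'"

lemma nonneg_poly_mult_monomial:
  assumes "nonneg_poly \<psi> e" and A: "set_mset A \<subseteq> V"
  shows "nonneg_poly (\<lambda>\<omega>. monomial A \<omega> * \<psi> \<omega>)
    (\<lambda>p \<omega>. (of_nat (count A p) * monomial (A - {#p#}) \<omega>) * \<psi> \<omega> + monomial A \<omega> * e p \<omega>)"
  using assms(1)
proof induction
  case (monomial B)
  have AB: "set_mset (A + B) \<subseteq> V" using A monomial by auto
  have "of_nat (count (A + B) p) * monomial (A + B - {#p#}) \<omega> =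
     (of_nat (count A p) * monomial (A - {#p#}) \<omega>) * monomial B \<omega> + monomial A \<omega> * (of_nat (count B p) * monomial (B - {#p#}) \<omega>)" for p \<omega>
    using count_times_split[of A B p "\<lambda>A. monomial A \<omega>"] by (simp add: mult_ac)
  then show ?case
    by (intro nonneg_poly.congr[OF nonneg_poly.monomial[OF AB]]) simp_all
next
  case zero
  show ?case by (rule nonneg_poly.congr[OF nonneg_poly.zero]) auto
next
  case (add \<phi> d \<psi> e)
  then show ?case by (intro nonneg_poly.congr[OF nonneg_poly.add[OF add.IH]]) (auto simp: algebra_simps)
next
  case (congr \<phi> d \<phi>' d')
  then show ?case by (intro nonneg_poly.congr[OF congr.IH]) auto
qed

lemma nonneg_poly_mult:
  assumes "nonneg_poly \<phi> d" "nonneg_poly \<psi> e"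
  shows "nonneg_poly (\<lambda>\<omega>. \<phi> \<omega> * \<psi> \<omega>) (\<lambda>p \<omega>. d p \<omega> * \<psi> \<omega> + \<phi> \<omega> * e p \<omega>)"
  using assms(1)
proof induction
  case (monomial A)
  then show ?case by (rule nonneg_poly_mult_monomial[OF assms(2)])
next
  case zero
  show ?case by (rule nonneg_poly.congr[OF nonneg_poly.zero]) auto
next
  case (add \<phi> d \<psi> e)
  then show ?case by (intro nonneg_poly.congr[OF nonneg_poly.add[OF add.IH]]) (auto simp: algebra_simps)
next
  case (congr \<phi> d \<phi>' d')
  then show ?case by (intro nonneg_poly.congr[OF congr.IH]) auto
qed

lemma nonneg_poly_sum:
  assumes "finite I" "\<And>i. i \<in> I \<Longrightarrow> nonneg_poly (f i) (g i)"
  shows "nonneg_poly (\<lambda>\<omega>. \<Sum>i\<in>I. f i \<omega>) (\<lambda>p \<omega>. \<Sum>i\<in>I. g i p \<omega>)"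
  using assms
proof (induction I rule: finite_induct)
  case empty
  then show ?case by (simp add: nonneg_poly.zero)
next
  case (insert i I)
  then show ?case using nonneg_poly.add[of "f i" "g i" "\<lambda>\<omega>. \<Sum>i\<in>I. f i \<omega>" "\<lambda>p \<omega>. \<Sum>i\<in>I. g i p \<omega>"] by simp
qed

lemma nonneg_poly_one: "nonneg_poly (\<lambda>_. 1) (\<lambda>_ _. 0)"
  using nonneg_poly.monomial[of "{#}"] by simp

lemma nonneg_poly_S: "p \<in> V \<Longrightarrow> nonneg_poly (S p) (\<lambda>q _. if q = p then 1 else 0)"
  by (rule nonneg_poly.congr[OF nonneg_poly.monomial[of "{#p#}"]]) auto

lemma nonneg_poly_of_nat_mult:
  assumes "nonneg_poly \<phi> d"
  shows "nonneg_poly (\<lambda>\<omega>. of_nat k * \<phi> \<omega>) (\<lambda>p \<omega>. of_nat k * d p \<omega>)"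
proof (induction k)
  case 0
  then show ?case by (simp add: nonneg_poly.zero)
next
  case (Suc k)
  show ?case by (rule nonneg_poly.congr[OF nonneg_poly.add[OF assms Suc]]) (auto simp: algebra_simps)
qed

text \<open>Derivatives stay in the class, so products of two derivatives are integrable and the
  covariance sums can be split additively.\<close>

lemma nonneg_poly_deriv: "nonneg_poly \<phi> d \<Longrightarrow> p \<in> V \<Longrightarrow> \<exists>e. nonneg_poly (d p) e"
proof (induction rule: nonneg_poly.induct)
  case (monomial A)
  have "nonneg_poly (monomial (A - {#p#})) (\<lambda>q \<omega>. of_nat (count (A - {#p#}) q) * monomial (A - {#p#} - {#q#}) \<omega>)"
    by (rule nonneg_poly.monomial[OF set_mset_diff_subset[OF monomial(1)]])
  from nonneg_poly_of_nat_mult[OF this, of "count A p"] show ?case by blast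
next
  case zero
  then show ?case using nonneg_poly.zero by blast
next
  case (add \<phi> d \<psi> e)
  then show ?case using nonneg_poly.add by blast
next
  case (congr \<phi> d \<phi>' d')
  then obtain e where "nonneg_poly (d p) e" by blast
  from nonneg_poly.congr[OF this, of "d' p" e] congr show ?case by auto
qed

lemma nonneg_poly_mean:
  assumes "nonneg_poly \<phi> d"
  shows "integrable M \<phi> \<and> (\<integral>\<omega>. \<phi> \<omega> \<partial>M) = of_real (mean \<phi>) \<and> 0 \<le> mean \<phi>"
  using assms
proof induction
  case (monomial A)
  then show ?case using monomial_moment_props[OF monomial] wick_integrable[OF wick monomial] by (simp add: mean_def)
next
  case (congr \<phi> d \<phi>' d')
  then have "\<phi>' = \<phi>" by auto
  then show ?case using congr by simp
qed (auto simp: mean_def)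

lemmas nonneg_poly_integrable = nonneg_poly_mean[THEN conjunct1]
lemmas nonneg_poly_integral = nonneg_poly_mean[THEN conjunct2, THEN conjunct1]
lemmas mean_nonneg = nonneg_poly_mean[THEN conjunct2, THEN conjunct2]

lemma mean_add: "integrable M \<phi> \<Longrightarrow> integrable M \<psi> \<Longrightarrow> mean (\<lambda>\<omega>. \<phi> \<omega> + \<psi> \<omega>) = mean \<phi> + mean \<psi>"
  by (simp add: mean_def)

lemma mean_zero [simp]: "mean (\<lambda>_. 0) = 0" by (simp add: mean_def)

lemma mean_sum: "(\<And>i. i \<in> I \<Longrightarrow> integrable M (f i)) \<Longrightarrow> mean (\<lambda>\<omega>. \<Sum>i\<in>I. f i \<omega>) = (\<Sum>i\<in>I. mean (f i))"
  by (simp add: mean_def Bochner_Integration.integral_sum)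

lemma mean_of_real_mult: "mean (\<lambda>\<omega>. of_real c * \<phi> \<omega>) = c * mean \<phi>"
  by (simp add: mean_def)

lemma mean_monomial: "set_mset A \<subseteq> V \<Longrightarrow> mean (monomial A) = monomial_moment A"
  by (simp add: mean_def monomial_moment_def)

lemma nonneg_poly_mult_integrable: "nonneg_poly \<phi> d \<Longrightarrow> nonneg_poly \<psi> e \<Longrightarrow> integrable M (\<lambda>\<omega>. \<phi> \<omega> * \<psi> \<omega>)"
  using nonneg_poly_integrable[OF nonneg_poly_mult] .

lemma nonneg_poly_deriv_mult_integrable:
  "nonneg_poly \<phi> d \<Longrightarrow> nonneg_poly \<psi> e \<Longrightarrow> p \<in> V \<Longrightarrow> q \<in> V \<Longrightarrow> integrable M (\<lambda>\<omega>. d p \<omega> * e q \<omega>)"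
  using nonneg_poly_deriv nonneg_poly_mult_integrable by meson

lemma mean_mult_add_left:
  "nonneg_poly \<phi> d \<Longrightarrow> nonneg_poly \<phi>' d' \<Longrightarrow> nonneg_poly \<psi> e \<Longrightarrow>
    mean (\<lambda>\<omega>. (\<phi> \<omega> + \<phi>' \<omega>) * \<psi> \<omega>) = mean (\<lambda>\<omega>. \<phi> \<omega> * \<psi> \<omega>) + mean (\<lambda>\<omega>. \<phi>' \<omega> * \<psi> \<omega>)"
  unfolding ring_distribs by (intro mean_add nonneg_poly_mult_integrable)

lemma mean_mult_add_right:
  "nonneg_poly \<phi> d \<Longrightarrow> nonneg_poly \<psi> e \<Longrightarrow> nonneg_poly \<psi>' e' \<Longrightarrow>
    mean (\<lambda>\<omega>. \<phi> \<omega> * (\<psi> \<omega> + \<psi>' \<omega>)) = mean (\<lambda>\<omega>. \<phi> \<omega> * \<psi> \<omega>) + mean (\<lambda>\<omega>. \<phi> \<omega> * \<psi>' \<omega>)"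
  unfolding ring_distribs by (intro mean_add nonneg_poly_mult_integrable)

text \<open>The correlation inequalities are additive in each of the two polynomials, so they need
  an argument only for pairs of monomials. The case \<open>congr\<close> exchanges derivatives for
  others that agree on \<open>V\<close>.\<close>

lemma nonneg_poly_bilinear_induct [consumes 2, case_names monomial zero_left zero_right add_left add_right congr]:
  assumes "nonneg_poly \<phi> d" "nonneg_poly \<psi> e"
    and monomial: "\<And>A B. set_mset A \<subseteq> V \<Longrightarrow> set_mset B \<subseteq> V \<Longrightarrow>
      Q (monomial A) (\<lambda>p \<omega>. of_nat (count A p) * monomial (A - {#p#}) \<omega>) (monomial B) (\<lambda>p \<omega>. of_nat (count B p) * monomial (B - {#p#}) \<omega>)"
    and "\<And>\<psi> e. nonneg_poly \<psi> e \<Longrightarrow> Q (\<lambda>_. 0) (\<lambda>_ _. 0) \<psi> e"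
    and "\<And>\<phi> d. nonneg_poly \<phi> d \<Longrightarrow> Q \<phi> d (\<lambda>_. 0) (\<lambda>_ _. 0)"
    and "\<And>\<phi> d \<phi>' d' \<psi> e. nonneg_poly \<phi> d \<Longrightarrow> nonneg_poly \<phi>' d' \<Longrightarrow> nonneg_poly \<psi> e \<Longrightarrow> Q \<phi> d \<psi> e \<Longrightarrow> Q \<phi>' d' \<psi> e \<Longrightarrow>
      Q (\<lambda>\<omega>. \<phi> \<omega> + \<phi>' \<omega>) (\<lambda>p \<omega>. d p \<omega> + d' p \<omega>) \<psi> e"
    and "\<And>\<phi> d \<psi> e \<psi>' e'. nonneg_poly \<phi> d \<Longrightarrow> nonneg_poly \<psi> e \<Longrightarrow> nonneg_poly \<psi>' e' \<Longrightarrow> Q \<phi> d \<psi> e \<Longrightarrow> Q \<phi> d \<psi>' e' \<Longrightarrow>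
      Q \<phi> d (\<lambda>\<omega>. \<psi> \<omega> + \<psi>' \<omega>) (\<lambda>p \<omega>. e p \<omega> + e' p \<omega>)"
    and congr: "\<And>\<phi> d d' \<psi> e e'. Q \<phi> d \<psi> e \<Longrightarrow> (\<And>p \<omega>. p \<in> V \<Longrightarrow> d p \<omega> = d' p \<omega>) \<Longrightarrow> (\<And>p \<omega>. p \<in> V \<Longrightarrow> e p \<omega> = e' p \<omega>) \<Longrightarrow> Q \<phi> d' \<psi> e'"
  shows "Q \<phi> d \<psi> e"
  using assms(1)
proof induction
  case A: (monomial A)
  from assms(2) show ?case
  proof induction
    case (monomial B)
    show ?case by (rule assms(3)[OF A monomial])
  next
    case zero
    show ?case by (rule assms(5)[OF nonneg_poly.monomial[OF A]])
  next
    case (add \<phi> d \<psi> e)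
    show ?case by (rule assms(7)[OF nonneg_poly.monomial[OF A] add.hyps add.IH])
  next
    case (congr \<phi> d \<phi>' d')
    then have "\<phi>' = \<phi>" by auto
    show ?case unfolding \<open>\<phi>' = \<phi>\<close>
      by (rule assms(8)[OF congr.IH]) (use congr.hyps in auto)
  qed
next
  case (congr \<phi> d \<phi>' d')
  then have "\<phi>' = \<phi>" by auto
  show ?case unfolding \<open>\<phi>' = \<phi>\<close>
    by (rule assms(8)[OF congr.IH]) (use congr.hyps in auto)
qed (use assms in auto)

lemma mean_superadd:
  assumes "nonneg_poly \<phi> d" "nonneg_poly \<psi> e"
  shows "mean \<phi> * mean \<psi> \<le> mean (\<lambda>\<omega>. \<phi> \<omega> * \<psi> \<omega>)"
  using assms
proof (induction rule: nonneg_poly_bilinear_induct)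
  case (monomial A B)
  then show ?case using monomial_moment_superadd[of A B] mean_monomial[of A] mean_monomial[of B] mean_monomial[of "A + B"] by simp
next
  case (add_left \<phi> d \<phi>' d' \<psi> e)
  show ?case
    unfolding mean_mult_add_left[OF add_left(1-3)] mean_add[OF add_left(1,2)[THEN nonneg_poly_integrable]]
    using add_left(4,5) by (simp add: ring_distribs)
next
  case (add_right \<phi> d \<psi> e \<psi>' e')
  show ?case
    unfolding mean_mult_add_right[OF add_right(1-3)] mean_add[OF add_right(2,3)[THEN nonneg_poly_integrable]]
    using add_right(4,5) by (simp add: ring_distribs)
qed auto

lemma mean_cov:
  assumes "nonneg_poly \<phi> d" "nonneg_poly \<psi> e"
  shows "mean (\<lambda>\<omega>. \<phi> \<omega> * \<psi> \<omega>) \<le> mean \<phi> * mean \<psi> + \<kappa> * (\<Sum>p\<in>V. mean (\<lambda>\<omega>. d p \<omega> * e (prod.swap p) \<omega>))"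
  using assms
proof (induction rule: nonneg_poly_bilinear_induct)
  case (monomial A B)
  have "mean (\<lambda>\<omega>. of_nat (count A p) * monomial (A - {#p#}) \<omega> * (of_nat (count B q) * monomial (B - {#q#}) \<omega>)) =
      real (count A p) * real (count B q) * monomial_moment ((A - {#p#}) + (B - {#q#}))" for p q
  proof -
    have "mean (\<lambda>\<omega>. of_nat (count A p) * monomial (A - {#p#}) \<omega> * (of_nat (count B q) * monomial (B - {#q#}) \<omega>))
        = mean (\<lambda>\<omega>. of_real (real (count A p) * real (count B q)) * monomial ((A - {#p#}) + (B - {#q#})) \<omega>)"
      by (simp add: mult_ac)
    also have "\<dots> = real (count A p) * real (count B q) * monomial_moment ((A - {#p#}) + (B - {#q#}))"
      unfolding mean_of_real_mult by (subst mean_monomial) (use monomial in \<open>auto dest: in_diffD\<close>)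
    finally show ?thesis .
  qed
  then show ?case using monomial_moment_cov[OF monomial] mean_monomial[of A] mean_monomial[of B] mean_monomial[of "A + B"] monomial by simp
next
  case (add_left \<phi> d \<phi>' d' \<psi> e)
  have "(\<Sum>p\<in>V. mean (\<lambda>\<omega>. (d p \<omega> + d' p \<omega>) * e (prod.swap p) \<omega>)) =
     (\<Sum>p\<in>V. mean (\<lambda>\<omega>. d p \<omega> * e (prod.swap p) \<omega>)) + (\<Sum>p\<in>V. mean (\<lambda>\<omega>. d' p \<omega> * e (prod.swap p) \<omega>))"
    unfolding sum.distrib[symmetric] ring_distribs using add_left.hyps
    by (intro sum.cong refl mean_add nonneg_poly_deriv_mult_integrable) auto
  then show ?case
    unfolding mean_mult_add_left[OF add_left(1-3)] mean_add[OF add_left(1,2)[THEN nonneg_poly_integrable]]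
    using add_left(4,5) by (simp add: ring_distribs)
next
  case (add_right \<phi> d \<psi> e \<psi>' e')
  have "(\<Sum>p\<in>V. mean (\<lambda>\<omega>. d p \<omega> * (e (prod.swap p) \<omega> + e' (prod.swap p) \<omega>))) =
     (\<Sum>p\<in>V. mean (\<lambda>\<omega>. d p \<omega> * e (prod.swap p) \<omega>)) + (\<Sum>p\<in>V. mean (\<lambda>\<omega>. d p \<omega> * e' (prod.swap p) \<omega>))"
    unfolding sum.distrib[symmetric] ring_distribs using add_right.hyps
    by (intro sum.cong refl mean_add nonneg_poly_deriv_mult_integrable) auto
  then show ?case
    unfolding mean_mult_add_right[OF add_right(1-3)] mean_add[OF add_right(2,3)[THEN nonneg_poly_integrable]]
    using add_right(4,5) by (simp add: ring_distribs)
next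
  case (congr \<phi> d d' \<psi> e e')
  have "(\<Sum>p\<in>V. mean (\<lambda>\<omega>. d p \<omega> * e (prod.swap p) \<omega>)) = (\<Sum>p\<in>V. mean (\<lambda>\<omega>. d' p \<omega> * e' (prod.swap p) \<omega>))"
    using congr by (intro sum.cong refl) auto
  with congr show ?case by simp
qed auto

text \<open>Gaussian integration by parts. On monomials it is the recursion itself, and both sides
  are additive; the derivative is taken at the transposed index because only that entry is
  correlated with \<open>S p\<close>.\<close>

lemma mean_stein:
  assumes "nonneg_poly \<phi> d" and p: "p \<in> V"
  shows "mean (\<lambda>\<omega>. \<phi> \<omega> * S p \<omega>) = \<kappa> * mean (d (prod.swap p))"
  using assms(1)
proof induction
  case (monomial A)
  have "mean (\<lambda>\<omega>. monomial A \<omega> * S p \<omega>) = monomial_moment (add_mset p A)"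
    unfolding monomial_moment_def mean_def by (simp add: mult.commute)
  also have "\<dots> = \<kappa> * (real (count A (prod.swap p)) * mean (monomial (A - {#prod.swap p#})))"
    by (simp only: monomial_moment_add[OF p monomial] mean_monomial[OF set_mset_diff_subset[OF monomial]] mult.assoc)
  also have "\<dots> = \<kappa> * mean (\<lambda>\<omega>. of_nat (count A (prod.swap p)) * monomial (A - {#prod.swap p#}) \<omega>)"
    by (subst mean_of_real_mult[symmetric]) simp
  finally show ?case .
next
  case (add \<phi> d \<psi> e)
  have p': "prod.swap p \<in> V" using p by simp
  have "mean (\<lambda>\<omega>. d (prod.swap p) \<omega> + e (prod.swap p) \<omega>) = mean (d (prod.swap p)) + mean (e (prod.swap p))"
    using nonneg_poly_deriv[OF add.hyps(1) p'] nonneg_poly_deriv[OF add.hyps(2) p'] by (intro mean_add) (auto dest: nonneg_poly_integrable)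
  then show ?case
    unfolding mean_mult_add_left[OF add.hyps nonneg_poly_S[OF p]]
    using add.IH by (simp add: ring_distribs)
next
  case (congr \<phi> d \<phi>' d')
  have "\<phi>' = \<phi>" "d' (prod.swap p) = d (prod.swap p)" using congr p by (auto simp del: mem_Times_iff)
  then show ?case using congr by simp
qed simp

end

section \<open>Entries and traces of powers as polynomials in the matrix entries\<close>

section \<open>Moments of matrix powers\<close>

lemma sum_even_index:
  fixes f :: "nat \<Rightarrow> 'a :: comm_monoid_add"
  assumes "\<And>a. odd a \<Longrightarrow> f a = 0"
  shows "(\<Sum>a<Suc (2 * i). f a) = (\<Sum>j\<le>i. f (2 * j))"
  using assms by (induction i) auto

text \<open>The covariance terms turn the factor \<open>n\<close> of the Catalan recursion into \<open>n + i\<^sup>3 / x\<close>;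
  this is where the correction \<open>i \<surd>i\<close> comes from.\<close>

lemma cubic_absorb:
  fixes r :: real
  assumes "r \<ge> 0" "i \<ge> 1"
  shows "r + real i ^ 3 / (r + real i * sqrt (real i)) \<le> r + real i * sqrt (real i)"
proof -
  have "real i * sqrt (real i) > 0" using assms by simp
  moreover have "(real i * sqrt (real i)) * (real i * sqrt (real i)) = real i ^ 3"
    by (simp add: power3_eq_cube mult_ac)
  ultimately have "real i ^ 3 \<le> (real i * sqrt (real i)) * (r + real i * sqrt (real i))"
    using assms(1) by (simp add: ring_distribs)
  moreover have "0 < r + real i * sqrt (real i)"
    using assms by (intro add_nonneg_pos) auto
  ultimately have "real i ^ 3 / (r + real i * sqrt (real i)) \<le> real i * sqrt (real i)"
    by (simp only: pos_divide_le_eq)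
  then show ?thesis by simp
qed

lemma catalan_convolution_power:
  "(\<Sum>j\<le>i. (catalan j * y ^ j) * (r * (catalan (i - j) * y ^ (i - j)))) = r * y ^ i * catalan (Suc i)"
proof -
  have "(catalan j * y ^ j) * (r * (catalan (i - j) * y ^ (i - j))) = r * y ^ i * (catalan j * catalan (i - j))"
    if "j \<in> {..i}" for j
  proof -
    have "y ^ i = y ^ j * y ^ (i - j)" using that by (simp add: power_add[symmetric])
    then show ?thesis by (simp only: mult_ac)
  qed
  then have "(\<Sum>j\<le>i. (catalan j * y ^ j) * (r * (catalan (i - j) * y ^ (i - j)))) = (\<Sum>j\<le>i. r * y ^ i * (catalan j * catalan (i - j)))"
    by (intro sum.cong refl)
  then show ?thesis by (simp only: catalan_convolution sum_distrib_left[symmetric])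
qed

context gue_moments begin

text \<open>Entries of the powers of the matrix with entries \<open>S (i, j)\<close>, written out as
  sums because \<open>gue_moments\<close> provides a family of entries and no matrix.\<close>

fun pow_entry :: "nat \<Rightarrow> nat \<Rightarrow> nat \<Rightarrow> 'w \<Rightarrow> complex" where
  "pow_entry 0 u v \<omega> = (if u = v then 1 else 0)"
| "pow_entry (Suc k) u v \<omega> = (\<Sum>w<n. pow_entry k u w \<omega> * S (w, v) \<omega>)"

definition pow_trace :: "nat \<Rightarrow> 'w \<Rightarrow> complex" where
  "pow_trace k \<omega> = (\<Sum>u<n. pow_entry k u u \<omega>)"

lemma pow_entry_add: "r < n \<Longrightarrow> (\<Sum>u<n. pow_entry a s u \<omega> * pow_entry b u r \<omega>) = pow_entry (a + b) s r \<omega>"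
proof (induction b arbitrary: r)
  case 0
  have "(\<Sum>u<n. pow_entry a s u \<omega> * pow_entry 0 u r \<omega>) = (\<Sum>u<n. if u = r then pow_entry a s u \<omega> else 0)"
    by (intro sum.cong) auto
  with 0 show ?case by simp
next
  case (Suc b)
  have "(\<Sum>u<n. pow_entry a s u \<omega> * pow_entry (Suc b) u r \<omega>) = (\<Sum>w<n. (\<Sum>u<n. pow_entry a s u \<omega> * pow_entry b u w \<omega>) * S (w, r) \<omega>)"
    unfolding pow_entry.simps sum_distrib_left sum_distrib_right by (subst sum.swap) (simp add: mult_ac)
  also have "\<dots> = (\<Sum>w<n. pow_entry (a + b) s w \<omega> * S (w, r) \<omega>)"
    by (intro sum.cong refl) (simp add: Suc.IH)
  finally show ?case by simp
qed

text \<open>Differentiating a product of \<open>k\<close> factors in the entry \<open>p\<close>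
  splits it at the differentiated factor: \<open>a\<close> factors remain on the left, ending at row
  \<open>fst p\<close>, and \<open>k - 1 - a\<close> on the right, starting at column
  \<open>snd p\<close>.\<close>

lemma nonneg_poly_pow_entry:
  assumes "v < n"
  shows "nonneg_poly (pow_entry k u v) (\<lambda>p \<omega>. \<Sum>a<k. pow_entry a u (fst p) \<omega> * pow_entry (k - 1 - a) (snd p) v \<omega>)"
  using assms
proof (induction k arbitrary: v)
  case 0
  show ?case
    by (cases "u = v") (auto intro: nonneg_poly.congr[OF nonneg_poly_one] nonneg_poly.congr[OF nonneg_poly.zero])
next
  case (Suc k)
  have "nonneg_poly (\<lambda>\<omega>. \<Sum>w<n. pow_entry k u w \<omega> * S (w, v) \<omega>)
     (\<lambda>p \<omega>. \<Sum>w<n. (\<Sum>a<k. pow_entry a u (fst p) \<omega> * pow_entry (k - 1 - a) (snd p) w \<omega>) * S (w, v) \<omega>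
        + pow_entry k u w \<omega> * (if p = (w, v) then 1 else 0))"
    using Suc.prems by (intro nonneg_poly_sum nonneg_poly_mult Suc.IH nonneg_poly_S) auto
  then show ?case
  proof (rule nonneg_poly.congr)
    fix p \<omega> assume p: "p \<in> V"
    have "(\<Sum>w<n. (\<Sum>a<k. pow_entry a u (fst p) \<omega> * pow_entry (k - 1 - a) (snd p) w \<omega>) * S (w, v) \<omega>) =
       (\<Sum>a<k. pow_entry a u (fst p) \<omega> * (\<Sum>w<n. pow_entry (k - 1 - a) (snd p) w \<omega> * S (w, v) \<omega>))"
      unfolding sum_distrib_left sum_distrib_right by (subst sum.swap) (simp add: mult_ac)
    also have "\<dots> = (\<Sum>a<k. pow_entry a u (fst p) \<omega> * pow_entry (k - a) (snd p) v \<omega>)"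
    proof (intro sum.cong refl)
      fix a assume "a \<in> {..<k}"
      then have "k - a = Suc (k - 1 - a)" by auto
      then show "pow_entry a u (fst p) \<omega> * (\<Sum>w<n. pow_entry (k - 1 - a) (snd p) w \<omega> * S (w, v) \<omega>) = pow_entry a u (fst p) \<omega> * pow_entry (k - a) (snd p) v \<omega>"
        by (simp only: pow_entry.simps)
    qed
    finally have 1: "(\<Sum>w<n. (\<Sum>a<k. pow_entry a u (fst p) \<omega> * pow_entry (k - 1 - a) (snd p) w \<omega>) * S (w, v) \<omega>) =
      (\<Sum>a<k. pow_entry a u (fst p) \<omega> * pow_entry (k - a) (snd p) v \<omega>)" .
    have "(\<Sum>w<n. pow_entry k u w \<omega> * (if p = (w, v) then 1 else 0)) =
        (\<Sum>w<n. if w = fst p then pow_entry k u w \<omega> * (if snd p = v then 1 else 0) else 0)"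
      by (intro sum.cong) auto
    also have "\<dots> = pow_entry k u (fst p) \<omega> * pow_entry 0 (snd p) v \<omega>"
      using p by auto
    \<comment> \<open>The newly appended last factor contributes the summand
      \<open>a = k\<close>.\<close>
    finally have 2: "(\<Sum>w<n. pow_entry k u w \<omega> * (if p = (w, v) then 1 else 0)) = pow_entry k u (fst p) \<omega> * pow_entry 0 (snd p) v \<omega>" .
    show "(\<Sum>w<n. (\<Sum>a<k. pow_entry a u (fst p) \<omega> * pow_entry (k - 1 - a) (snd p) w \<omega>) * S (w, v) \<omega>
        + pow_entry k u w \<omega> * (if p = (w, v) then 1 else 0)) =
       (\<Sum>a<Suc k. pow_entry a u (fst p) \<omega> * pow_entry (Suc k - 1 - a) (snd p) v \<omega>)"
      unfolding sum.distrib 1 2 by simp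
  qed simp
qed

text \<open>By cyclicity of the trace, each of the \<open>k\<close> choices of the differentiated
  factor leaves the same entry of the power \<open>k - 1\<close>.\<close>

lemma nonneg_poly_pow_trace: "nonneg_poly (pow_trace k) (\<lambda>p \<omega>. of_nat k * pow_entry (k - 1) (snd p) (fst p) \<omega>)"
proof -
  have "nonneg_poly (\<lambda>\<omega>. \<Sum>u<n. pow_entry k u u \<omega>) (\<lambda>p \<omega>. \<Sum>u<n. \<Sum>a<k. pow_entry a u (fst p) \<omega> * pow_entry (k - 1 - a) (snd p) u \<omega>)"
    by (intro nonneg_poly_sum nonneg_poly_pow_entry) auto
  then show ?thesis
  proof (rule nonneg_poly.congr)
    fix p \<omega> assume p: "p \<in> V"
    have "(\<Sum>u<n. \<Sum>a<k. pow_entry a u (fst p) \<omega> * pow_entry (k - 1 - a) (snd p) u \<omega>) =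
       (\<Sum>a<k. \<Sum>u<n. pow_entry (k - 1 - a) (snd p) u \<omega> * pow_entry a u (fst p) \<omega>)"
      by (subst sum.swap) (simp add: mult_ac)
    also have "\<dots> = (\<Sum>a<k. pow_entry (k - 1) (snd p) (fst p) \<omega>)"
      using p by (intro sum.cong refl) (auto simp: pow_entry_add)
    finally show "(\<Sum>u<n. \<Sum>a<k. pow_entry a u (fst p) \<omega> * pow_entry (k - 1 - a) (snd p) u \<omega>) = of_nat k * pow_entry (k - 1) (snd p) (fst p) \<omega>"
      by simp
  qed (simp add: pow_trace_def)
qed

section \<open>The moment recursion and its comparison with the Catalan recursion\<close>

definition entry_moment :: "nat \<Rightarrow> nat \<Rightarrow> nat \<Rightarrow> real" where "entry_moment k u v = mean (pow_entry k u v)"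
definition trace_moment :: "nat \<Rightarrow> real" where "trace_moment k = mean (pow_trace k)"

lemma entry_moment_nonneg: "v < n \<Longrightarrow> 0 \<le> entry_moment k u v"
  unfolding entry_moment_def by (rule mean_nonneg[OF nonneg_poly_pow_entry])

lemma trace_moment_eq: "trace_moment k = (\<Sum>u<n. entry_moment k u u)"
  unfolding trace_moment_def entry_moment_def pow_trace_def by (rule mean_sum) (auto intro: nonneg_poly_integrable[OF nonneg_poly_pow_entry])

lemma trace_moment_nonneg: "0 \<le> trace_moment k"
  unfolding trace_moment_eq by (intro sum_nonneg entry_moment_nonneg) auto

lemma entry_moment_0: "entry_moment 0 u v = (if u = v then 1 else 0)"
  by (simp add: entry_moment_def mean_def prob_space)

lemma trace_moment_0: "trace_moment 0 = n" by (simp add: trace_moment_eq entry_moment_0)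

text \<open>Integrate by parts in the last factor \<open>S (w, v)\<close>. The derivative at
  \<open>(v, w)\<close> splits the first \<open>k\<close> factors into an entry
  \<open>(u, v)\<close> and an entry \<open>(w, w)\<close>, and summing over \<open>w\<close> makes
  the latter a trace.\<close>

lemma schwinger_dyson:
  assumes v: "v < n"
  shows "entry_moment (Suc k) u v = \<kappa> * (\<Sum>a<k. mean (\<lambda>\<omega>. pow_entry a u v \<omega> * pow_trace (k - 1 - a) \<omega>))"
proof -
  have "entry_moment (Suc k) u v = (\<Sum>w<n. mean (\<lambda>\<omega>. pow_entry k u w \<omega> * S (w, v) \<omega>))"
    unfolding entry_moment_def pow_entry.simps using v
    by (intro mean_sum nonneg_poly_mult_integrable[OF nonneg_poly_pow_entry nonneg_poly_S]) auto
  also have "\<dots> = (\<Sum>w<n. \<kappa> * mean (\<lambda>\<omega>. \<Sum>a<k. pow_entry a u v \<omega> * pow_entry (k - 1 - a) w w \<omega>))"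
    using v by (intro sum.cong refl) (subst mean_stein[OF nonneg_poly_pow_entry], auto)
  also have "\<dots> = \<kappa> * (\<Sum>w<n. \<Sum>a<k. mean (\<lambda>\<omega>. pow_entry a u v \<omega> * pow_entry (k - 1 - a) w w \<omega>))"
    unfolding sum_distrib_left[symmetric] using v
    by (intro arg_cong2[where f = "(*)"] sum.cong refl mean_sum nonneg_poly_mult_integrable[OF nonneg_poly_pow_entry nonneg_poly_pow_entry]) auto
  also have "(\<Sum>w<n. \<Sum>a<k. mean (\<lambda>\<omega>. pow_entry a u v \<omega> * pow_entry (k - 1 - a) w w \<omega>)) = (\<Sum>a<k. mean (\<lambda>\<omega>. pow_entry a u v \<omega> * pow_trace (k - 1 - a) \<omega>))"
    unfolding pow_trace_def sum_distrib_left using v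
    by (subst sum.swap, intro sum.cong refl mean_sum[symmetric] nonneg_poly_mult_integrable[OF nonneg_poly_pow_entry nonneg_poly_pow_entry]) auto
  finally show ?thesis .
qed

lemma mean_pow_entry_trace_ge:
  assumes v: "v < n"
  shows "entry_moment a u v * trace_moment b \<le> mean (\<lambda>\<omega>. pow_entry a u v \<omega> * pow_trace b \<omega>)"
  unfolding entry_moment_def trace_moment_def by (rule mean_superadd[OF nonneg_poly_pow_entry[OF v] nonneg_poly_pow_trace])

text \<open>A link between a factor of the entry and a factor of the trace inserts the opened trace
  into the gap of the entry, giving the entry \<open>(u, v)\<close> of the power
  \<open>a + b - 2\<close>. There are \<open>a * b\<close> such links.\<close>

lemma mean_pow_entry_trace_le:
  assumes v: "v < n"
  shows "mean (\<lambda>\<omega>. pow_entry a u v \<omega> * pow_trace b \<omega>) \<le> entry_moment a u v * trace_moment b + \<kappa> * (real a * real b * entry_moment (a + b - 2) u v)"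
proof -
  have "(\<Sum>p\<in>V. mean (\<lambda>\<omega>. (\<Sum>c<a. pow_entry c u (fst p) \<omega> * pow_entry (a - 1 - c) (snd p) v \<omega>) * (of_nat b * pow_entry (b - 1) (snd (prod.swap p)) (fst (prod.swap p)) \<omega>)))
     = mean (\<lambda>\<omega>. \<Sum>p\<in>V. (\<Sum>c<a. pow_entry c u (fst p) \<omega> * pow_entry (a - 1 - c) (snd p) v \<omega>) * (of_nat b * pow_entry (b - 1) (snd (prod.swap p)) (fst (prod.swap p)) \<omega>))"
    by (intro mean_sum[symmetric] nonneg_poly_deriv_mult_integrable[OF nonneg_poly_pow_entry[OF v] nonneg_poly_pow_trace]) auto
  also have "(\<lambda>\<omega>. \<Sum>p\<in>V. (\<Sum>c<a. pow_entry c u (fst p) \<omega> * pow_entry (a - 1 - c) (snd p) v \<omega>) * (of_nat b * pow_entry (b - 1) (snd (prod.swap p)) (fst (prod.swap p)) \<omega>))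
     = (\<lambda>\<omega>. of_real (real a * real b) * pow_entry (a + b - 2) u v \<omega>)"
  proof
    fix \<omega>
    have "(\<Sum>p\<in>V. (\<Sum>c<a. pow_entry c u (fst p) \<omega> * pow_entry (a - 1 - c) (snd p) v \<omega>) * (of_nat b * pow_entry (b - 1) (snd (prod.swap p)) (fst (prod.swap p)) \<omega>))
       = (\<Sum>r<n. \<Sum>s<n. (\<Sum>c<a. pow_entry c u r \<omega> * pow_entry (a - 1 - c) s v \<omega>) * (of_nat b * pow_entry (b - 1) r s \<omega>))"
      by (simp add: sum.cartesian_product case_prod_beta)
    also have "\<dots> = (\<Sum>r<n. \<Sum>s<n. \<Sum>c<a. of_nat b * (pow_entry c u r \<omega> * (pow_entry (b - 1) r s \<omega> * pow_entry (a - 1 - c) s v \<omega>)))"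
      unfolding sum_distrib_left sum_distrib_right by (simp add: mult_ac)
    also have "\<dots> = (\<Sum>r<n. \<Sum>c<a. \<Sum>s<n. of_nat b * (pow_entry c u r \<omega> * (pow_entry (b - 1) r s \<omega> * pow_entry (a - 1 - c) s v \<omega>)))"
      by (intro sum.cong refl sum.swap)
    also have "\<dots> = (\<Sum>c<a. \<Sum>r<n. \<Sum>s<n. of_nat b * (pow_entry c u r \<omega> * (pow_entry (b - 1) r s \<omega> * pow_entry (a - 1 - c) s v \<omega>)))"
      by (rule sum.swap)
    also have "\<dots> = (\<Sum>c<a. of_nat b * pow_entry (a + b - 2) u v \<omega>)"
    proof (intro sum.cong refl)
      fix c assume c: "c \<in> {..<a}"
      show "(\<Sum>r<n. \<Sum>s<n. of_nat b * (pow_entry c u r \<omega> * (pow_entry (b - 1) r s \<omega> * pow_entry (a - 1 - c) s v \<omega>))) = of_nat b * pow_entry (a + b - 2) u v \<omega>"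
      \<comment> \<open>For \<open>b = 0\<close> the truncated \<open>b - 1\<close> is harmless,
        since the factor \<open>of_nat b\<close> vanishes.\<close>
      proof (cases b)
        case (Suc b')
        have "c + (b' + (a - 1 - c)) = a + b - 2" using c Suc by simp
        then have "(\<Sum>r<n. pow_entry c u r \<omega> * (\<Sum>s<n. pow_entry (b - 1) r s \<omega> * pow_entry (a - 1 - c) s v \<omega>)) = pow_entry (a + b - 2) u v \<omega>"
          using v Suc by (simp add: pow_entry_add)
        then show ?thesis by (simp add: sum_distrib_left[symmetric])
      qed simp
    qed
    finally show "(\<Sum>p\<in>V. (\<Sum>c<a. pow_entry c u (fst p) \<omega> * pow_entry (a - 1 - c) (snd p) v \<omega>) * (of_nat b * pow_entry (b - 1) (snd (prod.swap p)) (fst (prod.swap p)) \<omega>)) = of_real (real a * real b) * pow_entry (a + b - 2) u v \<omega>"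
      by simp
  qed
  finally show ?thesis
    using mean_cov[OF nonneg_poly_pow_entry[OF v, of a u] nonneg_poly_pow_trace[of b]] unfolding entry_moment_def trace_moment_def mean_of_real_mult by simp
qed

lemma trace_moment_ge: "trace_moment (Suc k) \<ge> \<kappa> * (\<Sum>a<k. trace_moment a * trace_moment (k - 1 - a))"
proof -
  have "(\<Sum>a<k. trace_moment a * trace_moment (k - 1 - a)) = (\<Sum>u<n. \<Sum>a<k. entry_moment a u u * trace_moment (k - 1 - a))"
    by (subst sum.swap) (simp add: trace_moment_eq[of a for a] sum_distrib_right)
  also have "\<kappa> * \<dots> \<le> \<kappa> * (\<Sum>u<n. \<Sum>a<k. mean (\<lambda>\<omega>. pow_entry a u u \<omega> * pow_trace (k - 1 - a) \<omega>))"
    using \<kappa>_pos by (intro mult_left_mono sum_mono mean_pow_entry_trace_ge) auto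
  also have "\<dots> = trace_moment (Suc k)"
    by (simp add: trace_moment_eq schwinger_dyson sum_distrib_left)
  finally show ?thesis .
qed

text \<open>Single entries are bounded, rather than traces, because the expectation of
  \<open>tr (e^X e^Y)\<close> involves off-diagonal entries. For \<open>k < 3\<close> the
  subtraction \<open>k - 3\<close> is truncated, but then every coefficient
  \<open>a * (k - 1 - a)\<close> is 0.\<close>

lemma entry_moment_le:
  assumes v: "v < n"
  shows "entry_moment (Suc k) u v \<le> \<kappa> * (\<Sum>a<k. entry_moment a u v * trace_moment (k - 1 - a) + \<kappa> * (real a * real (k - 1 - a) * entry_moment (k - 3) u v))"
  unfolding schwinger_dyson[OF v]
proof (intro mult_left_mono sum_mono)
  fix a assume "a \<in> {..<k}"
  then have "a + (k - 1 - a) - 2 = k - 3" by auto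
  then show "mean (\<lambda>\<omega>. pow_entry a u v \<omega> * pow_trace (k - 1 - a) \<omega>) \<le> entry_moment a u v * trace_moment (k - 1 - a) + \<kappa> * (real a * real (k - 1 - a) * entry_moment (k - 3) u v)"
    using mean_pow_entry_trace_le[OF v, of a u "k - 1 - a"] by simp
qed (use \<kappa>_pos in simp)

text \<open>In the upper recursion every term contains a smaller odd moment or a zero coefficient,
  so the moment is at most 0, and it is nonnegative.\<close>

lemma entry_moment_odd: "odd k \<Longrightarrow> v < n \<Longrightarrow> entry_moment k u v = 0"
proof (induction k arbitrary: u v rule: less_induct)
  case (less k)
  then obtain k' where k: "k = Suc k'" and ev: "even k'" by (cases k) auto
  have m0: "trace_moment j = 0" if "odd j" "j < k" for j
    unfolding trace_moment_eq using less.IH[OF that(2,1)] by simp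
  have "(\<Sum>a<k'. entry_moment a u v * trace_moment (k' - 1 - a) + \<kappa> * (real a * real (k' - 1 - a) * entry_moment (k' - 3) u v)) = 0"
  proof (intro sum.neutral ballI)
    fix a assume a: "a \<in> {..<k'}"
    have "entry_moment a u v * trace_moment (k' - 1 - a) = 0"
    proof (cases "odd a")
      case True
      then show ?thesis using less.IH[of a] a k less.prems by simp
    next
      case False
      then have "odd (k' - 1 - a)" using ev a by auto
      then show ?thesis using m0[of "k' - 1 - a"] a k by simp
    qed
    moreover have "real a * real (k' - 1 - a) * entry_moment (k' - 3) u v = 0"
    proof (cases "k' \<ge> 3")
      case True
      then have "odd (k' - 3)" using ev by auto
      then show ?thesis using less.IH[of "k' - 3"] k less.prems by simp
    next
      case False
      then have "a = 0 \<or> k' - 1 - a = 0" using a by auto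
      then show ?thesis by auto
    qed
    ultimately show "entry_moment a u v * trace_moment (k' - 1 - a) + \<kappa> * (real a * real (k' - 1 - a) * entry_moment (k' - 3) u v) = 0"
      by (simp only: mult_zero_right add_0_left)
  qed
  then have "entry_moment k u v \<le> 0" using entry_moment_le[OF less.prems(2), of k' u] unfolding k by simp
  with entry_moment_nonneg[OF less.prems(2)] show ?case by (simp add: order_antisym)
qed

lemma trace_moment_odd: "odd k \<Longrightarrow> trace_moment k = 0"
  by (simp add: trace_moment_eq entry_moment_odd)

text \<open>Restricted to even indices, \<open>trace_moment_ge\<close> dominates the Catalan
  recursion, with one factor \<open>\<kappa> * n\<close> per step.\<close>

lemma trace_moment_even_ge: "real n * (catalan i * (\<kappa> * real n) ^ i) \<le> trace_moment (2 * i)"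
proof (induction i rule: less_induct)
  case (less i)
  show ?case
  proof (cases i)
    case (Suc i')
    have "real n * (catalan i * (\<kappa> * real n) ^ i) =
      \<kappa> * (\<Sum>j\<le>i'. (real n * (catalan j * (\<kappa> * real n) ^ j)) * (real n * (catalan (i' - j) * (\<kappa> * real n) ^ (i' - j))))"
      unfolding mult.assoc[of "real n"] sum_distrib_left[symmetric] catalan_convolution_power
      by (simp add: Suc mult_ac)
    also have "\<dots> \<le> \<kappa> * (\<Sum>j\<le>i'. trace_moment (2 * j) * trace_moment (2 * (i' - j)))"
      using \<kappa>_pos Suc less_imp_le[OF catalan_pos]
      by (intro mult_left_mono sum_mono mult_mono less.IH trace_moment_nonneg mult_nonneg_nonneg zero_le_power) auto
    also have "(\<Sum>j\<le>i'. trace_moment (2 * j) * trace_moment (2 * (i' - j))) = (\<Sum>a<Suc (2 * i'). trace_moment a * trace_moment (Suc (2 * i') - 1 - a))"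
      by (subst sum_even_index) (auto simp: trace_moment_odd right_diff_distrib')
    also have "\<kappa> * \<dots> \<le> trace_moment (2 * i)"
      using trace_moment_ge[of "Suc (2 * i')"] by (simp add: Suc)
    finally show ?thesis .
  qed (simp add: trace_moment_0 catalan_0)
qed

text \<open>The products in the recursion give the Catalan convolution with weight \<open>n\<close>,
  the covariance terms a multiple of it with weight at most \<open>i^3 / x\<close>;
  \<open>cubic_absorb\<close> bounds the total weight by \<open>x\<close>.\<close>

lemma entry_moment_even_le: "v < n \<Longrightarrow> entry_moment (2 * i) u v \<le> moment_bound \<kappa> n i"
proof (induction i arbitrary: u v rule: less_induct)
  case (less i)
  show ?case
  proof (cases i)
    case 0
    then show ?thesis by (simp add: entry_moment_0 moment_bound_def catalan_0)
  next
    case (Suc i')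
    \<comment> \<open>The correction is frozen at the index \<open>i\<close>. All smaller moments
      are bounded with this one \<open>x\<close>, so that the bounds \<open>B j\<close> have a
      common base and the Catalan convolution applies.\<close>
    define x where "x = real n + real i * sqrt (real i)"
    have x: "x > 0" using Suc by (simp add: x_def add_nonneg_pos)
    define B where "B = (\<lambda>j. catalan j * (\<kappa> * x) ^ j)"
    have B0: "0 \<le> B j" for j unfolding B_def using x \<kappa>_pos less_imp_le[OF catalan_pos] by simp
    have eB: "entry_moment (2 * j) u v \<le> B j" if "j < i" "v < n" for j u v
    proof -
      have "real j * sqrt (real j) \<le> real i * sqrt (real i)" using that by (intro mult_mono) auto
      then have "moment_bound \<kappa> n j \<le> B j"
        unfolding moment_bound_def B_def x_def using \<kappa>_pos less_imp_le[OF catalan_pos]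
        by (intro mult_left_mono power_mono) auto
      with less.IH[OF that, of u] show ?thesis by simp
    qed
    have mB: "trace_moment (2 * j) \<le> real n * B j" if "j < i" for j
      unfolding trace_moment_eq using sum_bounded_above[of "{..<n}" "\<lambda>u. entry_moment (2 * j) u u" "B j"] eB[OF that] by simp
    have conv: "(\<Sum>j\<le>i'. B j * (real n * B (i' - j))) = real n * (\<kappa> * x) ^ i' * catalan i"
      unfolding B_def catalan_convolution_power Suc by (rule refl)
    have first: "(\<Sum>a<Suc (2 * i'). entry_moment a u v * trace_moment (Suc (2 * i') - 1 - a)) \<le> real n * (\<kappa> * x) ^ i' * catalan i"
    proof -
      have "(\<Sum>a<Suc (2 * i'). entry_moment a u v * trace_moment (Suc (2 * i') - 1 - a)) = (\<Sum>j\<le>i'. entry_moment (2 * j) u v * trace_moment (2 * (i' - j)))"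
        using less.prems by (subst sum_even_index) (auto simp: entry_moment_odd right_diff_distrib')
      also have "\<dots> \<le> (\<Sum>j\<le>i'. B j * (real n * B (i' - j)))"
        using less.prems Suc by (intro sum_mono mult_mono eB mB B0 trace_moment_nonneg) auto
      finally show ?thesis using conv by simp
    qed
    \<comment> \<open>The moment in these terms has index \<open>i' - 1\<close>, one power of
      \<open>x\<close> short of the main term; the inequality is multiplied by \<open>x\<close> to
      compensate.\<close>
    have second: "(\<Sum>a<Suc (2 * i'). real a * real (Suc (2 * i') - 1 - a) * entry_moment (Suc (2 * i') - 3) u v) * x
       \<le> real i ^ 3 * (catalan i * (\<kappa> * x) ^ i' / \<kappa>)"
    proof (cases i')
      case 0
      then show ?thesis using \<kappa>_pos x less_imp_le[OF catalan_pos, of i] by simp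
    next
      case (Suc i'')
      have ii: "i = Suc (Suc i'')" using Suc \<open>i = Suc i'\<close> by simp
      have k3: "Suc (2 * i') - 3 = 2 * i''" using Suc by simp
      \<comment> \<open>The product of two numbers with sum \<open>2 * i'\<close> is largest when
        they are equal.\<close>
      have "real a * real (2 * i' - a) \<le> real i' * real i'" if "a < Suc (2 * i')" for a
      proof -
        have "real (2 * i' - a) = 2 * real i' - real a" using that by (simp add: of_nat_diff)
        moreover have "0 \<le> (real i' - real a)\<^sup>2" by simp
        ultimately show ?thesis by (simp add: power2_eq_square algebra_simps)
      qed
      then have "(\<Sum>a<Suc (2 * i'). real a * real (Suc (2 * i') - 1 - a) * entry_moment (Suc (2 * i') - 3) u v)
          \<le> (\<Sum>a<Suc (2 * i'). real i' * real i' * B i'')"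
        using less.prems eB[of i'' v u] ii unfolding k3
        by (intro sum_mono, intro mult_mono[where c = "entry_moment (2 * i'') u v"] entry_moment_nonneg) auto
      also have "\<dots> = (2 * real i' + 1) * real i' * real i' * B i''" by simp
      also have "\<dots> \<le> (2 * real i ^ 3) * B i''"
      proof (rule mult_right_mono[OF _ B0])
        \<comment> \<open>There are \<open>2 * i' + 1\<close> summands, at most
          \<open>2 * i\<close>; the factor 2 is taken up by \<open>catalan_growth\<close>
          afterwards.\<close>
        have "(2 * real i' + 1) * real i' * real i' \<le> (2 * real i) * real i * real i"
          using \<open>i = Suc i'\<close> by (intro mult_mono) auto
        then show "(2 * real i' + 1) * real i' * real i' \<le> 2 * real i ^ 3" by (simp add: power3_eq_cube)
      qed
      finally have "(\<Sum>a<Suc (2 * i'). real a * real (Suc (2 * i') - 1 - a) * entry_moment (Suc (2 * i') - 3) u v) * x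
         \<le> (2 * real i ^ 3) * B i'' * x" using x by (intro mult_right_mono) auto
      also have "\<dots> = real i ^ 3 * (2 * catalan i'' * (\<kappa> * x) ^ i' / \<kappa>)"
        using \<kappa>_pos by (simp add: B_def Suc)
      also have "\<dots> \<le> real i ^ 3 * (catalan i * (\<kappa> * x) ^ i' / \<kappa>)"
      proof -
        have "2 * catalan i'' \<le> catalan i"
          using catalan_growth(1)[of i''] catalan_growth(2)[of i''] unfolding ii by simp
        then show ?thesis using \<kappa>_pos x by (intro mult_left_mono divide_right_mono mult_right_mono) auto
      qed
      finally show ?thesis .
    qed
    define Z where "Z = (\<Sum>a<Suc (2 * i'). real a * real (Suc (2 * i') - 1 - a) * entry_moment (Suc (2 * i') - 3) u v)"
    have Z: "\<kappa> * Z \<le> real i ^ 3 / x * (catalan i * (\<kappa> * x) ^ i')"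
      using second \<kappa>_pos x unfolding Z_def[symmetric] by (simp add: field_simps)
    have "entry_moment (2 * i) u v \<le> \<kappa> * ((\<Sum>a<Suc (2 * i'). entry_moment a u v * trace_moment (Suc (2 * i') - 1 - a)) + \<kappa> * Z)"
    proof -
      have "2 * i = Suc (Suc (2 * i'))" by (simp add: Suc)
      then show ?thesis
        using entry_moment_le[OF less.prems, of "Suc (2 * i')" u] by (simp only: sum.distrib Z_def sum_distrib_left)
    qed
    also have "\<dots> \<le> \<kappa> * (real n * (\<kappa> * x) ^ i' * catalan i + real i ^ 3 / x * (catalan i * (\<kappa> * x) ^ i'))"
      using \<kappa>_pos by (intro mult_left_mono add_mono first Z) auto
    also have "\<dots> = \<kappa> * (real n + real i ^ 3 / x) * (catalan i * (\<kappa> * x) ^ i')"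
      by (simp add: algebra_simps)
    also have "\<dots> \<le> \<kappa> * x * (catalan i * (\<kappa> * x) ^ i')"
      using \<kappa>_pos x less_imp_le[OF catalan_pos] cubic_absorb[of "real n" i] Suc unfolding x_def
      by (intro mult_right_mono mult_left_mono) auto
    also have "\<dots> = moment_bound \<kappa> n i"
      by (simp add: moment_bound_def x_def Suc)
    finally show ?thesis .
  qed
qed

end

section \<open>Expectation of the exponential series, term by term\<close>

section \<open>The mean of the matrix exponential\<close>

text \<open>The central binomial coefficient is at most \<open>4 ^ k\<close>.\<close>

lemma fact_double_le: "fact (2 * k) \<le> (4 ^ k * (fact k)\<^sup>2 :: real)"
proof (induction k)
  case (Suc k)
  have "fact (2 * Suc k) = real (2 * k + 2) * real (2 * k + 1) * fact (2 * k)" by (simp add: algebra_simps)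
  also have "\<dots> \<le> (4 * (real k + 1)\<^sup>2) * (4 ^ k * (fact k)\<^sup>2)"
  proof (rule mult_mono[OF _ Suc])
    show "real (2 * k + 2) * real (2 * k + 1) \<le> 4 * (real k + 1)\<^sup>2"
      by (simp add: power2_eq_square algebra_simps)
  qed auto
  also have "\<dots> = 4 ^ Suc k * (fact (Suc k))\<^sup>2"
    by (simp add: power2_eq_square algebra_simps)
  finally show ?case .
qed simp

lemma sums_even_index:
  fixes f :: "nat \<Rightarrow> real"
  assumes "\<And>k. odd k \<Longrightarrow> f k = 0" "(\<lambda>i. f (2 * i)) sums s"
  shows "f sums s"
  using assms sums_mono_reindex[of "\<lambda>i. 2 * i" f s] by (auto simp: strict_mono_def elim!: evenE)

locale gue_matrix = gue_moments M n "\<lambda>p \<omega>. X \<omega> $$ p" \<kappa>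
  for M :: "'w measure" and n :: nat and X :: "'w \<Rightarrow> complex mat" and \<kappa> :: real +
  assumes X_carrier: "\<omega> \<in> space M \<Longrightarrow> X \<omega> \<in> carrier_mat n n"
    and X_hermitian: "AE \<omega> in M. mat_adjoint (X \<omega>) = X \<omega>"
begin

lemma pow_entry_eq_pow:
  assumes "\<omega> \<in> space M" "u < n" "v < n"
  shows "pow_entry k u v \<omega> = (X \<omega> ^\<^sub>m k) $$ (u, v)"
  using assms(3)
proof (induction k arbitrary: v)
  case 0
  then show ?case using X_carrier[OF assms(1)] assms(2) by auto
next
  case (Suc k)
  then show ?case
    using mult_mat_entry[OF pow_carrier_mat[OF X_carrier[OF assms(1)]] X_carrier[OF assms(1)] assms(2), of v k]
    by simp
qed

lemma norm_pow_entry_sq: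
  assumes "u < n" "v < n"
  shows "AE \<omega> in M. complex_of_real ((norm (pow_entry k u v \<omega>))\<^sup>2) = pow_entry k u v \<omega> * pow_entry k v u \<omega>"
  using X_hermitian
proof (rule AE_mp, intro AE_I2 impI)
  fix \<omega> assume \<omega>: "\<omega> \<in> space M" and h: "mat_adjoint (X \<omega>) = X \<omega>"
  have "cnj (pow_entry k u v \<omega>) = pow_entry k v u \<omega>"
    using mat_adjoint_pow_entry[OF X_carrier[OF \<omega>] h assms] pow_entry_eq_pow[OF \<omega>] assms by simp
  then show "complex_of_real ((norm (pow_entry k u v \<omega>))\<^sup>2) = pow_entry k u v \<omega> * pow_entry k v u \<omega>"
    by (simp only: complex_norm_square)
qed

lemma pow_entry_integrable: "v < n \<Longrightarrow> integrable M (pow_entry k u v)"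
  by (rule nonneg_poly_integrable[OF nonneg_poly_pow_entry])

text \<open>Hermitian symmetry turns the squared modulus into the product of the entries
  \<open>(u, v)\<close> and \<open>(v, u)\<close>. The corresponding products over all
  \<open>w\<close> have nonnegative means and add up to the diagonal entry of the power
  \<open>2 * k\<close>.\<close>

lemma norm_pow_entry_sq_integral:
  assumes "u < n" "v < n"
  shows "integrable M (\<lambda>\<omega>. (norm (pow_entry k u v \<omega>))\<^sup>2)" (is ?int)
    and "(\<integral>\<omega>. (norm (pow_entry k u v \<omega>))\<^sup>2 \<partial>M) \<le> moment_bound \<kappa> n k" (is ?le)
proof -
  have ip: "integrable M (\<lambda>\<omega>. pow_entry k u w \<omega> * pow_entry k w u \<omega>)" if "w < n" for w
    using that assms by (intro nonneg_poly_mult_integrable[OF nonneg_poly_pow_entry nonneg_poly_pow_entry])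
  have [measurable]: "pow_entry k u v \<in> borel_measurable M"
    using pow_entry_integrable[OF assms(2)] by (rule borel_measurable_integrable)
  have "integrable M (\<lambda>\<omega>. complex_of_real ((norm (pow_entry k u v \<omega>))\<^sup>2))"
    by (rule integrable_cong_AE_imp[OF ip[OF assms(2)]]) (use norm_pow_entry_sq[OF assms] in \<open>auto simp: eq_commute\<close>)
  from integrable_Re[OF this] show ?int by simp
  have "complex_of_real (\<integral>\<omega>. (norm (pow_entry k u v \<omega>))\<^sup>2 \<partial>M) = (\<integral>\<omega>. pow_entry k u v \<omega> * pow_entry k v u \<omega> \<partial>M)"
    unfolding integral_complex_of_real[symmetric]
    by (rule integral_cong_AE) (use norm_pow_entry_sq[OF assms] borel_measurable_integrable[OF ip[OF assms(2)]] in auto)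
  then have "(\<integral>\<omega>. (norm (pow_entry k u v \<omega>))\<^sup>2 \<partial>M) = mean (\<lambda>\<omega>. pow_entry k u v \<omega> * pow_entry k v u \<omega>)"
    unfolding mean_def by (metis Re_complex_of_real)
  also have "\<dots> \<le> (\<Sum>w<n. mean (\<lambda>\<omega>. pow_entry k u w \<omega> * pow_entry k w u \<omega>))"
    using assms by (intro member_le_sum[where f = "\<lambda>w. mean (\<lambda>\<omega>. pow_entry k u w \<omega> * pow_entry k w u \<omega>)"])
      (auto intro: mean_nonneg[OF nonneg_poly_mult[OF nonneg_poly_pow_entry nonneg_poly_pow_entry]])
  also have "\<dots> = mean (\<lambda>\<omega>. \<Sum>w<n. pow_entry k u w \<omega> * pow_entry k w u \<omega>)"
    by (intro mean_sum[symmetric] ip) auto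
  also have "\<dots> = entry_moment (2 * k) u u"
    unfolding entry_moment_def using assms by (simp add: pow_entry_add mult_2)
  also have "\<dots> \<le> moment_bound \<kappa> n k"
    by (rule entry_moment_even_le[OF assms(1)])
  finally show ?le .
qed

text \<open>The termwise mean of the exponential series; \<open>mat_exp_integral\<close> identifies
  it with the mean of the entry \<open>(u, v)\<close> of the matrix exponential.\<close>

definition exp_mean :: "nat \<Rightarrow> nat \<Rightarrow> real" where
  "exp_mean u v = (\<Sum>k. entry_moment k u v / fact k)"

lemma exp_mean_sums:
  assumes "v < n"
  shows "(\<lambda>i. entry_moment (2 * i) u v / fact (2 * i)) sums exp_mean u v"
    and "(\<lambda>k. entry_moment k u v / fact k) sums exp_mean u v"
proof -
  have "summable (\<lambda>i. entry_moment (2 * i) u v / fact (2 * i))"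
  proof (rule summable_comparison_test')
    show "summable (\<lambda>k. 1 ^ k * moment_bound \<kappa> n k / fact (2 * k))"
      by (rule summable_moment_bound[OF \<kappa>_pos]) simp
    show "norm (entry_moment (2 * i) u v / fact (2 * i)) \<le> 1 ^ i * moment_bound \<kappa> n i / fact (2 * i)" for i
      using entry_moment_even_le[OF assms] entry_moment_nonneg[OF assms] by (simp add: divide_right_mono)
  qed
  then obtain s where s: "(\<lambda>i. entry_moment (2 * i) u v / fact (2 * i)) sums s" by (auto simp: summable_def)
  have "(\<lambda>k. entry_moment k u v / fact k) sums s"
    by (rule sums_even_index[OF _ s]) (simp add: entry_moment_odd assms)
  moreover from this have "s = exp_mean u v" unfolding exp_mean_def by (rule sums_unique)
  ultimately show "(\<lambda>i. entry_moment (2 * i) u v / fact (2 * i)) sums exp_mean u v" "(\<lambda>k. entry_moment k u v / fact k) sums exp_mean u v"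
    using s by auto
qed

lemma exp_mean_nonneg: "v < n \<Longrightarrow> 0 \<le> exp_mean u v"
  unfolding exp_mean_def by (intro suminf_nonneg sums_summable[OF exp_mean_sums(2)]) (auto intro!: divide_nonneg_nonneg entry_moment_nonneg)

lemma exp_mean_le:
  assumes "v < n"
  shows "exp_mean u v \<le> exp_upper \<kappa> n"
  unfolding exp_upper_def sums_unique[OF exp_mean_sums(1)[OF assms]]
  using summable_moment_bound[OF \<kappa>_pos, of 1 n]
  by (intro suminf_le sums_summable[OF exp_mean_sums(1)[OF assms]] divide_right_mono entry_moment_even_le assms) auto

lemma exp_mean_trace_ge: "real n * exp_lower \<kappa> n \<le> (\<Sum>u<n. exp_mean u u)"
proof -
  have s: "(\<lambda>i. trace_moment (2 * i) / fact (2 * i)) sums (\<Sum>u<n. exp_mean u u)"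
    unfolding trace_moment_eq sum_divide_distrib by (intro sums_sum exp_mean_sums(1)) auto
  have "real n * exp_lower \<kappa> n = (\<Sum>k. real n * (catalan k * (\<kappa> * real n) ^ k / fact (2 * k)))"
    unfolding exp_lower_def by (rule suminf_mult[symmetric, OF summable_exp_lower[OF \<kappa>_pos]])
  also have "\<dots> \<le> (\<Sum>u<n. exp_mean u u)"
    unfolding sums_unique[OF s]
    using trace_moment_even_ge
    by (intro suminf_le sums_summable[OF s] summable_mult summable_exp_lower[OF \<kappa>_pos]) (auto simp: divide_right_mono)
  finally show ?thesis .
qed

text \<open>The interchange of sum and integral needs first absolute moments of the terms, also for
  odd powers. They are controlled by second moments, which \<open>norm_pow_entry_sq_integral\<close>
  bounds.\<close>

lemma mat_exp_integral:
  assumes "u < n" "v < n"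
  shows "integrable M (\<lambda>\<omega>. mat_exp (X \<omega>) $$ (u, v))"
    and "(\<integral>\<omega>. mat_exp (X \<omega>) $$ (u, v) \<partial>M) = complex_of_real (exp_mean u v)"
proof -
  let ?f = "\<lambda>k \<omega>. pow_entry k u v \<omega> / fact k"
  have eq: "mat_exp (X \<omega>) $$ (u, v) = (\<Sum>k. ?f k \<omega>)" if "\<omega> \<in> space M" for \<omega>
    using that assms X_carrier[OF that] by (simp add: mat_exp_def pow_entry_eq_pow)
  have int: "integrable M (?f k)" for k
    using pow_entry_integrable[OF assms(2)] by simp
  have sm: "AE \<omega> in M. summable (\<lambda>k. norm (?f k \<omega>))"
  proof (rule AE_I2)
    fix \<omega> assume \<omega>: "\<omega> \<in> space M"
    define b where "b = Max ((\<lambda>ij. norm (X \<omega> $$ ij)) ` ({..<n} \<times> {..<n}))"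
    have b: "norm (X \<omega> $$ (i, j)) \<le> b" if "i < n" "j < n" for i j
      unfolding b_def using that by (intro Max_ge) auto
    show "summable (\<lambda>k. norm (?f k \<omega>))"
    proof (rule summable_comparison_test')
      show "summable (\<lambda>k. inverse (fact k) * (real n * b) ^ k)" by (rule summable_exp)
      show "norm (norm (?f k \<omega>)) \<le> inverse (fact k) * (real n * b) ^ k" for k
        using pow_mat_entry_bound[OF X_carrier[OF \<omega>] b assms, of k] pow_entry_eq_pow[OF \<omega> assms, of k]
        by (simp add: norm_divide divide_simps)
    qed
  qed
  have si: "summable (\<lambda>k. \<integral>\<omega>. norm (?f k \<omega>) \<partial>M)"
  proof (rule summable_comparison_test')
    show "summable (\<lambda>k. (1/2) ^ k + 8 ^ k * moment_bound \<kappa> n k / fact (2 * k))"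
      by (intro summable_add summable_geometric summable_moment_bound \<kappa>_pos) auto
    fix k
    have pw: "norm (?f k \<omega>) \<le> (1/2) ^ k + 8 ^ k / fact (2 * k) * (norm (pow_entry k u v \<omega>))\<^sup>2" for \<omega>
    proof -
      define t where "t = norm (?f k \<omega>)"
      \<comment> \<open>The inequality of arithmetic and geometric means with weight
        \<open>2 ^ k\<close>: the remainder \<open>(1/2) ^ k\<close> is summable, and the weight
        joins \<open>fact_double_le\<close> in the factor \<open>8 ^ k\<close>.\<close>
      have "0 \<le> (2 ^ k * t - 1)\<^sup>2" by simp
      then have "2 * (2 ^ k * t) \<le> (2 ^ k)\<^sup>2 * t\<^sup>2 + 1"
        by (simp add: power2_eq_square algebra_simps)
      then have "2 ^ k * (2 * t) \<le> 2 ^ k * (2 ^ k * t\<^sup>2 + (1/2) ^ k)"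
        by (simp add: power2_eq_square ring_distribs power_mult_distrib[symmetric] mult_ac)
      then have "2 * t \<le> 2 ^ k * t\<^sup>2 + (1/2) ^ k" by simp
      moreover have "t \<ge> 0" by (simp add: t_def)
      ultimately have "t \<le> (1/2) ^ k + 2 ^ k * t\<^sup>2" by (smt (verit) zero_le_power zero_le_divide_1_iff)
      also have "2 ^ k * t\<^sup>2 = 2 ^ k / (fact k)\<^sup>2 * (norm (pow_entry k u v \<omega>))\<^sup>2"
        by (simp add: t_def norm_divide power_divide)
      also have "\<dots> \<le> 8 ^ k / fact (2 * k) * (norm (pow_entry k u v \<omega>))\<^sup>2"
      proof (rule mult_right_mono)
        have "2 ^ k * fact (2 * k) \<le> (2 ^ k * (4 ^ k * (fact k)\<^sup>2) :: real)"
          by (intro mult_left_mono fact_double_le) auto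
        then have "2 ^ k * fact (2 * k) \<le> (8 ^ k * (fact k)\<^sup>2 :: real)"
          by (simp add: mult.assoc[symmetric] power_mult_distrib[symmetric])
        then show "2 ^ k / (fact k)\<^sup>2 \<le> (8 ^ k / fact (2 * k) :: real)"
          by (simp add: divide_simps mult_ac)
      qed simp
      finally show ?thesis unfolding t_def by simp
    qed
    have "(\<integral>\<omega>. norm (?f k \<omega>) \<partial>M) \<le> (\<integral>\<omega>. (1/2) ^ k + 8 ^ k / fact (2 * k) * (norm (pow_entry k u v \<omega>))\<^sup>2 \<partial>M)"
      by (rule integral_mono[OF integrable_norm[OF int] _ pw])
         (intro Bochner_Integration.integrable_add integrable_const integrable_mult_right norm_pow_entry_sq_integral(1) assms)
    also have "\<dots> = (1/2) ^ k + 8 ^ k / fact (2 * k) * (\<integral>\<omega>. (norm (pow_entry k u v \<omega>))\<^sup>2 \<partial>M)"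
      using norm_pow_entry_sq_integral(1)[OF assms] by (subst Bochner_Integration.integral_add) (auto simp: prob_space)
    also have "\<dots> \<le> (1/2) ^ k + 8 ^ k / fact (2 * k) * moment_bound \<kappa> n k"
      by (intro add_left_mono mult_left_mono norm_pow_entry_sq_integral(2) assms) auto
    finally show "norm (\<integral>\<omega>. norm (?f k \<omega>) \<partial>M) \<le> (1/2) ^ k + 8 ^ k * moment_bound \<kappa> n k / fact (2 * k)"
      by simp
  qed
  show "integrable M (\<lambda>\<omega>. mat_exp (X \<omega>) $$ (u, v))"
    using integrable_suminf[OF int sm si]
    by (rule Bochner_Integration.integrable_cong[THEN iffD1, rotated -1]) (simp_all add: eq)
  have "(\<integral>\<omega>. mat_exp (X \<omega>) $$ (u, v) \<partial>M) = (\<integral>\<omega>. (\<Sum>k. ?f k \<omega>) \<partial>M)"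
    by (rule Bochner_Integration.integral_cong) (simp_all add: eq)
  also have "\<dots> = (\<Sum>k. integral\<^sup>L M (?f k))"
    by (rule integral_suminf[OF int sm si])
  also have "\<dots> = (\<Sum>k. complex_of_real (entry_moment k u v / fact k))"
    unfolding entry_moment_def using nonneg_poly_integral[OF nonneg_poly_pow_entry[OF assms(2)]] by simp
  also have "\<dots> = complex_of_real (exp_mean u v)"
    using exp_mean_sums(2)[OF assms(2), of u] by (metis sums_of_real sums_unique)
  finally show "(\<integral>\<omega>. mat_exp (X \<omega>) $$ (u, v) \<partial>M) = complex_of_real (exp_mean u v)" .
qed

end

section \<open>From real Gaussian coordinates to Wick's formula for GUE entries\<close>

section \<open>Gaussian matrices\<close>

lemma wick_distr:
  assumes X: "X \<in> measurable M N" and f: "\<And>v. v \<in> V \<Longrightarrow> f v \<in> borel_measurable N"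
  shows "wick (distr M N X) V f C \<longleftrightarrow> wick M V (\<lambda>v \<omega>. f v (X \<omega>)) C"
proof -
  have meas: "(\<lambda>x. \<Prod>v\<in>#A. f v x) \<in> borel_measurable N" if "set_mset A \<subseteq> V" for A
    using that by (induction A) (auto intro!: borel_measurable_times f)
  have int: "(\<integral>x. (\<Prod>v\<in>#A. f v x) \<partial>distr M N X) = (\<integral>\<omega>. (\<Prod>v\<in>#A. f v (X \<omega>)) \<partial>M)"
    if "set_mset A \<subseteq> V" for A
    by (rule integral_distr[OF X meas[OF that]])
  have 1: "integrable (distr M N X) (\<lambda>x. \<Prod>v\<in>#A. f v x) \<longleftrightarrow> integrable M (\<lambda>\<omega>. \<Prod>v\<in>#A. f v (X \<omega>))"
    if "set_mset A \<subseteq> V" for A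
    by (rule integrable_distr_eq[OF X meas[OF that]])
  have 2: "(\<integral>x. f v x * (\<Prod>w\<in>#A. f w x) \<partial>distr M N X) = (\<integral>\<omega>. f v (X \<omega>) * (\<Prod>w\<in>#A. f w (X \<omega>)) \<partial>M)"
    if "v \<in> V" "set_mset A \<subseteq> V" for v A
    using int[of "add_mset v A"] that by simp
  have 3: "(\<Sum>w\<in>#A. C v w * (\<integral>x. (\<Prod>u\<in>#A - {#w#}. f u x) \<partial>distr M N X)) =
     (\<Sum>w\<in>#A. C v w * (\<integral>\<omega>. (\<Prod>u\<in>#A - {#w#}. f u (X \<omega>)) \<partial>M))" if "set_mset A \<subseteq> V" for v A
    using that by (intro sum_mset_cong arg_cong2[where f = "(*)"] refl int) (auto dest: in_diffD)
  show ?thesis unfolding wick_def using 1 2 3 by (auto intro!: arg_cong2[where f = "(\<and>)"])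
qed

definition gauss_moment :: "nat \<Rightarrow> real" where
  "gauss_moment k = (\<integral>x. x ^ k \<partial>density lborel (\<lambda>x. ennreal (normal_density 0 (sqrt (1/2)) x)))"

lemma gauss_moment_integrable:
  "integrable (density lborel (\<lambda>x. ennreal (normal_density 0 (sqrt (1/2)) x))) (\<lambda>x. x ^ k)"
  using integrable_normal_moment[of "sqrt (1/2)" 0 k] by (subst integrable_density) auto

lemma gauss_moment_eq: "gauss_moment k = (LBINT x. normal_density 0 (sqrt (1/2)) x * x ^ k)"
  unfolding gauss_moment_def by (subst integral_density) auto

lemma gauss_moment_even: "gauss_moment (2 * k) = fact (2 * k) / (4 ^ k * fact k)"
  using integral_normal_moment_even[of "sqrt (1/2)" 0 k] by (simp add: gauss_moment_eq)

lemma gauss_moment_odd: "odd k \<Longrightarrow> gauss_moment k = 0"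
  using integral_normal_moment_odd[of "sqrt (1/2)" 0] by (auto simp: gauss_moment_eq elim!: oddE)

text \<open>One-dimensional integration by parts for variance 1/2, read off from the explicit
  moments. At \<open>k = 0\<close> the coefficient vanishes, so \<open>k - 1\<close> may be
  truncated.\<close>

lemma gauss_moment_Suc: "gauss_moment (Suc k) = real k / 2 * gauss_moment (k - 1)"
proof (cases "even k")
  case True
  then have "k = 0 \<or> odd (k - 1)" by auto
  then show ?thesis using True gauss_moment_odd[of "Suc k"] gauss_moment_odd[of "k - 1"] by auto
next
  case False
  then obtain j where k: "k = 2 * j + 1" by (elim oddE)
  have "gauss_moment (2 * Suc j) = real k / 2 * gauss_moment (2 * j)"
    unfolding gauss_moment_even k by (simp add: divide_simps)
  then show ?thesis by (simp add: k)
qed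

lemma std_complex_moment:
  shows "integrable std_complex_gaussian (\<lambda>z. complex_of_real (Re z) ^ a * complex_of_real (Im z) ^ b)" (is ?int)
    and "(\<integral>z. complex_of_real (Re z) ^ a * complex_of_real (Im z) ^ b \<partial>std_complex_gaussian) =
      complex_of_real (gauss_moment a * gauss_moment b)" (is ?val)
proof -
  define N where "N = density lborel (\<lambda>x. ennreal (normal_density 0 (sqrt (1/2)) x))"
  interpret N: prob_space N
    unfolding N_def by (rule prob_space_normal_density) simp
  interpret NN: pair_prob_space N N ..
  have sN: "sets N = sets borel" by (simp add: N_def)
  have [measurable]: "(\<lambda>p. Complex (fst p) (snd p)) \<in> borel_measurable (N \<Otimes>\<^sub>M N)"
    unfolding Complex_eq N_def by measurable
  have f [measurable]: "(\<lambda>z. complex_of_real (Re z) ^ a * complex_of_real (Im z) ^ b) \<in> borel_measurable borel"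
    by measurable
  have int1: "integrable N (\<lambda>x. complex_of_real x ^ k)" for k
    using gauss_moment_integrable[of k] unfolding N_def[symmetric] by (simp flip: of_real_power)
  have val1: "(\<integral>x. complex_of_real x ^ k \<partial>N) = complex_of_real (gauss_moment k)" for k
    unfolding gauss_moment_def N_def[symmetric] by (simp flip: of_real_power)
  have m1: "(\<lambda>p. complex_of_real (fst p) ^ a * complex_of_real (snd p) ^ b) \<in> borel_measurable (N \<Otimes>\<^sub>M N)"
    unfolding N_def by measurable
  have int2: "integrable (N \<Otimes>\<^sub>M N) (\<lambda>p. complex_of_real (fst p) ^ a * complex_of_real (snd p) ^ b)"
  proof (rule NN.Fubini_integrable[OF m1])
    show "integrable N (\<lambda>x. \<integral>y. norm (complex_of_real (fst (x, y)) ^ a * complex_of_real (snd (x, y)) ^ b) \<partial>N)"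
      using integrable_norm[OF int1[of a]] by (simp add: norm_mult)
    show "AE x in N. integrable N (\<lambda>y. complex_of_real (fst (x, y)) ^ a * complex_of_real (snd (x, y)) ^ b)"
      using int1[of b] by simp
  qed
  have dst: "std_complex_gaussian = distr (N \<Otimes>\<^sub>M N) borel (\<lambda>p. Complex (fst p) (snd p))"
    unfolding std_complex_gaussian_def Let_def N_def[symmetric] case_prod_beta ..
  show ?int
    unfolding dst by (subst integrable_distr_eq) (use int2 in auto)
  have "(\<integral>z. complex_of_real (Re z) ^ a * complex_of_real (Im z) ^ b \<partial>std_complex_gaussian) =
     (\<integral>p. complex_of_real (fst p) ^ a * complex_of_real (snd p) ^ b \<partial>(N \<Otimes>\<^sub>M N))"
    unfolding dst by (subst integral_distr) auto
  also have "\<dots> = (\<integral>x. \<integral>y. complex_of_real x ^ a * complex_of_real y ^ b \<partial>N \<partial>N)"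
    using NN.integral_fst'[OF int2] by simp
  also have "\<dots> = complex_of_real (gauss_moment a * gauss_moment b)"
    by (simp add: val1)
  finally show ?val .
qed

text \<open>The real coordinates of the family \<open>z\<close>, with \<open>True\<close> selecting
  the imaginary part; they are complex-valued so that \<open>wick_linear\<close> can recombine them
  with complex coefficients.\<close>

definition gauss_coord :: "'i \<times> bool \<Rightarrow> ('i \<Rightarrow> complex) \<Rightarrow> complex" where
  "gauss_coord v z = complex_of_real (if snd v then Im (z (fst v)) else Re (z (fst v)))"

lemma prod_Times_bool:
  "(\<Prod>v\<in>I \<times> (UNIV :: bool set). g v) = (\<Prod>i\<in>I. g (i, False) * g (i, True) :: 'a :: comm_monoid_mult)"
proof -
  have "(\<Prod>v\<in>I \<times> (UNIV :: bool set). g v) = (\<Prod>i\<in>I. \<Prod>b\<in>UNIV. g (i, b))"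
    by (simp add: prod.cartesian_product)
  then show ?thesis by (simp add: UNIV_bool)
qed

lemma gauss_coord_moment:
  fixes I :: "'i set"
  assumes I: "finite I" and A: "set_mset A \<subseteq> I \<times> UNIV"
  shows "integrable (PiM I (\<lambda>_. std_complex_gaussian)) (\<lambda>z. \<Prod>v\<in>#A. gauss_coord v z)"
    and "(\<integral>z. (\<Prod>v\<in>#A. gauss_coord v z) \<partial>PiM I (\<lambda>_. std_complex_gaussian)) =
      complex_of_real (\<Prod>v\<in>I \<times> UNIV. gauss_moment (count A v))"
proof -
  interpret G: prob_space std_complex_gaussian by (rule prob_space_std_complex_gaussian)
  interpret product_sigma_finite "\<lambda>_ :: 'i. std_complex_gaussian" ..
  have eq: "(\<Prod>v\<in>#A. gauss_coord v z) =
      (\<Prod>i\<in>I. complex_of_real (Re (z i)) ^ count A (i, False) * complex_of_real (Im (z i)) ^ count A (i, True))" for z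
    by (subst prod_mset_count_fun[OF A], simp add: I)
       (simp only: prod_Times_bool gauss_coord_def fst_conv snd_conv if_True if_False)
  show "integrable (PiM I (\<lambda>_. std_complex_gaussian)) (\<lambda>z. \<Prod>v\<in>#A. gauss_coord v z)"
    unfolding eq by (rule product_integrable_prod[OF I std_complex_moment(1)])
  show "(\<integral>z. (\<Prod>v\<in>#A. gauss_coord v z) \<partial>PiM I (\<lambda>_. std_complex_gaussian)) =
      complex_of_real (\<Prod>v\<in>I \<times> UNIV. gauss_moment (count A v))"
    unfolding eq
    by (subst product_integral_prod[OF I std_complex_moment(1)])
       (simp only: std_complex_moment(2) prod_Times_bool of_real_prod)
qed

text \<open>Moments are products over the coordinates. Multiplying by the coordinate
  \<open>v\<close> changes one factor only, to which \<open>gauss_moment_Suc\<close>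
  applies.\<close>

lemma wick_gauss_coord:
  fixes I :: "'i set"
  assumes I: "finite I"
  shows "wick (PiM I (\<lambda>_. std_complex_gaussian)) (I \<times> UNIV) gauss_coord (\<lambda>v w. if v = w then 1/2 else 0)"
  unfolding wick_def
proof (intro conjI allI impI ballI)
  let ?M = "PiM I (\<lambda>_. std_complex_gaussian)"
  fix A :: "('i \<times> bool) multiset" assume A: "set_mset A \<subseteq> I \<times> UNIV"
  show "integrable ?M (\<lambda>z. \<Prod>v\<in>#A. gauss_coord v z)"
    by (rule gauss_coord_moment(1)[OF I A])
  fix v :: "'i \<times> bool" assume v: "v \<in> I \<times> UNIV"
  have fin: "finite (I \<times> (UNIV :: bool set))" using I by simp
  define R where "R = (\<Prod>w\<in>I \<times> UNIV - {v}. gauss_moment (count A w))"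
  have R: "(\<Prod>w\<in>I \<times> UNIV - {v}. gauss_moment (count B w)) = R"
    if "\<And>w. w \<noteq> v \<Longrightarrow> count B w = count A w" for B
    unfolding R_def by (intro prod.cong refl) (metis that DiffD2 singletonI)
  have "set_mset (add_mset v A) \<subseteq> I \<times> UNIV" using v A by auto
  from gauss_coord_moment(2)[OF I this]
  have "(\<integral>z. gauss_coord v z * (\<Prod>w\<in>#A. gauss_coord w z) \<partial>?M) =
      complex_of_real (\<Prod>w\<in>I \<times> UNIV. gauss_moment (count (add_mset v A) w))" by simp
  also have "(\<Prod>w\<in>I \<times> UNIV. gauss_moment (count (add_mset v A) w)) = gauss_moment (Suc (count A v)) * R"
    by (subst prod.remove[OF fin v], subst R) auto
  also have "\<dots> = real (count A v) / 2 * (gauss_moment (count A v - 1) * R)"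
    by (simp add: gauss_moment_Suc)
  also have "gauss_moment (count A v - 1) * R = (\<Prod>w\<in>I \<times> UNIV. gauss_moment (count (A - {#v#}) w))"
    by (subst prod.remove[OF fin v], subst R) auto
  also have "complex_of_real (real (count A v) / 2 * \<dots>) =
      of_nat (count A v) / 2 * (\<integral>z. (\<Prod>u\<in>#A - {#v#}. gauss_coord u z) \<partial>?M)"
    by (subst gauss_coord_moment(2)[OF I]) (use A in \<open>auto dest: in_diffD\<close>)
  also have "\<dots> = (\<Sum>w\<in>#A. (if v = w then 1/2 else 0) * (\<integral>z. (\<Prod>u\<in>#A - {#w#}. gauss_coord u z) \<partial>?M))"
  proof -
    have "(\<Sum>w\<in>#B. (if v = w then 1/2 else 0) * f w) = of_nat (count B v) / 2 * (f v :: complex)" for B f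
      by (induction B) (auto simp: algebra_simps add_divide_distrib)
    then show ?thesis by simp
  qed
  finally show "(\<integral>z. gauss_coord v z * (\<Prod>w\<in>#A. gauss_coord w z) \<partial>?M) =
    (\<Sum>w\<in>#A. (if v = w then 1/2 else 0) * (\<integral>z. (\<Prod>u\<in>#A - {#w#}. gauss_coord u z) \<partial>?M))" .
qed

lemma wick_gue:
  assumes "is_gue M n X"
  shows "wick M ({..<n} \<times> {..<n}) (\<lambda>p \<omega>. X \<omega> $$ p) (\<lambda>p q. if q = prod.swap p then of_real (1/2) else 0)"
proof -
  define I where "I = {..<n} \<times> {..<n}"
  \<comment> \<open>Coefficients of the entry \<open>p\<close>, which is half of
    \<open>z p + cnj (z (prod.swap p))\<close>, in the real coordinates.\<close>
  define c :: "nat \<times> nat \<Rightarrow> (nat \<times> nat) \<times> bool \<Rightarrow> complex" where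
    "c = (\<lambda>p v. if snd v then \<i> * (of_bool (fst v = p) - of_bool (fst v = prod.swap p)) / 2
       else (of_bool (fst v = p) + of_bool (fst v = prod.swap p)) / 2)"
  define G :: "(nat \<times> nat \<Rightarrow> complex) \<Rightarrow> complex mat" where
    "G = (\<lambda>z. let Z = mat n n z in (1/2) \<cdot>\<^sub>m (Z + mat_adjoint Z))"
  have fin: "finite I" by (simp add: I_def)
  have sw: "prod.swap p \<in> I" if "p \<in> I" for p using that by (auto simp: I_def)
  have delta: "(\<Sum>r\<in>I. of_bool (r = p) * f r) = f p" if "p \<in> I" for p and f :: "nat \<times> nat \<Rightarrow> complex"
  proof -
    have "(\<Sum>r\<in>I. of_bool (r = p) * f r) = (\<Sum>r\<in>I. if r = p then f r else 0)" by (intro sum.cong) auto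
    then show ?thesis using that fin by simp
  qed
  have "wick (PiM I (\<lambda>_. std_complex_gaussian)) I (\<lambda>p z. G z $$ p) (\<lambda>p q. if q = prod.swap p then of_real (1/2) else 0)"
  proof (rule wick_cong[OF wick_linear[OF wick_gauss_coord[OF fin], where U = I and c = c]])
    fix p z assume p: "p \<in> I"
    have "(\<Sum>v\<in>I \<times> UNIV. c p v * gauss_coord v z) = (\<Sum>r\<in>I. \<Sum>b\<in>UNIV. c p (r, b) * gauss_coord (r, b) z)"
      by (simp add: sum.cartesian_product)
    also have "\<dots> = (\<Sum>r\<in>I. of_bool (r = p) * (z r / 2) + of_bool (r = prod.swap p) * (cnj (z r) / 2))"
      by (intro sum.cong refl) (auto simp: c_def gauss_coord_def UNIV_bool complex_eq_iff)
    also have "\<dots> = z p / 2 + cnj (z (prod.swap p)) / 2"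
      unfolding sum.distrib delta[OF p] delta[OF sw[OF p]] ..
    also have "\<dots> = G z $$ p"
      using p by (auto simp: G_def I_def Let_def)
    finally show "(\<Sum>v\<in>I \<times> UNIV. c p v * gauss_coord v z) = G z $$ p" .
  next
    fix p q assume p: "p \<in> I" and q: "q \<in> I"
    have "(\<Sum>v\<in>I \<times> UNIV. \<Sum>v'\<in>I \<times> UNIV. c p v * c q v' * (if v = v' then 1/2 else 0)) =
        (\<Sum>v\<in>I \<times> UNIV. c p v * c q v / 2)"
    proof (intro sum.cong refl)
      fix v :: "(nat \<times> nat) \<times> bool" assume v: "v \<in> I \<times> UNIV"
      have "(\<Sum>v'\<in>I \<times> UNIV. c p v * c q v' * (if v = v' then 1/2 else 0)) =
          (\<Sum>v'\<in>I \<times> UNIV. if v = v' then c p v * c q v' / 2 else 0)"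
        by (intro sum.cong) auto
      also have "\<dots> = c p v * c q v / 2" using v fin by (subst sum.delta') auto
      finally show "(\<Sum>v'\<in>I \<times> UNIV. c p v * c q v' * (if v = v' then 1/2 else 0)) = c p v * c q v / 2" .
    qed
    also have "\<dots> = (\<Sum>r\<in>I. \<Sum>b\<in>UNIV. c p (r, b) * c q (r, b) / 2)"
      by (simp add: sum.cartesian_product)
    \<comment> \<open>For each \<open>r\<close>, real and imaginary parts contribute products of
      deltas with opposite signs on \<open>p = q\<close> and equal signs on
      \<open>p = prod.swap q\<close>; only the latter survive.\<close>
    also have "\<dots> = (\<Sum>r\<in>I. of_bool (r = p) * (of_bool (r = prod.swap q) / 4) + of_bool (r = prod.swap p) * (of_bool (r = q) / 4))"
    proof (intro sum.cong refl)
      fix r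
      have "(\<Sum>b\<in>UNIV. c p (r, b) * c q (r, b) / 2) = c p (r, False) * c q (r, False) / 2 + c p (r, True) * c q (r, True) / 2"
        by (simp add: UNIV_bool add.commute)
      also have "\<dots> = of_bool (r = p) * (of_bool (r = prod.swap q) / 4) + of_bool (r = prod.swap p) * (of_bool (r = q) / 4)"
        unfolding c_def snd_conv fst_conv if_True if_False by (simp add: field_simps)
      finally show "(\<Sum>b\<in>UNIV. c p (r, b) * c q (r, b) / 2) = of_bool (r = p) * (of_bool (r = prod.swap q) / 4) + of_bool (r = prod.swap p) * (of_bool (r = q) / 4)" .
    qed
    also have "\<dots> = of_bool (p = prod.swap q) / 4 + of_bool (prod.swap p = q) / 4"
      unfolding sum.distrib delta[OF p] delta[OF sw[OF p]] ..
    also have "\<dots> = (if q = prod.swap p then of_real (1/2) else 0)"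
      by (auto simp: swap_eq_iff)
    finally show "(\<Sum>v\<in>I \<times> UNIV. \<Sum>v'\<in>I \<times> UNIV. c p v * c q v' * (if v = v' then 1/2 else 0)) = (if q = prod.swap p then of_real (1/2) else 0)" .
  qed (simp add: fin)
  moreover have entry: "(\<lambda>B. B $$ p) \<in> borel_measurable (mat_borel n)" if "p \<in> I" for p
    using that measurable_mat_borel_entry by (cases p) (auto simp: I_def)
  moreover have "G \<in> measurable (PiM I (\<lambda>_. std_complex_gaussian)) (mat_borel n)"
    unfolding G_def I_def by (rule measurable_gue_map)
  ultimately have "wick (gue n) I (\<lambda>p B. B $$ p) (\<lambda>p q. if q = prod.swap p then of_real (1/2) else 0)"
    unfolding gue_def G_def[symmetric] I_def[symmetric] by (subst wick_distr) auto
  moreover have "X \<in> measurable M (mat_borel n)" "gue n = distr M (mat_borel n) X"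
    using assms by (auto simp: is_gue_def)
  ultimately show ?thesis
    using wick_distr[of X M "mat_borel n" I "\<lambda>p B. B $$ p"] entry unfolding I_def by auto
qed

section \<open>Expected traces and the limit\<close>

section \<open>The limit\<close>

lemma measurable_mat_pow_entry:
  assumes "u < n" "v < n"
  shows "(\<lambda>B :: complex mat. (B ^\<^sub>m k) $$ (u, v)) \<in> borel_measurable (mat_borel n)"
  using assms(2)
proof (induction k arbitrary: v)
  case 0
  have "(\<lambda>B :: complex mat. (B ^\<^sub>m 0) $$ (u, v)) \<in> borel_measurable (mat_borel n) \<longleftrightarrow>
      (\<lambda>B :: complex mat. if u = v then 1 else 0 :: complex) \<in> borel_measurable (mat_borel n)"
    using assms(1) 0 by (intro measurable_cong) auto
  then show ?case by simp
next
  case (Suc k)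
  have "(\<lambda>B :: complex mat. (B ^\<^sub>m Suc k) $$ (u, v)) \<in> borel_measurable (mat_borel n) \<longleftrightarrow>
      (\<lambda>B :: complex mat. \<Sum>w<n. (B ^\<^sub>m k) $$ (u, w) * B $$ (w, v)) \<in> borel_measurable (mat_borel n)"
    using mult_mat_entry[OF pow_carrier_mat _ assms(1) Suc.prems, of _ _ k] by (intro measurable_cong) simp
  moreover have "(\<lambda>B :: complex mat. \<Sum>w<n. (B ^\<^sub>m k) $$ (u, w) * B $$ (w, v)) \<in> borel_measurable (mat_borel n)"
    using Suc.prems by (intro borel_measurable_sum borel_measurable_times Suc.IH measurable_mat_borel_entry) auto
  ultimately show ?case by blast
qed

text \<open>Through this, independence and equality in law pass from the matrices to the entries of
  their exponentials.\<close>

lemma measurable_mat_exp_entry: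
  assumes "u < n" "v < n"
  shows "(\<lambda>B. mat_exp B $$ (u, v)) \<in> borel_measurable (mat_borel n)"
proof -
  have "(\<lambda>B. mat_exp B $$ (u, v)) \<in> borel_measurable (mat_borel n) \<longleftrightarrow>
     (\<lambda>B. \<Sum>k. (B ^\<^sub>m k) $$ (u, v) / fact k) \<in> borel_measurable (mat_borel n)"
    using assms by (intro measurable_cong) (auto simp: mat_exp_def)
  moreover have "(\<lambda>B :: complex mat. \<Sum>k. (B ^\<^sub>m k) $$ (u, v) / fact k) \<in> borel_measurable (mat_borel n)"
    by (intro borel_measurable_suminf borel_measurable_divide borel_measurable_const measurable_mat_pow_entry assms)
  ultimately show ?thesis by blast
qed

lemma is_gue_gue_matrix:
  assumes "prob_space M" "is_gue M n X"
  shows "gue_matrix M n X (1/2)"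
proof -
  interpret prob_space M by fact
  have "X \<omega> \<in> carrier_mat n n" if "\<omega> \<in> space M" for \<omega>
    using measurable_space[of X M "mat_borel n" \<omega>] assms(2) that by (simp add: is_gue_def)
  moreover have "AE \<omega> in M. mat_adjoint (X \<omega>) = X \<omega>"
    using is_gue_hermitian[OF assms(2)] by eventually_elim simp
  ultimately show ?thesis
    by unfold_locales (use wick_gue[OF assms(2)] in auto)
qed

text \<open>Covariances of independent families add, and \<open>1/2 + 1/2 = 1\<close>.\<close>

lemma is_gue_sum_gue_matrix:
  assumes M: "prob_space M" and X: "is_gue M n X" and Y: "is_gue M n Y"
    and indep: "prob_space.indep_var M (mat_borel n) X (mat_borel n) Y"
  shows "gue_matrix M n (\<lambda>\<omega>. X \<omega> + Y \<omega>) 1"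
proof -
  interpret prob_space M by fact
  interpret GX: gue_matrix M n X "1/2" by (rule is_gue_gue_matrix[OF M X])
  interpret GY: gue_matrix M n Y "1/2" by (rule is_gue_gue_matrix[OF M Y])
  have meas: "(\<lambda>B. \<Prod>p\<in>#A. B $$ p) \<in> borel_measurable (mat_borel n)"
    if "set_mset A \<subseteq> {..<n} \<times> {..<n}" for A
    using that by (induction A) (auto intro!: borel_measurable_times measurable_mat_borel_entry)
  have "wick M ({..<n} \<times> {..<n}) (\<lambda>p \<omega>. X \<omega> $$ p + Y \<omega> $$ p)
      (\<lambda>p q. (if q = prod.swap p then of_real (1/2) else 0) + (if q = prod.swap p then of_real (1/2) else 0))"
  proof (rule wick_indep_add[OF GX.wick GY.wick])
    fix A B :: "(nat \<times> nat) multiset"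
    assume "set_mset A \<subseteq> {..<n} \<times> {..<n}" "set_mset B \<subseteq> {..<n} \<times> {..<n}"
    from indep_var_compose[OF indep meas[OF this(1)] meas[OF this(2)]]
    show "indep_var borel (\<lambda>\<omega>. \<Prod>v\<in>#A. X \<omega> $$ v) borel (\<lambda>\<omega>. \<Prod>v\<in>#B. Y \<omega> $$ v)"
      by (simp add: comp_def)
  qed simp
  then have "wick M ({..<n} \<times> {..<n}) (\<lambda>p \<omega>. (X \<omega> + Y \<omega>) $$ p) (\<lambda>p q. if q = prod.swap p then of_real 1 else 0)"
  proof (rule wick_cong)
    fix p \<omega> assume "p \<in> {..<n} \<times> {..<n}" and \<omega>: "\<omega> \<in> space M"
    then show "X \<omega> $$ p + Y \<omega> $$ p = (X \<omega> + Y \<omega>) $$ p"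
      using GY.X_carrier[OF \<omega>] by (cases p) auto
  qed auto
  moreover have "X \<omega> + Y \<omega> \<in> carrier_mat n n" if "\<omega> \<in> space M" for \<omega>
    using GX.X_carrier[OF that] GY.X_carrier[OF that] by simp
  moreover have "AE \<omega> in M. mat_adjoint (X \<omega> + Y \<omega>) = X \<omega> + Y \<omega>"
    using is_gue_hermitian[OF X] is_gue_hermitian[OF Y]
  proof eventually_elim
    case (elim \<omega>)
    show ?case
    proof (rule eq_matI)
      fix i j assume "i < dim_row (X \<omega> + Y \<omega>)" "j < dim_col (X \<omega> + Y \<omega>)"
      then have ij: "i < n" "j < n" using elim by auto
      then have "cnj (X \<omega> $$ (j, i)) = X \<omega> $$ (i, j)" "cnj (Y \<omega> $$ (j, i)) = Y \<omega> $$ (i, j)"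
        using elim mat_adjoint_index[of i "X \<omega>" j] mat_adjoint_index[of i "Y \<omega>" j] by auto
      then show "mat_adjoint (X \<omega> + Y \<omega>) $$ (i, j) = (X \<omega> + Y \<omega>) $$ (i, j)"
        using ij elim by auto
    qed (use elim in auto)
  qed
  ultimately show ?thesis by unfold_locales auto
qed

lemma gue_alpha_bounds:
  assumes n: "n \<ge> 1" and M: "prob_space M" and X: "is_gue M n X" and Y: "is_gue M n Y"
    and indep: "prob_space.indep_var M (mat_borel n) X (mat_borel n) Y"
  obtains a b where
    "(\<integral>\<omega>. mat_trace (mat_exp (X \<omega>) * mat_exp (Y \<omega>)) \<partial>M) = complex_of_real a"
    "(\<integral>\<omega>. mat_trace (mat_exp (X \<omega> + Y \<omega>)) \<partial>M) = complex_of_real b"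
    "real n * (exp_lower (1/2) n)\<^sup>2 \<le> a" "a \<le> (real n)\<^sup>2 * (exp_upper (1/2) n)\<^sup>2"
    "real n * exp_lower 1 n \<le> b" "b \<le> real n * exp_upper 1 n"
proof -
  interpret prob_space M by fact
  interpret GX: gue_matrix M n X "1/2" by (rule is_gue_gue_matrix[OF M X])
  interpret GY: gue_matrix M n Y "1/2" by (rule is_gue_gue_matrix[OF M Y])
  interpret GS: gue_matrix M n "\<lambda>\<omega>. X \<omega> + Y \<omega>" 1 by (rule is_gue_sum_gue_matrix[OF M X Y indep])
  \<comment> \<open>\<open>q\<close> is the mean of the exponential of \<open>X\<close>; by equality
    in law it is also that of \<open>Y\<close>, so \<open>a\<close> is the trace of the square of
    the matrix \<open>q\<close>.\<close>
  define q where "q = GX.exp_mean"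
  define a where "a = (\<Sum>u<n. \<Sum>v<n. q u v * q v u)"
  define b where "b = (\<Sum>u<n. GS.exp_mean u u)"
  have dX: "distr M (mat_borel n) X = distr M (mat_borel n) Y"
    and mX: "X \<in> measurable M (mat_borel n)" and mY: "Y \<in> measurable M (mat_borel n)"
    using X Y by (auto simp: is_gue_def)
  have qY: "GY.exp_mean u v = q u v" if "u < n" "v < n" for u v
  proof -
    have "complex_of_real (GY.exp_mean u v) = (\<integral>B. mat_exp B $$ (u, v) \<partial>distr M (mat_borel n) Y)"
      by (simp only: integral_distr[OF mY measurable_mat_exp_entry[OF that]] GY.mat_exp_integral(2)[OF that])
    also have "\<dots> = complex_of_real (q u v)"
      by (simp only: dX[symmetric] integral_distr[OF mX measurable_mat_exp_entry[OF that]] GX.mat_exp_integral(2)[OF that] q_def)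
    finally show ?thesis by simp
  qed
  have ind: "indep_var borel (\<lambda>\<omega>. mat_exp (X \<omega>) $$ (u, v)) borel (\<lambda>\<omega>. mat_exp (Y \<omega>) $$ (v, u))" if "u < n" "v < n" for u v
    using indep_var_compose[OF indep measurable_mat_exp_entry[OF that] measurable_mat_exp_entry[OF that(2,1)]]
    by (simp add: comp_def)
  have int: "integrable M (\<lambda>\<omega>. mat_exp (X \<omega>) $$ (u, v) * mat_exp (Y \<omega>) $$ (v, u))" if "u < n" "v < n" for u v
    using that by (intro indep_var_integrable ind GX.mat_exp_integral(1) GY.mat_exp_integral(1))
  have num: "(\<integral>\<omega>. mat_trace (mat_exp (X \<omega>) * mat_exp (Y \<omega>)) \<partial>M) = complex_of_real a"
  proof -
    have "(\<integral>\<omega>. mat_trace (mat_exp (X \<omega>) * mat_exp (Y \<omega>)) \<partial>M) =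
        (\<integral>\<omega>. (\<Sum>u<n. \<Sum>v<n. mat_exp (X \<omega>) $$ (u, v) * mat_exp (Y \<omega>) $$ (v, u)) \<partial>M)"
    proof (rule Bochner_Integration.integral_cong[OF refl])
      fix \<omega> assume \<omega>: "\<omega> \<in> space M"
      note c = mat_exp_carrier[OF GX.X_carrier[OF \<omega>]] mat_exp_carrier[OF GY.X_carrier[OF \<omega>]]
      show "mat_trace (mat_exp (X \<omega>) * mat_exp (Y \<omega>)) = (\<Sum>u<n. \<Sum>v<n. mat_exp (X \<omega>) $$ (u, v) * mat_exp (Y \<omega>) $$ (v, u))"
        unfolding mat_trace_def using c
        by (intro sum.cong mult_mat_entry[OF c]) (auto simp del: index_mult_mat(1))
    qed
    also have "\<dots> = (\<Sum>u<n. \<integral>\<omega>. (\<Sum>v<n. mat_exp (X \<omega>) $$ (u, v) * mat_exp (Y \<omega>) $$ (v, u)) \<partial>M)"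
      by (intro Bochner_Integration.integral_sum Bochner_Integration.integrable_sum int) auto
    also have "\<dots> = (\<Sum>u<n. \<Sum>v<n. (\<integral>\<omega>. mat_exp (X \<omega>) $$ (u, v) * mat_exp (Y \<omega>) $$ (v, u) \<partial>M))"
      by (intro sum.cong refl Bochner_Integration.integral_sum int) auto
    also have "\<dots> = (\<Sum>u<n. \<Sum>v<n. complex_of_real (q u v * q v u))"
    proof (intro sum.cong refl)
      fix u v assume "u \<in> {..<n}" "v \<in> {..<n}"
      then have uv: "u < n" "v < n" by auto
      show "(\<integral>\<omega>. mat_exp (X \<omega>) $$ (u, v) * mat_exp (Y \<omega>) $$ (v, u) \<partial>M) = complex_of_real (q u v * q v u)"
        using indep_var_lebesgue_integral[OF ind[OF uv] GX.mat_exp_integral(1)[OF uv] GY.mat_exp_integral(1)[OF uv(2,1)]]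
          GX.mat_exp_integral(2)[OF uv] GY.mat_exp_integral(2)[OF uv(2,1)] qY[OF uv(2,1)] by (simp add: q_def)
    qed
    finally show ?thesis by (simp add: a_def)
  qed
  have den: "(\<integral>\<omega>. mat_trace (mat_exp (X \<omega> + Y \<omega>)) \<partial>M) = complex_of_real b"
  proof -
    have "(\<integral>\<omega>. mat_trace (mat_exp (X \<omega> + Y \<omega>)) \<partial>M) = (\<integral>\<omega>. (\<Sum>u<n. mat_exp (X \<omega> + Y \<omega>) $$ (u, u)) \<partial>M)"
    proof (rule Bochner_Integration.integral_cong[OF refl])
      fix \<omega> assume "\<omega> \<in> space M"
      from mat_exp_carrier[OF GS.X_carrier[OF this]]
      show "mat_trace (mat_exp (X \<omega> + Y \<omega>)) = (\<Sum>u<n. mat_exp (X \<omega> + Y \<omega>) $$ (u, u))"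
        by (simp add: mat_trace_def)
    qed
    also have "\<dots> = (\<Sum>u<n. \<integral>\<omega>. mat_exp (X \<omega> + Y \<omega>) $$ (u, u) \<partial>M)"
      by (intro Bochner_Integration.integral_sum GS.mat_exp_integral(1)) auto
    also have "\<dots> = complex_of_real b"
      by (simp add: b_def GS.mat_exp_integral(2))
    finally show ?thesis .
  qed
  have q0: "0 \<le> q u v" if "v < n" for u v unfolding q_def by (rule GX.exp_mean_nonneg[OF that])
  have qU: "q u v \<le> exp_upper (1/2) n" if "v < n" for u v unfolding q_def by (rule GX.exp_mean_le[OF that])
  \<comment> \<open>Cauchy-Schwarz bounds the squared trace of \<open>q\<close> by \<open>n\<close>
    times the sum of its squared diagonal entries; the off-diagonal products in \<open>a\<close> are
    nonnegative and may be added.\<close>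
  have "real n * (real n * (exp_lower (1/2) n)\<^sup>2) = (real n * exp_lower (1/2) n)\<^sup>2"
    by (simp add: power2_eq_square)
  also have "\<dots> \<le> (\<Sum>u<n. q u u)\<^sup>2"
    unfolding q_def using exp_lower_pos[of "1/2" n] n by (intro power_mono GX.exp_mean_trace_ge) auto
  also have "\<dots> \<le> real n * (\<Sum>u<n. (q u u)\<^sup>2)"
    using sum_squared_le_sum_of_squares[of "\<lambda>u. q u u" "{..<n}"] by (simp add: mult.commute)
  also have "\<dots> \<le> real n * a"
    unfolding a_def
  proof (intro mult_left_mono sum_mono)
    fix u assume u: "u \<in> {..<n}"
    show "(q u u)\<^sup>2 \<le> (\<Sum>v<n. q u v * q v u)"
      using u member_le_sum[of u "{..<n}" "\<lambda>v. q u v * q v u"] q0 by (simp add: power2_eq_square)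
  qed simp
  finally have 1: "real n * (exp_lower (1/2) n)\<^sup>2 \<le> a"
    using n by simp
  have "a \<le> (\<Sum>u<n. \<Sum>v<n. exp_upper (1/2) n * exp_upper (1/2) n)"
    unfolding a_def using q0 qU order_trans[OF q0 qU] by (intro sum_mono mult_mono) auto
  then have 2: "a \<le> (real n)\<^sup>2 * (exp_upper (1/2) n)\<^sup>2"
    by (simp add: power2_eq_square)
  have "b \<le> (\<Sum>u<n. exp_upper 1 n)"
    unfolding b_def by (intro sum_mono GS.exp_mean_le) auto
  then have 3: "b \<le> real n * exp_upper 1 n" by simp
  show ?thesis
    using that[OF num den 1 2 _ 3] GS.exp_mean_trace_ge unfolding b_def by blast
qed

theorem theorem3p7:
  fixes M :: "nat \<Rightarrow> 'w measure"
    and X Y :: "nat \<Rightarrow> 'w \<Rightarrow> complex mat"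
    and \<alpha> :: "nat \<Rightarrow> complex"
  assumes "\<And>n. n \<ge> 1 \<Longrightarrow> prob_space (M n)"
    and "\<And>n. n \<ge> 1 \<Longrightarrow> is_gue (M n) n (X n)"
    and "\<And>n. n \<ge> 1 \<Longrightarrow> is_gue (M n) n (Y n)"
    and "\<And>n. n \<ge> 1 \<Longrightarrow> prob_space.indep_var (M n) (mat_borel n) (X n) (mat_borel n) (Y n)"
    and "\<And>n. n \<ge> 1 \<Longrightarrow> \<alpha> n =
           prob_space.expectation (M n) (\<lambda>\<omega>. mat_trace (mat_exp (X n \<omega>) * mat_exp (Y n \<omega>)))
         / prob_space.expectation (M n) (\<lambda>\<omega>. mat_trace (mat_exp (X n \<omega> + Y n \<omega>)))"
  shows "(\<lambda>n. ln (Re (\<alpha> n)) / sqrt (real n)) \<longlonglongrightarrow> 2 * (sqrt 2 - 1)"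
proof -
  define l u L U where "l = (\<lambda>n. ln (exp_lower (1/2) n) / sqrt (real n))"
    and "u = (\<lambda>n. ln (exp_upper (1/2) n) / sqrt (real n))"
    and "L = (\<lambda>n. ln (exp_lower 1 n) / sqrt (real n))"
    and "U = (\<lambda>n. ln (exp_upper 1 n) / sqrt (real n))"
  \<comment> \<open>The numerator contains two exponentials with \<open>\<kappa> = 1/2\<close>, the
    denominator one with \<open>\<kappa> = 1\<close>.\<close>
  have s2: "2 * (2 * sqrt (1/2)) - 2 * sqrt 1 = 2 * (sqrt 2 - 1)"
    by (simp add: real_sqrt_divide field_simps)
  have lim: "l \<longlonglongrightarrow> 2 * sqrt (1/2)" "u \<longlonglongrightarrow> 2 * sqrt (1/2)" "L \<longlonglongrightarrow> 2 * sqrt 1" "U \<longlonglongrightarrow> 2 * sqrt 1"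
    unfolding l_def u_def L_def U_def by (rule ln_exp_lower ln_exp_upper; simp)+
  have lnn: "(\<lambda>n. ln (real n) / sqrt (real n)) \<longlonglongrightarrow> 0"
    by real_asymp
  \<comment> \<open>In the lower bound the logarithms of the polynomial factors cancel; in the upper
    bound one \<open>ln n\<close> remains and vanishes after division by
    \<open>sqrt n\<close>.\<close>
  have bounds: "2 * l n - U n \<le> ln (Re (\<alpha> n)) / sqrt (real n) \<and>
      ln (Re (\<alpha> n)) / sqrt (real n) \<le> 2 * u n - L n + ln (real n) / sqrt (real n)" if n: "n \<ge> 1" for n
  proof -
    obtain a b where ab:
      "(\<integral>\<omega>. mat_trace (mat_exp (X n \<omega>) * mat_exp (Y n \<omega>)) \<partial>M n) = complex_of_real a"
      "(\<integral>\<omega>. mat_trace (mat_exp (X n \<omega> + Y n \<omega>)) \<partial>M n) = complex_of_real b"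
      "real n * (exp_lower (1/2) n)\<^sup>2 \<le> a" "a \<le> (real n)\<^sup>2 * (exp_upper (1/2) n)\<^sup>2"
      "real n * exp_lower 1 n \<le> b" "b \<le> real n * exp_upper 1 n"
      using gue_alpha_bounds[OF n assms(1)[OF n] assms(2)[OF n] assms(3)[OF n] assms(4)[OF n]] by blast
    have \<alpha>: "Re (\<alpha> n) = a / b"
      using assms(5)[OF n] unfolding ab(1,2) by simp
    have pos: "exp_lower (1/2) n > 0" "exp_lower 1 n > 0" "exp_upper (1/2) n > 0" "exp_upper 1 n > 0"
      using n by (auto intro!: exp_lower_pos less_le_trans[OF exp_lower_pos exp_lower_le_upper])
    have n0: "real n > 0" using n by simp
    have "0 < real n * (exp_lower (1/2) n)\<^sup>2" "0 < real n * exp_lower 1 n" using n0 pos by simp_all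
    with ab have a0: "a > 0" and b0: "b > 0" by linarith+
    have "ln a \<ge> ln (real n * (exp_lower (1/2) n)\<^sup>2)" using ab a0 n0 pos by (intro ln_mono) auto
    then have la: "ln a \<ge> ln (real n) + 2 * ln (exp_lower (1/2) n)" using n0 pos by (simp add: ln_mult ln_realpow)
    have "ln a \<le> ln ((real n)\<^sup>2 * (exp_upper (1/2) n)\<^sup>2)" using ab a0 n0 pos by (intro ln_mono) auto
    then have ua: "ln a \<le> 2 * ln (real n) + 2 * ln (exp_upper (1/2) n)" using n0 pos by (simp add: ln_mult ln_realpow)
    have "ln b \<ge> ln (real n * exp_lower 1 n)" using ab b0 n0 pos by (intro ln_mono) auto
    then have lb: "ln b \<ge> ln (real n) + ln (exp_lower 1 n)" using n0 pos by (simp add: ln_mult)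
    have "ln b \<le> ln (real n * exp_upper 1 n)" using ab b0 n0 pos by (intro ln_mono) auto
    then have ub: "ln b \<le> ln (real n) + ln (exp_upper 1 n)" using n0 pos by (simp add: ln_mult)
    have "ln (Re (\<alpha> n)) = ln a - ln b" using a0 b0 by (simp add: \<alpha> ln_div)
    then have "2 * ln (exp_lower (1/2) n) - ln (exp_upper 1 n) \<le> ln (Re (\<alpha> n))"
      "ln (Re (\<alpha> n)) \<le> 2 * ln (exp_upper (1/2) n) - ln (exp_lower 1 n) + ln (real n)"
      using la ua lb ub by linarith+
    from this[THEN divide_right_mono, of "sqrt (real n)"] show ?thesis
      by (simp add: l_def u_def L_def U_def diff_divide_distrib add_divide_distrib)
  qed
  show ?thesis
  proof (rule tendsto_sandwich)
    show "\<forall>\<^sub>F n in sequentially. 2 * l n - U n \<le> ln (Re (\<alpha> n)) / sqrt (real n)"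
      using eventually_ge_at_top[of 1] by eventually_elim (use bounds in blast)
    show "\<forall>\<^sub>F n in sequentially. ln (Re (\<alpha> n)) / sqrt (real n) \<le> 2 * u n - L n + ln (real n) / sqrt (real n)"
      using eventually_ge_at_top[of 1] by eventually_elim (use bounds in blast)
    show "(\<lambda>n. 2 * l n - U n) \<longlonglongrightarrow> 2 * (sqrt 2 - 1)"
      unfolding s2[symmetric] by (intro tendsto_intros lim)
    have "(\<lambda>n. 2 * u n - L n + ln (real n) / sqrt (real n)) \<longlonglongrightarrow> 2 * (2 * sqrt (1/2)) - 2 * sqrt 1 + 0"
      by (intro tendsto_intros lim lnn)
    then show "(\<lambda>n. 2 * u n - L n + ln (real n) / sqrt (real n)) \<longlonglongrightarrow> 2 * (sqrt 2 - 1)"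
      by (simp only: s2 add_0_right)
  qed
qed

end
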